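(* Let $R$ be a $\mathbb{Z}$-graded graded-commutative noetherian ring and let $\mathsf{T}$ be a graded $R$-linear triangulated category that is strongly generated, Ext-finite and idempotent complete. Let $\mathsf{f} \colon \mathsf{T}^{op} \to \operatorname{grMod}(R)$ be a graded $R$-linear cohomological functor. Then $\mathsf{f}$ is graded representable if and only if $\mathsf{f}$ is locally finite, that is, if and only if $\mathsf{f}(X)$ is a finitely generated graded $R$-module for every object $X$ of $\mathsf{T}$.
   Context: Graded modules. A $\mathbb{Z}$-graded ring $R=\coprod_{d} R_d$ is graded-commutative if $rs=(-1)^{de}sr$ for $r\in R_d$, $s\in R_e$. $\operatorname{grMod}(R)$ is the category of graded $R$-modules with degree-preserving $R$-linear maps, and $\operatorname{grmod}(R)$ its full subcategory of finitely generated modules. The shift is $(M[n])_d=M_{n+d}$, where a homogeneous $r\in R$ acts on $M[n]$ by $(-1)^{n|r|}$ times its action on $M$ (Koszul sign convention). Graded linear categories. Let $\mathsf{T}$ be a triangulated category with suspension $\Sigma$. Write $\operatorname{Ext}^*_{\mathsf{T}}(X,Y)=\coprod_{d\in\mathbb{Z}}\operatorname{Hom}_{\mathsf{T}}(X,\Sigma^d Y)$. The graded center is $\operatorname{Z}(\mathsf{T})=\coprod_{d}\{\eta\colon \operatorname{id}_{\mathsf{T}}\to\Sigma^d \mid \eta\Sigma=(-1)^d\Sigma\eta\}$. $\mathsf{T}$ is graded $R$-linear if it is equipped with a homomorphism of graded rings $\varphi\colon R\to \operatorname{Z}(\mathsf{T})$; then $\operatorname{Ext}^*_{\mathsf{T}}(X,Y)$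 is a graded $R$-module via $r\cdot h=\varphi(r)_{\Sigma^eY}\circ h=(\Sigma^{|r|}h)\circ\varphi(r)_X$ for $h\in\operatorname{Hom}_{\mathsf{T}}(X,\Sigma^eY)$ and homogeneous $r$. Graded linear functors. A functor $\mathsf{f}\colon\mathsf{T}^{op}\to\operatorname{grMod}(R)$ is graded $R$-linear if (i) $\mathsf{f}(\Sigma^nX)=\mathsf{f}(X)[-n]$ naturally in $X$, for all $n$; and (ii) the induced map from $\operatorname{Ext}^*_{\mathsf{T}}(X,Y)$ to the graded module $\coprod_d\operatorname{Hom}_{\operatorname{grMod}(R)}(\mathsf{f}(Y),\mathsf{f}(X)[d])$, sending $h\colon X\to\Sigma^dY$ to $\mathsf{f}(h)\colon \mathsf{f}(Y)[-d]\to \mathsf{f}(X)$ viewed as a degree $d$ map $\mathsf{f}(Y)\to\mathsf{f}(X)$, is a map of graded $R$-modules, where $(r\alpha)(m)=r\,\alpha(m)$. It is cohomological if it sends exact triangles to long exact sequences of graded $R$-modules. Natural transformations between graded $R$-linear functors are required to respect this structure (components are degree-preserving and $R$-linear, and compatible with the identifications in (i)). For $X\in\mathsf{T}$ let $\mathsf{g}_X=\operatorname{Ext}^*_{\mathsf{T}}(-,X)\colon\mathsf{T}^{op}\to\operatorname{grMod}(R)$, with the natural identification $\operatorname{Ext}^*_{\mathsf{T}}(\Sigma^nY,X)\cong\operatorname{Ext}^*_{\mathsf{T}}(Y,X)[-n]$ induced by $\Sigma^{-n}$. A functor is graded representable if it is naturally isomorphic to $\mathsf{g}_X$ for some $X\in\mathsf{T}$.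 $\mathsf{T}$ is Ext-finite if $\operatorname{Ext}^*_{\mathsf{T}}(X,Y)$ is a finitely generated graded $R$-module for all $X,Y\in\mathsf{T}$. $\mathsf{T}$ is idempotent complete if every idempotent endomorphism in $\mathsf{T}$ splits. Strong generation. For $G\in\mathsf{T}$ let $\operatorname{thick}^1(G)$ be the smallest full subcategory containing $G$ and closed under finite coproducts, retracts and (positive and negative) suspensions; for $n\ge2$ let $\operatorname{thick}^n(G)$ be the full subcategory of all $X$ for which there are $X'\in\mathsf{T}$ and an exact triangle $Y\to X\oplus X'\to Z\to\Sigma Y$ with $Y\in\operatorname{thick}^{n-1}(G)$ and $Z\in\operatorname{thick}^1(G)$. $\mathsf{T}$ is strongly generated if $\mathsf{T}=\operatorname{thick}^n(G)$ for some $G$ and some integer $n \geq 1$. *)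

theory Defs
  imports "HOL-Algebra.Module"
begin

section \<open>Graded-commutative noetherian rings\<close>

record 'r graded_ring = "'r ring" +
  grading :: "int \<Rightarrow> 'r set"

text \<open>The sign $(-1)^k$ acting on an additive abelian group.\<close>

definition signed :: "('a, 'b) ring_scheme \<Rightarrow> int \<Rightarrow> 'a \<Rightarrow> 'a" where
  "signed A k x = (if even k then x else \<ominus>\<^bsub>A\<^esub> x)"

locale graded_ring = ring R for R :: "('r, 'z) graded_ring_scheme" (structure) +
  assumes grading_subgroup: "subgroup (grading R d) (add_monoid R)"
    and grading_one: "\<one> \<in> grading R 0"
    and grading_mult: "\<lbrakk>r \<in> grading R d; s \<in> grading R e\<rbrakk> \<Longrightarrow> r \<otimes> s \<in> grading R (d + e)"
    and grading_decomp: "x \<in> carrier R \<Longrightarrow>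
      \<exists>!c. (\<forall>d. c d \<in> grading R d) \<and> finite {d. c d \<noteq> \<zero>} \<and> x = (\<Oplus>d\<in>{d. c d \<noteq> \<zero>}. c d)"

locale graded_commutative_ring = graded_ring +
  assumes graded_comm:
    "\<lbrakk>r \<in> grading R d; s \<in> grading R e\<rbrakk> \<Longrightarrow> r \<otimes> s = signed R (d * e) (s \<otimes> r)"

text \<open>The predicate \<open>noetherian_ring\<close> of the library speaks about two-sided ideals. As a
  graded-commutative ring need not be commutative, noetherian is taken here in the usual sense for
  arbitrary rings: all left and all right ideals are finitely generated.\<close>

definition left_ideal :: "('r, 'z) ring_scheme \<Rightarrow> 'r set \<Rightarrow> bool" where
  "left_ideal R I \<longleftrightarrow> subgroup I (add_monoid R) \<and> (\<forall>r\<in>carrier R. \<forall>x\<in>I. r \<otimes>\<^bsub>R\<^esub> x \<in> I)"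

definition right_ideal :: "('r, 'z) ring_scheme \<Rightarrow> 'r set \<Rightarrow> bool" where
  "right_ideal R I \<longleftrightarrow> subgroup I (add_monoid R) \<and> (\<forall>r\<in>carrier R. \<forall>x\<in>I. x \<otimes>\<^bsub>R\<^esub> r \<in> I)"

definition left_right_noetherian :: "('r, 'z) ring_scheme \<Rightarrow> bool" where
  "left_right_noetherian R \<longleftrightarrow>
     (\<forall>I. left_ideal R I \<longrightarrow> (\<exists>A. finite A \<and> A \<subseteq> carrier R \<and> I = \<Inter>{J. left_ideal R J \<and> A \<subseteq> J})) \<and>
     (\<forall>I. right_ideal R I \<longrightarrow> (\<exists>A. finite A \<and> A \<subseteq> carrier R \<and> I = \<Inter>{J. right_ideal R J \<and> A \<subseteq> J}))"


section \<open>Graded modules\<close>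

text \<open>A graded module is given by its homogeneous components \<open>gpart M d\<close>. As in the library's
  record for modules, the components are additive groups; the multiplicative fields of the
  \<open>ring\<close> record are ignored. The action of $r \in R_d$ on $x \in M_e$ is \<open>gact M d e r x\<close>; the
  degrees are arguments because $0 \in R_d$ for all $d$ and the components of $M$ may overlap.\<close>

record ('r, 'x) graded_module =
  gpart :: "int \<Rightarrow> 'x ring"
  gact :: "int \<Rightarrow> int \<Rightarrow> 'r \<Rightarrow> 'x \<Rightarrow> 'x"

abbreviation gcar :: "('r, 'x) graded_module \<Rightarrow> int \<Rightarrow> 'x set" where
  "gcar M d \<equiv> carrier (gpart M d)"

locale graded_module = graded_ring R for R :: "('r, 'z) graded_ring_scheme" (structure) +
  fixes M :: "('r, 'x) graded_module"
  assumes gpart_group: "abelian_group (gpart M d)"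
    and gact_closed: "\<lbrakk>r \<in> grading R d; x \<in> gcar M e\<rbrakk> \<Longrightarrow> gact M d e r x \<in> gcar M (d + e)"
    and gact_add_left: "\<lbrakk>r \<in> grading R d; s \<in> grading R d; x \<in> gcar M e\<rbrakk> \<Longrightarrow>
      gact M d e (r \<oplus> s) x = gact M d e r x \<oplus>\<^bsub>gpart M (d + e)\<^esub> gact M d e s x"
    and gact_add_right: "\<lbrakk>r \<in> grading R d; x \<in> gcar M e; y \<in> gcar M e\<rbrakk> \<Longrightarrow>
      gact M d e r (x \<oplus>\<^bsub>gpart M e\<^esub> y) = gact M d e r x \<oplus>\<^bsub>gpart M (d + e)\<^esub> gact M d e r y"
    and gact_assoc: "\<lbrakk>r \<in> grading R d; s \<in> grading R e; x \<in> gcar M n\<rbrakk> \<Longrightarrow>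
      gact M (d + e) n (r \<otimes> s) x = gact M d (e + n) r (gact M e n s x)"
    and gact_one: "x \<in> gcar M e \<Longrightarrow> gact M 0 e \<one> x = x"

text \<open>Morphisms of \<open>grMod(R)\<close>, as families of maps indexed by the degree. Only the values on the
  components of the source matter.\<close>

definition gmod_hom ::
  "('r, 'z) graded_ring_scheme \<Rightarrow> ('r, 'x) graded_module \<Rightarrow> ('r, 'y) graded_module \<Rightarrow>
   (int \<Rightarrow> 'x \<Rightarrow> 'y) \<Rightarrow> bool" where
  "gmod_hom R M N \<alpha> \<longleftrightarrow>
     (\<forall>d. \<forall>x\<in>gcar M d. \<alpha> d x \<in> gcar N d) \<and>
     (\<forall>d. \<forall>x\<in>gcar M d. \<forall>y\<in>gcar M d. \<alpha> d (x \<oplus>\<^bsub>gpart M d\<^esub> y) = \<alpha> d x \<oplus>\<^bsub>gpart N d\<^esub> \<alpha> d y) \<and>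
     (\<forall>d e. \<forall>r\<in>grading R d. \<forall>x\<in>gcar M e. \<alpha> (d + e) (gact M d e r x) = gact N d e r (\<alpha> e x))"

definition gmod_iso ::
  "('r, 'z) graded_ring_scheme \<Rightarrow> ('r, 'x) graded_module \<Rightarrow> ('r, 'y) graded_module \<Rightarrow>
   (int \<Rightarrow> 'x \<Rightarrow> 'y) \<Rightarrow> bool" where
  "gmod_iso R M N \<alpha> \<longleftrightarrow> gmod_hom R M N \<alpha> \<and> (\<forall>d. bij_betw (\<alpha> d) (gcar M d) (gcar N d))"

definition gshift :: "('r, 'x) graded_module \<Rightarrow> int \<Rightarrow> ('r, 'x) graded_module" where
  "gshift M n = \<lparr>gpart = (\<lambda>d. gpart M (n + d)),
     gact = (\<lambda>d e r x. signed (gpart M (d + (n + e))) (n * d) (gact M d (n + e) r x))\<rparr>"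

text \<open>The graded module $\coprod_d \mathrm{Hom}_{\mathrm{grMod}(R)}(M, N[d])$. Note that
  $(r\alpha)(m) = r\,\alpha(m)$ uses the action on $N$ itself, without the sign of $N[d]$.\<close>

definition ghom ::
  "('r, 'z) graded_ring_scheme \<Rightarrow> ('r, 'x) graded_module \<Rightarrow> ('r, 'y) graded_module \<Rightarrow>
   ('r, int \<Rightarrow> 'x \<Rightarrow> 'y) graded_module" where
  "ghom R M N = \<lparr>
     gpart = (\<lambda>d. \<lparr>
       carrier = {\<alpha>. gmod_hom R M (gshift N d) \<alpha> \<and> (\<forall>e. \<alpha> e \<in> extensional (gcar M e))},
       monoid.mult = undefined, one = undefined,
       zero = (\<lambda>e. \<lambda>x\<in>gcar M e. \<zero>\<^bsub>gpart N (d + e)\<^esub>),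
       add = (\<lambda>\<alpha> \<beta> e. \<lambda>x\<in>gcar M e. \<alpha> e x \<oplus>\<^bsub>gpart N (d + e)\<^esub> \<beta> e x)\<rparr>),
     gact = (\<lambda>a d r \<alpha> e. \<lambda>x\<in>gcar M e. gact N a (d + e) r (\<alpha> e x))\<rparr>"

text \<open>Generated by finitely many homogeneous elements; a generator \<open>a\<close> of degree \<open>d\<close> is the
  pair \<open>(d, a)\<close>.\<close>

definition gfin_gen :: "('r, 'z) graded_ring_scheme \<Rightarrow> ('r, 'x) graded_module \<Rightarrow> bool" where
  "gfin_gen R M \<longleftrightarrow> (\<exists>A. finite A \<and> (\<forall>(d, a)\<in>A. a \<in> gcar M d) \<and>
     (\<forall>n. \<forall>x\<in>gcar M n. \<exists>c. (\<forall>(d, a)\<in>A. c (d, a) \<in> grading R (n - d)) \<and>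
        x = finsum (gpart M n) (\<lambda>(d, a). gact M (n - d) d (c (d, a)) a) A))"


section \<open>Triangulated categories\<close>

record ('o, 'm) category =
  Obj :: "'o set"
  Arr :: "'m set"
  Dom :: "'m \<Rightarrow> 'o"
  Cod :: "'m \<Rightarrow> 'o"
  Idn :: "'o \<Rightarrow> 'm"
  Comp :: "'m \<Rightarrow> 'm \<Rightarrow> 'm"  (infixr \<open>\<cdot>\<index>\<close> 75)

definition hom_set :: "('o, 'm, 'z) category_scheme \<Rightarrow> 'o \<Rightarrow> 'o \<Rightarrow> 'm set" where
  "hom_set T X Y = {f \<in> Arr T. Dom T f = X \<and> Cod T f = Y}"

locale category =
  fixes T :: "('o, 'm, 'z) category_scheme" (structure)
  assumes Dom_Obj: "f \<in> Arr T \<Longrightarrow> Dom T f \<in> Obj T"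
    and Cod_Obj: "f \<in> Arr T \<Longrightarrow> Cod T f \<in> Obj T"
    and Idn_hom: "X \<in> Obj T \<Longrightarrow> Idn T X \<in> hom_set T X X"
    and Comp_hom: "\<lbrakk>f \<in> hom_set T X Y; g \<in> hom_set T Y Z\<rbrakk> \<Longrightarrow> g \<cdot> f \<in> hom_set T X Z"
    and Comp_Idn: "f \<in> hom_set T X Y \<Longrightarrow> f \<cdot> Idn T X = f"
    and Idn_Comp: "f \<in> hom_set T X Y \<Longrightarrow> Idn T Y \<cdot> f = f"
    and Comp_assoc: "\<lbrakk>f \<in> hom_set T W X; g \<in> hom_set T X Y; h \<in> hom_set T Y Z\<rbrakk> \<Longrightarrow>
      (h \<cdot> g) \<cdot> f = h \<cdot> (g \<cdot> f)"

record ('o, 'm) preadd_category = "('o, 'm) category" +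
  Zero_arr :: "'o \<Rightarrow> 'o \<Rightarrow> 'm"
  Add_arr :: "'m \<Rightarrow> 'm \<Rightarrow> 'm"

definition hom_group :: "('o, 'm, 'z) preadd_category_scheme \<Rightarrow> 'o \<Rightarrow> 'o \<Rightarrow> 'm ring" where
  "hom_group T X Y = \<lparr>carrier = hom_set T X Y, monoid.mult = undefined, one = undefined,
     zero = Zero_arr T X Y, add = Add_arr T\<rparr>"

locale preadditive_category = category T
  for T :: "('o, 'm, 'z) preadd_category_scheme" (structure) +
  assumes hom_abelian_group: "\<lbrakk>X \<in> Obj T; Y \<in> Obj T\<rbrakk> \<Longrightarrow> abelian_group (hom_group T X Y)"
    and Comp_add_left: "\<lbrakk>f \<in> hom_set T X Y; g \<in> hom_set T Y Z; h \<in> hom_set T Y Z\<rbrakk> \<Longrightarrow>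
      (Add_arr T g h) \<cdot> f = Add_arr T (g \<cdot> f) (h \<cdot> f)"
    and Comp_add_right: "\<lbrakk>f \<in> hom_set T X Y; g \<in> hom_set T X Y; h \<in> hom_set T Y Z\<rbrakk> \<Longrightarrow>
      h \<cdot> (Add_arr T f g) = Add_arr T (h \<cdot> f) (h \<cdot> g)"

definition zero_object :: "('o, 'm, 'z) category_scheme \<Rightarrow> 'o \<Rightarrow> bool" where
  "zero_object T N \<longleftrightarrow>
     N \<in> Obj T \<and> (\<forall>X\<in>Obj T. (\<exists>!f. f \<in> hom_set T N X) \<and> (\<exists>!f. f \<in> hom_set T X N))"

text \<open>\<open>S\<close> is the direct sum of \<open>X\<close> and \<open>Y\<close>; in a preadditive category this is the same as being
  a coproduct.\<close>

definition direct_sum :: "('o, 'm, 'z) preadd_category_scheme \<Rightarrow> 'o \<Rightarrow> 'o \<Rightarrow> 'o \<Rightarrow> bool" where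
  "direct_sum T X Y S \<longleftrightarrow> X \<in> Obj T \<and> Y \<in> Obj T \<and> S \<in> Obj T \<and>
     (\<exists>i\<in>hom_set T X S. \<exists>j\<in>hom_set T Y S. \<exists>p\<in>hom_set T S X. \<exists>q\<in>hom_set T S Y.
        p \<cdot>\<^bsub>T\<^esub> i = Idn T X \<and> q \<cdot>\<^bsub>T\<^esub> j = Idn T Y \<and>
        q \<cdot>\<^bsub>T\<^esub> i = Zero_arr T X Y \<and> p \<cdot>\<^bsub>T\<^esub> j = Zero_arr T Y X \<and>
        Add_arr T (i \<cdot>\<^bsub>T\<^esub> p) (j \<cdot>\<^bsub>T\<^esub> q) = Idn T S)"

locale additive_category = preadditive_category +
  assumes zero_object_exists: "\<exists>N. zero_object T N"
    and direct_sum_exists: "\<lbrakk>X \<in> Obj T; Y \<in> Obj T\<rbrakk> \<Longrightarrow> \<exists>S. direct_sum T X Y S"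

definition iso_arr :: "('o, 'm, 'z) category_scheme \<Rightarrow> 'm \<Rightarrow> bool" where
  "iso_arr T f \<longleftrightarrow> f \<in> Arr T \<and> (\<exists>g\<in>hom_set T (Cod T f) (Dom T f).
     g \<cdot>\<^bsub>T\<^esub> f = Idn T (Dom T f) \<and> f \<cdot>\<^bsub>T\<^esub> g = Idn T (Cod T f))"

text \<open>The suspension is an automorphism, given by its effect on objects and on morphisms, so that
  $\Sigma^n$ is defined for all integers $n$ and $\Sigma^{m+n} = \Sigma^m \Sigma^n$.
  A triangle $X \to Y \to Z \to \Sigma X$ is the triple of its morphisms.\<close>

record ('o, 'm) triang_category = "('o, 'm) preadd_category" +
  Sus_ob :: "'o \<Rightarrow> 'o"
  Sus_arr :: "'m \<Rightarrow> 'm"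
  Triangles :: "('m \<times> 'm \<times> 'm) set"

locale triangulated_category = additive_category T
  for T :: "('o, 'm, 'z) triang_category_scheme" (structure) +
  assumes Sus_ob_bij: "bij_betw (Sus_ob T) (Obj T) (Obj T)"
    and Sus_arr_bij: "bij_betw (Sus_arr T) (Arr T) (Arr T)"
    and Sus_hom: "f \<in> hom_set T X Y \<Longrightarrow> Sus_arr T f \<in> hom_set T (Sus_ob T X) (Sus_ob T Y)"
    and Sus_Idn: "X \<in> Obj T \<Longrightarrow> Sus_arr T (Idn T X) = Idn T (Sus_ob T X)"
    and Sus_Comp: "\<lbrakk>f \<in> hom_set T X Y; g \<in> hom_set T Y Z\<rbrakk> \<Longrightarrow>
      Sus_arr T (g \<cdot> f) = Sus_arr T g \<cdot> Sus_arr T f"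
    and Sus_add: "\<lbrakk>f \<in> hom_set T X Y; g \<in> hom_set T X Y\<rbrakk> \<Longrightarrow>
      Sus_arr T (Add_arr T f g) = Add_arr T (Sus_arr T f) (Sus_arr T g)"
    and triangle_homs: "(u, v, w) \<in> Triangles T \<Longrightarrow>
      \<exists>X Y Z. u \<in> hom_set T X Y \<and> v \<in> hom_set T Y Z \<and> w \<in> hom_set T Z (Sus_ob T X)"
    and triangle_iso: "\<lbrakk>(u, v, w) \<in> Triangles T;
        u' \<in> hom_set T X' Y'; v' \<in> hom_set T Y' Z'; w' \<in> hom_set T Z' (Sus_ob T X');
        a \<in> hom_set T (Dom T u) X'; b \<in> hom_set T (Dom T v) Y'; c \<in> hom_set T (Dom T w) Z';
        iso_arr T a; iso_arr T b; iso_arr T c;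
        b \<cdot> u = u' \<cdot> a; c \<cdot> v = v' \<cdot> b; Sus_arr T a \<cdot> w = w' \<cdot> c\<rbrakk> \<Longrightarrow>
      (u', v', w') \<in> Triangles T"
    and triangle_Idn: "\<lbrakk>X \<in> Obj T; zero_object T N\<rbrakk> \<Longrightarrow>
      (Idn T X, Zero_arr T X N, Zero_arr T N (Sus_ob T X)) \<in> Triangles T"
    and triangle_cone: "u \<in> Arr T \<Longrightarrow> \<exists>v w. (u, v, w) \<in> Triangles T"
    and triangle_rotate: "\<lbrakk>u \<in> hom_set T X Y; v \<in> hom_set T Y Z; w \<in> hom_set T Z (Sus_ob T X)\<rbrakk> \<Longrightarrow>
      (u, v, w) \<in> Triangles T \<longleftrightarrow>
      (v, w, \<ominus>\<^bsub>hom_group T (Sus_ob T X) (Sus_ob T Y)\<^esub> Sus_arr T u) \<in> Triangles T"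
    and triangle_morphism: "\<lbrakk>(u, v, w) \<in> Triangles T; (u', v', w') \<in> Triangles T;
        a \<in> hom_set T (Dom T u) (Dom T u'); b \<in> hom_set T (Dom T v) (Dom T v');
        b \<cdot> u = u' \<cdot> a\<rbrakk> \<Longrightarrow>
      \<exists>c\<in>hom_set T (Dom T w) (Dom T w'). c \<cdot> v = v' \<cdot> b \<and> Sus_arr T a \<cdot> w = w' \<cdot> c"
    and triangle_octahedral: "\<lbrakk>u \<in> hom_set T X Y; v \<in> hom_set T Y Z;
        (u, u\<^sub>1, u\<^sub>2) \<in> Triangles T; (v, v\<^sub>1, v\<^sub>2) \<in> Triangles T; (v \<cdot> u, w\<^sub>1, w\<^sub>2) \<in> Triangles T\<rbrakk> \<Longrightarrow>
      \<exists>s t. (s, t, Sus_arr T u\<^sub>1 \<cdot> v\<^sub>2) \<in> Triangles T \<and>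
        s \<in> hom_set T (Cod T u\<^sub>1) (Cod T w\<^sub>1) \<and> t \<in> hom_set T (Cod T w\<^sub>1) (Cod T v\<^sub>1) \<and>
        s \<cdot> u\<^sub>1 = w\<^sub>1 \<cdot> v \<and> w\<^sub>2 \<cdot> s = u\<^sub>2 \<and> t \<cdot> w\<^sub>1 = v\<^sub>1 \<and> v\<^sub>2 \<cdot> t = Sus_arr T u \<cdot> w\<^sub>2"

definition sus_ob :: "('o, 'm, 'z) triang_category_scheme \<Rightarrow> int \<Rightarrow> 'o \<Rightarrow> 'o" where
  "sus_ob T n X = (if 0 \<le> n then (Sus_ob T ^^ nat n) X
     else (inv_into (Obj T) (Sus_ob T) ^^ nat (- n)) X)"

definition sus_arr :: "('o, 'm, 'z) triang_category_scheme \<Rightarrow> int \<Rightarrow> 'm \<Rightarrow> 'm" where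
  "sus_arr T n f = (if 0 \<le> n then (Sus_arr T ^^ nat n) f
     else (inv_into (Arr T) (Sus_arr T) ^^ nat (- n)) f)"

definition idempotent_complete :: "('o, 'm, 'z) category_scheme \<Rightarrow> bool" where
  "idempotent_complete T \<longleftrightarrow> (\<forall>X\<in>Obj T. \<forall>e\<in>hom_set T X X. e \<cdot>\<^bsub>T\<^esub> e = e \<longrightarrow>
     (\<exists>Y\<in>Obj T. \<exists>p\<in>hom_set T X Y. \<exists>i\<in>hom_set T Y X. i \<cdot>\<^bsub>T\<^esub> p = e \<and> p \<cdot>\<^bsub>T\<^esub> i = Idn T Y))"


subsection \<open>Strong generation\<close>

definition retract :: "('o, 'm, 'z) category_scheme \<Rightarrow> 'o \<Rightarrow> 'o \<Rightarrow> bool" where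
  "retract T Y X \<longleftrightarrow> Y \<in> Obj T \<and> X \<in> Obj T \<and>
     (\<exists>i\<in>hom_set T Y X. \<exists>p\<in>hom_set T X Y. p \<cdot>\<^bsub>T\<^esub> i = Idn T Y)"

text \<open>Full subcategories are given by their sets of objects.\<close>

inductive_set thick1 :: "('o, 'm, 'z) triang_category_scheme \<Rightarrow> 'o \<Rightarrow> 'o set"
  for T :: "('o, 'm, 'z) triang_category_scheme" and G :: 'o where
  thick1_base: "G \<in> thick1 T G"
| thick1_zero: "zero_object T N \<Longrightarrow> N \<in> thick1 T G"
| thick1_sum: "\<lbrakk>X \<in> thick1 T G; Y \<in> thick1 T G; direct_sum T X Y S\<rbrakk> \<Longrightarrow> S \<in> thick1 T G"
| thick1_retract: "\<lbrakk>X \<in> thick1 T G; retract T Y X\<rbrakk> \<Longrightarrow> Y \<in> thick1 T G"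
| thick1_sus: "X \<in> thick1 T G \<Longrightarrow> sus_ob T n X \<in> thick1 T G"

text \<open>\<open>thick T G n\<close> is only meaningful for \<open>n \<ge> 1\<close>.\<close>

fun thick :: "('o, 'm, 'z) triang_category_scheme \<Rightarrow> 'o \<Rightarrow> nat \<Rightarrow> 'o set" where
  "thick T G 0 = {}"
| "thick T G (Suc 0) = thick1 T G"
| "thick T G (Suc (Suc n)) = {X \<in> Obj T. \<exists>X'\<in>Obj T. \<exists>S. direct_sum T X X' S \<and>
     (\<exists>Y\<in>thick T G (Suc n). \<exists>Z\<in>thick1 T G. \<exists>(u, v, w)\<in>Triangles T.
        u \<in> hom_set T Y S \<and> v \<in> hom_set T S Z \<and> w \<in> hom_set T Z (Sus_ob T Y))}"

definition strongly_generated :: "('o, 'm, 'z) triang_category_scheme \<Rightarrow> bool" where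
  "strongly_generated T \<longleftrightarrow> (\<exists>G\<in>Obj T. \<exists>n\<ge>1. Obj T = thick T G n)"


section \<open>Graded linear triangulated categories\<close>

text \<open>The component of degree \<open>d\<close> of the graded center, and its operations.\<close>

definition graded_center :: "('o, 'm, 'z) triang_category_scheme \<Rightarrow> int \<Rightarrow> ('o \<Rightarrow> 'm) set" where
  "graded_center T d = {\<eta> \<in> (\<Pi>\<^sub>E X\<in>Obj T. hom_set T X (sus_ob T d X)).
     (\<forall>X\<in>Obj T. \<forall>Y\<in>Obj T. \<forall>f\<in>hom_set T X Y. \<eta> Y \<cdot>\<^bsub>T\<^esub> f = sus_arr T d f \<cdot>\<^bsub>T\<^esub> \<eta> X) \<and>
     (\<forall>X\<in>Obj T. \<eta> (Sus_ob T X) =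
        signed (hom_group T (Sus_ob T X) (sus_ob T d (Sus_ob T X))) d (Sus_arr T (\<eta> X)))}"

definition center_add ::
  "('o, 'm, 'z) triang_category_scheme \<Rightarrow> ('o \<Rightarrow> 'm) \<Rightarrow> ('o \<Rightarrow> 'm) \<Rightarrow> 'o \<Rightarrow> 'm" where
  "center_add T \<eta> \<theta> = (\<lambda>X\<in>Obj T. Add_arr T (\<eta> X) (\<theta> X))"

definition center_mult ::
  "('o, 'm, 'z) triang_category_scheme \<Rightarrow> int \<Rightarrow> ('o \<Rightarrow> 'm) \<Rightarrow> ('o \<Rightarrow> 'm) \<Rightarrow> 'o \<Rightarrow> 'm" where
  \<comment> \<open>\<open>e\<close> is the degree of \<open>\<theta>\<close>\<close>
  "center_mult T e \<eta> \<theta> = (\<lambda>X\<in>Obj T. \<eta> (sus_ob T e X) \<cdot>\<^bsub>T\<^esub> \<theta> X)"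

definition center_one :: "('o, 'm, 'z) triang_category_scheme \<Rightarrow> 'o \<Rightarrow> 'm" where
  "center_one T = (\<lambda>X\<in>Obj T. Idn T X)"

text \<open>\<open>\<phi> d\<close> is the degree \<open>d\<close> part of the homomorphism of graded rings from \<open>R\<close> to the graded
  center.\<close>

locale graded_linear_category = R: graded_commutative_ring R + triangulated_category T
  for R :: "('r, 'y) graded_ring_scheme" and T :: "('o, 'm, 'z) triang_category_scheme" +
  fixes \<phi> :: "int \<Rightarrow> 'r \<Rightarrow> 'o \<Rightarrow> 'm"
  assumes phi_center: "r \<in> grading R d \<Longrightarrow> \<phi> d r \<in> graded_center T d"
    and phi_add: "\<lbrakk>r \<in> grading R d; s \<in> grading R d\<rbrakk> \<Longrightarrow>
      \<phi> d (r \<oplus>\<^bsub>R\<^esub> s) = center_add T (\<phi> d r) (\<phi> d s)"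
    and phi_mult: "\<lbrakk>r \<in> grading R d; s \<in> grading R e\<rbrakk> \<Longrightarrow>
      \<phi> (d + e) (r \<otimes>\<^bsub>R\<^esub> s) = center_mult T e (\<phi> d r) (\<phi> e s)"
    and phi_one: "\<phi> 0 \<one>\<^bsub>R\<^esub> = center_one T"

definition Ext :: "('o, 'm, 'z) triang_category_scheme \<Rightarrow> (int \<Rightarrow> 'r \<Rightarrow> 'o \<Rightarrow> 'm) \<Rightarrow>
   'o \<Rightarrow> 'o \<Rightarrow> ('r, 'm) graded_module" where
  "Ext T \<phi> X Y = \<lparr>gpart = (\<lambda>d. hom_group T X (sus_ob T d Y)),
     gact = (\<lambda>d e r h. \<phi> d r (sus_ob T e Y) \<cdot>\<^bsub>T\<^esub> h)\<rparr>"

definition Ext_finite :: "('r, 'y) graded_ring_scheme \<Rightarrow> ('o, 'm, 'z) triang_category_scheme \<Rightarrow>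
   (int \<Rightarrow> 'r \<Rightarrow> 'o \<Rightarrow> 'm) \<Rightarrow> bool" where
  "Ext_finite R T \<phi> \<longleftrightarrow> (\<forall>X\<in>Obj T. \<forall>Y\<in>Obj T. gfin_gen R (Ext T \<phi> X Y))"


section \<open>Graded linear functors\<close>

text \<open>A contravariant functor to graded modules together with the identifications
  \<open>Fsh F n X\<close> of $F(\Sigma^n X)$ with $F(X)[-n]$.\<close>

record ('o, 'm, 'r, 'x) graded_functor =
  Fob :: "'o \<Rightarrow> ('r, 'x) graded_module"
  Farr :: "'m \<Rightarrow> int \<Rightarrow> 'x \<Rightarrow> 'x"
  Fsh :: "int \<Rightarrow> 'o \<Rightarrow> int \<Rightarrow> 'x \<Rightarrow> 'x"

text \<open>For $h \colon X \to \Sigma^d Y$, the map $F(h) \colon F(Y)[-d] \to F(X)$ viewed as a map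
  $F(Y) \to F(X)[d]$.\<close>

definition degree_map :: "('o, 'm, 'z) triang_category_scheme \<Rightarrow>
   ('o, 'm, 'r, 'x) graded_functor \<Rightarrow> 'o \<Rightarrow> int \<Rightarrow> 'm \<Rightarrow> int \<Rightarrow> 'x \<Rightarrow> 'x" where
  "degree_map T F Y d h e = (\<lambda>x\<in>gcar (Fob F Y) e.
     Farr F h (d + e) (inv_into (gcar (Fob F (sus_ob T d Y)) (d + e)) (Fsh F d Y (d + e)) x))"

text \<open>The equality $F(\Sigma^n X) = F(X)[-n]$ of the literature is rendered by a system of natural
  isomorphisms that is compatible with $\Sigma^{m+n} = \Sigma^m \Sigma^n$
  and $[-(m+n)] = [-n][-m]$.\<close>

locale graded_linear_functor = graded_linear_category R T \<phi>
  for R :: "('r, 'y) graded_ring_scheme" and T :: "('o, 'm, 'z) triang_category_scheme"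
    and \<phi> :: "int \<Rightarrow> 'r \<Rightarrow> 'o \<Rightarrow> 'm" +
  fixes F :: "('o, 'm, 'r, 'x) graded_functor"
  assumes Fob_module: "X \<in> Obj T \<Longrightarrow> graded_module R (Fob F X)"
    and Farr_hom: "h \<in> hom_set T X Y \<Longrightarrow> gmod_hom R (Fob F Y) (Fob F X) (Farr F h)"
    and Farr_Idn: "\<lbrakk>X \<in> Obj T; x \<in> gcar (Fob F X) e\<rbrakk> \<Longrightarrow> Farr F (Idn T X) e x = x"
    and Farr_Comp: "\<lbrakk>h \<in> hom_set T X Y; k \<in> hom_set T Y Z; x \<in> gcar (Fob F Z) e\<rbrakk> \<Longrightarrow>
      Farr F (k \<cdot>\<^bsub>T\<^esub> h) e x = Farr F h e (Farr F k e x)"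
    and Fsh_iso: "X \<in> Obj T \<Longrightarrow>
      gmod_iso R (Fob F (sus_ob T n X)) (gshift (Fob F X) (- n)) (Fsh F n X)"
    and Fsh_natural: "\<lbrakk>h \<in> hom_set T X Y; x \<in> gcar (Fob F (sus_ob T n Y)) e\<rbrakk> \<Longrightarrow>
      Fsh F n X e (Farr F (sus_arr T n h) e x) = Farr F h (- n + e) (Fsh F n Y e x)"
    and Fsh_coherent: "\<lbrakk>X \<in> Obj T; x \<in> gcar (Fob F (sus_ob T (m + n) X)) e\<rbrakk> \<Longrightarrow>
      Fsh F (m + n) X e x = Fsh F n X (- m + e) (Fsh F m (sus_ob T n X) e x)"
    and degree_map_hom: "\<lbrakk>X \<in> Obj T; Y \<in> Obj T\<rbrakk> \<Longrightarrow>
      gmod_hom R (Ext T \<phi> X Y) (ghom R (Fob F Y) (Fob F X)) (degree_map T F Y)"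

text \<open>Exactness at the middle term of the image under \<open>F\<close> of $A \xrightarrow{a} B \xrightarrow{b} C$.\<close>

definition exact_image :: "('o, 'm, 'z) triang_category_scheme \<Rightarrow>
   ('o, 'm, 'r, 'x) graded_functor \<Rightarrow> 'm \<Rightarrow> 'm \<Rightarrow> bool" where
  "exact_image T F a b \<longleftrightarrow> (\<forall>e.
     Farr F b e ` gcar (Fob F (Cod T b)) e =
     {x \<in> gcar (Fob F (Dom T b)) e. Farr F a e x = \<zero>\<^bsub>gpart (Fob F (Dom T a)) e\<^esub>})"

text \<open>The long exact sequence
  $\cdots \to F(\Sigma^{n+1} Y) \to F(\Sigma^{n+1} X) \to F(\Sigma^n Z) \to F(\Sigma^n Y)
  \to F(\Sigma^n X) \to \cdots$ of an exact triangle. Signs of the maps do not affect exactness.\<close>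

definition cohomological :: "('o, 'm, 'z) triang_category_scheme \<Rightarrow>
   ('o, 'm, 'r, 'x) graded_functor \<Rightarrow> bool" where
  "cohomological T F \<longleftrightarrow> (\<forall>(u, v, w)\<in>Triangles T. \<forall>n.
     exact_image T F (sus_arr T n u) (sus_arr T n v) \<and>
     exact_image T F (sus_arr T n v) (sus_arr T n w) \<and>
     exact_image T F (sus_arr T n w) (sus_arr T (n + 1) u))"

text \<open>The functor $\mathsf{g}_X = \mathrm{Ext}^*(-, X)$.\<close>

definition Ext_functor :: "('o, 'm, 'z) triang_category_scheme \<Rightarrow> (int \<Rightarrow> 'r \<Rightarrow> 'o \<Rightarrow> 'm) \<Rightarrow>
   'o \<Rightarrow> ('o, 'm, 'r, 'm) graded_functor" where
  "Ext_functor T \<phi> X = \<lparr>Fob = (\<lambda>Y. Ext T \<phi> Y X), Farr = (\<lambda>h e m. m \<cdot>\<^bsub>T\<^esub> h),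
     Fsh = (\<lambda>n Y e m. sus_arr T (- n) m)\<rparr>"

definition graded_natural_iso :: "('r, 'y) graded_ring_scheme \<Rightarrow>
   ('o, 'm, 'z) triang_category_scheme \<Rightarrow> ('o, 'm, 'r, 'x) graded_functor \<Rightarrow>
   ('o, 'm, 'r, 'w) graded_functor \<Rightarrow> ('o \<Rightarrow> int \<Rightarrow> 'x \<Rightarrow> 'w) \<Rightarrow> bool" where
  "graded_natural_iso R T F G \<tau> \<longleftrightarrow>
     (\<forall>X\<in>Obj T. gmod_iso R (Fob F X) (Fob G X) (\<tau> X)) \<and>
     (\<forall>X\<in>Obj T. \<forall>Y\<in>Obj T. \<forall>h\<in>hom_set T X Y. \<forall>e. \<forall>x\<in>gcar (Fob F Y) e.
        \<tau> X e (Farr F h e x) = Farr G h e (\<tau> Y e x)) \<and>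
     (\<forall>X\<in>Obj T. \<forall>n e. \<forall>x\<in>gcar (Fob F (sus_ob T n X)) e.
        \<tau> X (- n + e) (Fsh F n X e x) = Fsh G n X e (\<tau> (sus_ob T n X) e x))"

definition graded_representable :: "('r, 'y) graded_ring_scheme \<Rightarrow>
   ('o, 'm, 'z) triang_category_scheme \<Rightarrow> (int \<Rightarrow> 'r \<Rightarrow> 'o \<Rightarrow> 'm) \<Rightarrow>
   ('o, 'm, 'r, 'x) graded_functor \<Rightarrow> bool" where
  "graded_representable R T \<phi> F \<longleftrightarrow>
     (\<exists>X\<in>Obj T. \<exists>\<tau>. graded_natural_iso R T F (Ext_functor T \<phi> X) \<tau>)"

definition locally_finite :: "('r, 'y) graded_ring_scheme \<Rightarrow>
   ('o, 'm, 'z) triang_category_scheme \<Rightarrow> ('o, 'm, 'r, 'x) graded_functor \<Rightarrow> bool" where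
  "locally_finite R T F \<longleftrightarrow> (\<forall>X\<in>Obj T. gfin_gen R (Fob F X))"

end

theory Submission
  imports Defs
begin

text \<open>The functor \<open>F\<close> is determined by its part \<open>H(Y) = F(Y)\<^sub>0\<close>, because
  \<open>F(Y)\<^sub>d = H(\<Sigma>\<^sup>-\<^sup>d Y)\<close>. An element of \<open>H(A)\<close> is a morphism \<open>Ext\<^sup>*(-, A) \<rightarrow> F\<close>. If \<open>F(G)\<close> is
  finitely generated, a finite direct sum \<open>A\<^sub>0\<close> of suspensions of \<open>G\<close> and an element \<open>x\<^sub>0\<close> make this morphism
  surjective at \<open>G\<close>; its kernel at \<open>G\<close> is finitely generated since \<open>R\<close> is noetherian and
  \<open>Ext\<^sup>*(G, A\<^sub>0)\<close> is finitely generated, hence is hit by a map \<open>B \<rightarrow> A\<^sub>0\<close> annihilating \<open>x\<^sub>0\<close>, and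
  \<open>x\<^sub>0\<close> extends over the cone \<open>A\<^sub>1\<close>. Iterating gives a sequence \<open>A\<^sub>0 \<rightarrow> A\<^sub>1 \<rightarrow> \<dots>\<close> for which, by induction along
  the construction of \<open>thick\<^sup>n(G)\<close>, the comparison with \<open>F\<close> at every object of \<open>thick\<^sup>n(G)\<close> is
  surjective from stage \<open>n - 1\<close> on and has a kernel that dies after \<open>n\<close> steps. When
  \<open>thick\<^sup>n(G)\<close> is everything, \<open>F\<close> is therefore a retract of some \<open>Ext\<^sup>*(-, A\<^sub>j)\<close>, so
  it is represented by the image of an idempotent endomorphism of \<open>A\<^sub>j\<close>.\<close>

section \<open>Graded submodules over noetherian rings\<close>

text \<open>The sequence need not become stationary, and \<open>T\<close> need not have the
  coproducts that form its colimit. The bound on the number of extensions takes the place of the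
  colimit. Each extension is a four-lemma chase between the long exact sequences of
  \<open>Hom(-, A i)\<close> and of \<open>H\<close>. Such a chase asks for a composite that
  vanishes, while only its image in \<open>H\<close> is known to vanish; one transition map pays for
  the difference. So each extension costs one stage for surjectivity and one step for killing, and
  the total does not depend on the object. Finite generation over the ring enters only at
  \<open>G\<close>: kernel and image of a Yoneda map are graded submodules, so finitely many
  homogeneous elements control them in all degrees, hence at all suspensions of \<open>G\<close> at
  once. From there until the final return to all degrees the argument is about additive functors.
  Since noetherian is a condition on ungraded one-sided ideals and graded modules are families of
  components, ideals first have to be passed through their homogeneous components.\<close>

definition gsubmodule :: "('r, 'z) graded_ring_scheme \<Rightarrow> ('r, 'x) graded_module \<Rightarrow> (int \<Rightarrow> 'x set) \<Rightarrow> bool" where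
  "gsubmodule R M N \<longleftrightarrow>
     (\<forall>d. N d \<subseteq> gcar M d \<and> \<zero>\<^bsub>gpart M d\<^esub> \<in> N d \<and> (\<forall>x\<in>N d. \<forall>y\<in>N d. x \<oplus>\<^bsub>gpart M d\<^esub> y \<in> N d)) \<and>
     (\<forall>d e. \<forall>r\<in>grading R d. \<forall>x\<in>N e. gact M d e r x \<in> N (d + e))"

text \<open>An intersection, and not a set of linear combinations, because finite generation is used
  as a test: a graded submodule that contains the generators contains everything.\<close>

definition gspan :: "('r, 'z) graded_ring_scheme \<Rightarrow> ('r, 'x) graded_module \<Rightarrow> (int \<times> 'x) set \<Rightarrow> int \<Rightarrow> 'x set" where
  "gspan R M A n = \<Inter>{N n |N. gsubmodule R M N \<and> (\<forall>(d, a)\<in>A. a \<in> N d)}"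

definition gleft_ideal :: "('r, 'z) graded_ring_scheme \<Rightarrow> (int \<Rightarrow> 'r set) \<Rightarrow> bool" where
  "gleft_ideal R J \<longleftrightarrow>
     (\<forall>d. J d \<subseteq> grading R d \<and> \<zero>\<^bsub>R\<^esub> \<in> J d \<and> (\<forall>x\<in>J d. \<forall>y\<in>J d. x \<oplus>\<^bsub>R\<^esub> y \<in> J d)) \<and>
     (\<forall>d e. \<forall>r\<in>grading R d. \<forall>x\<in>J e. r \<otimes>\<^bsub>R\<^esub> x \<in> J (d + e))"

lemma (in abelian_monoid) finsum_closed_subset:
  assumes "finite S" "I \<subseteq> carrier G" "\<zero> \<in> I" "\<And>x y. x \<in> I \<Longrightarrow> y \<in> I \<Longrightarrow> x \<oplus> y \<in> I"
    and "\<And>s. s \<in> S \<Longrightarrow> g s \<in> I"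
  shows "finsum G g S \<in> I"
  using assms(1,5)
proof (induction S)
  case (insert s S)
  have "g \<in> S \<rightarrow> carrier G" "g s \<in> carrier G" using insert.prems assms(2) by auto
  then show ?case using insert assms(4) by simp
qed (use assms in simp)

section \<open>Homogeneous components and graded left ideals\<close>

context graded_ring
begin

lemma grading_carrier: "r \<in> grading R d \<Longrightarrow> r \<in> carrier R"
  using subgroup.subset[OF grading_subgroup] by auto

lemma grading_zero: "\<zero> \<in> grading R d"
  using subgroup.one_closed[OF grading_subgroup] by simp

lemma grading_add: "\<lbrakk>r \<in> grading R d; s \<in> grading R d\<rbrakk> \<Longrightarrow> r \<oplus> s \<in> grading R d"
  using subgroup.m_closed[OF grading_subgroup] by simp

lemma grading_minus: "r \<in> grading R d \<Longrightarrow> \<ominus> r \<in> grading R d"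
  using subgroup.m_inv_closed[OF grading_subgroup] by (simp add: a_inv_def)

text \<open>The homogeneous components of \<open>x\<close>, extracted from the unique decomposition
  in \<open>grading_decomp\<close>.\<close>

definition comp :: "'r \<Rightarrow> int \<Rightarrow> 'r" where
  "comp x = (THE c. (\<forall>d. c d \<in> grading R d) \<and> finite {d. c d \<noteq> \<zero>} \<and>
     x = (\<Oplus>d\<in>{d. c d \<noteq> \<zero>}. c d))"

lemma comp_props:
  assumes "x \<in> carrier R"
  shows "comp x d \<in> grading R d" "finite {d. comp x d \<noteq> \<zero>}"
    "x = (\<Oplus>d\<in>{d. comp x d \<noteq> \<zero>}. comp x d)"
  using theI'[OF grading_decomp[OF assms]] unfolding comp_def[symmetric] by auto

lemma comp_carrier: "x \<in> carrier R \<Longrightarrow> comp x d \<in> carrier R"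
  using comp_props(1) grading_carrier by blast

text \<open>\<open>S\<close> may be larger than the support: in a sum or a product terms can cancel,
  and then the exact support is out of reach.\<close>

lemma comp_eqI:
  assumes "finite S" "\<And>d. c d \<in> grading R d" "\<And>d. d \<notin> S \<Longrightarrow> c d = \<zero>" "x = (\<Oplus>d\<in>S. c d)"
  shows "comp x = c"
proof -
  have sub: "{d. c d \<noteq> \<zero>} \<subseteq> S" using assms(3) by auto
  have c: "\<And>d. c d \<in> carrier R" using assms(2) grading_carrier by blast
  have "(\<Oplus>d\<in>{d. c d \<noteq> \<zero>}. c d) = (\<Oplus>d\<in>S. c d)"
    by (rule add.finprod_mono_neutral_cong_left) (use assms(1) sub c in auto)
  then have *: "(\<forall>d. c d \<in> grading R d) \<and> finite {d. c d \<noteq> \<zero>} \<and> x = (\<Oplus>d\<in>{d. c d \<noteq> \<zero>}. c d)"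
    using assms finite_subset[OF sub] by auto
  have "x \<in> carrier R" unfolding assms(4) by (rule finsum_closed) (use c in auto)
  then show ?thesis unfolding comp_def using the1_equality[OF grading_decomp] * by blast
qed

lemma comp_sum:
  assumes "x \<in> carrier R" "finite S" "{d. comp x d \<noteq> \<zero>} \<subseteq> S"
  shows "x = (\<Oplus>d\<in>S. comp x d)"
proof -
  have "(\<Oplus>d\<in>{d. comp x d \<noteq> \<zero>}. comp x d) = (\<Oplus>d\<in>S. comp x d)"
    by (rule add.finprod_mono_neutral_cong_left) (use assms comp_carrier in auto)
  then show ?thesis using comp_props(3)[OF assms(1)] by simp
qed

lemma comp_homogeneous:
  assumes "x \<in> grading R d"
  shows "comp x = (\<lambda>e. if e = d then x else \<zero>)"
  by (rule comp_eqI[where S = "{d}"]) (use assms grading_zero grading_carrier in auto)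

lemma comp_add:
  assumes "x \<in> carrier R" "y \<in> carrier R"
  shows "comp (x \<oplus> y) = (\<lambda>d. comp x d \<oplus> comp y d)"
proof (rule comp_eqI)
  let ?S = "{d. comp x d \<noteq> \<zero>} \<union> {d. comp y d \<noteq> \<zero>}"
  show "finite ?S" using comp_props(2) assms by simp
  show "\<And>d. comp x d \<oplus> comp y d \<in> grading R d" using grading_add comp_props(1) assms by simp
  show "\<And>d. d \<notin> ?S \<Longrightarrow> comp x d \<oplus> comp y d = \<zero>" by simp
  have "(\<Oplus>d\<in>?S. comp x d \<oplus> comp y d) = (\<Oplus>d\<in>?S. comp x d) \<oplus> (\<Oplus>d\<in>?S. comp y d)"
    by (rule finsum_addf) (use comp_carrier assms in auto)
  then show "x \<oplus> y = (\<Oplus>d\<in>?S. comp x d \<oplus> comp y d)"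
    using comp_sum[of x ?S] comp_sum[of y ?S] assms comp_props(2) by simp
qed

lemma comp_mult_homogeneous:
  assumes "r \<in> grading R e" "x \<in> carrier R"
  shows "comp (r \<otimes> x) = (\<lambda>d. r \<otimes> comp x (d - e))"
proof (rule comp_eqI)
  let ?S = "{d. comp x d \<noteq> \<zero>}"
  have r: "r \<in> carrier R" using assms(1) grading_carrier by blast
  show "finite ((\<lambda>d. d + e) ` ?S)" using comp_props(2) assms by simp
  show "r \<otimes> comp x (d - e) \<in> grading R d" for d
    using grading_mult[OF assms(1) comp_props(1)[OF assms(2)], of "d - e"] by simp
  show "r \<otimes> comp x (d - e) = \<zero>" if "d \<notin> (\<lambda>d. d + e) ` ?S" for d
  proof -
    have "comp x (d - e) = \<zero>" using that by (force intro: image_eqI[where x = "d - e"])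
    then show ?thesis using r by simp
  qed
  have "(\<Oplus>d\<in>(\<lambda>d. d + e) ` ?S. r \<otimes> comp x (d - e)) = (\<Oplus>d\<in>?S. r \<otimes> comp x d)"
    by (subst finsum_reindex) (use r comp_carrier assms in \<open>auto simp: inj_on_def\<close>)
  also have "\<dots> = r \<otimes> (\<Oplus>d\<in>?S. comp x d)"
    by (rule finsum_rdistr[symmetric]) (use r comp_carrier comp_props(2) assms in auto)
  finally show "r \<otimes> x = (\<Oplus>d\<in>(\<lambda>d. d + e) ` ?S. r \<otimes> comp x (d - e))"
    using comp_props(3)[OF assms(2)] by simp
qed

text \<open>Multiplication by a homogeneous element shifts components, so it preserves the condition
  degree by degree; a general multiplier is a finite sum of homogeneous ones.\<close>

lemma left_ideal_of_gleft_ideal: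
  assumes J: "gleft_ideal R J"
  shows "left_ideal R {x \<in> carrier R. \<forall>d. comp x d \<in> J d}" (is "left_ideal R ?I")
proof -
  have zero: "\<zero> \<in> ?I" using J comp_homogeneous[OF grading_zero] by (simp add: gleft_ideal_def)
  have add: "x \<oplus> y \<in> ?I" if "x \<in> ?I" "y \<in> ?I" for x y
    using that J by (simp add: comp_add gleft_ideal_def)
  have hmul: "r \<otimes> x \<in> ?I" if "r \<in> grading R e" "x \<in> ?I" for r e x
  proof -
    have "r \<otimes> comp x (d - e) \<in> J d" for d
      using J that unfolding gleft_ideal_def
      by (metis (no_types, lifting) add.commute diff_add_cancel mem_Collect_eq)
    then show ?thesis using that grading_carrier by (auto simp: comp_mult_homogeneous)
  qed
  have mul: "r \<otimes> x \<in> ?I" if "r \<in> carrier R" "x \<in> ?I" for r x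
  proof -
    let ?S = "{d. comp r d \<noteq> \<zero>}"
    have x: "x \<in> carrier R" using that by simp
    have "r \<otimes> x = (\<Oplus>d\<in>?S. comp r d) \<otimes> x" using comp_props(3)[OF that(1)] by simp
    also have "\<dots> = (\<Oplus>d\<in>?S. comp r d \<otimes> x)"
      by (rule finsum_ldistr) (use x comp_carrier comp_props(2) that(1) in auto)
    also have "\<dots> \<in> ?I"
    proof (rule finsum_closed_subset)
      show "finite ?S" by (rule comp_props(2)[OF that(1)])
      show "\<And>d. comp r d \<otimes> x \<in> ?I" by (rule hmul[OF comp_props(1)[OF that(1)] that(2)])
    qed (use zero add in auto)
    finally show ?thesis .
  qed
  have "subgroup ?I (add_monoid R)"
  proof (rule subgroup.intro)
    fix x assume x: "x \<in> ?I"
    have "\<ominus> x = (\<ominus> \<one>) \<otimes> x" using x by (simp add: l_minus)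
    then show "inv\<^bsub>add_monoid R\<^esub> x \<in> ?I" using mul[of "\<ominus> \<one>" x] x by (simp add: a_inv_def)
  qed (use zero add in auto)
  then show ?thesis using mul by (simp add: left_ideal_def)
qed

text \<open>Generation is phrased as a test against other graded ideals \<open>J'\<close>; in use
  \<open>J'\<close> is another colon ideal, for which only the generators have to be
  checked.\<close>

lemma gleft_ideal_finitely_generated:
  assumes "left_right_noetherian R" and J: "gleft_ideal R J"
  obtains A where "finite A" "\<forall>(d, a)\<in>A. a \<in> J d"
    "\<And>J' n. \<lbrakk>gleft_ideal R J'; \<forall>(d, a)\<in>A. a \<in> J' d\<rbrakk> \<Longrightarrow> J n \<subseteq> J' n"
proof -
  define I where "I = (\<lambda>J. {x \<in> carrier R. \<forall>d. comp x d \<in> J d})"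
  have "left_ideal R (I J)" unfolding I_def by (rule left_ideal_of_gleft_ideal[OF J])
  then obtain A0 where A0: "finite A0" "A0 \<subseteq> carrier R" "I J = \<Inter>{K. left_ideal R K \<and> A0 \<subseteq> K}"
    using assms(1) unfolding left_right_noetherian_def by meson
  \<comment> \<open>The generators of the ungraded ideal need not be homogeneous, so they are
    replaced by their nonzero components, each tagged with its degree.\<close>
  define A where "A = (\<Union>a\<in>A0. (\<lambda>d. (d, comp a d)) ` {d. comp a d \<noteq> \<zero>})"
  have "A0 \<subseteq> I J" using A0(3) by blast
  then have AJ: "\<forall>(d, a)\<in>A. a \<in> J d" by (auto simp: A_def I_def)
  have "finite A" unfolding A_def using A0 comp_props(2) by blast
  moreover note AJ
  moreover have "J n \<subseteq> J' n" if J': "gleft_ideal R J'" "\<forall>(d, a)\<in>A. a \<in> J' d" for J' n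
  proof
    fix x assume x: "x \<in> J n"
    have zJ: "\<zero> \<in> J d" "\<zero> \<in> J' d" for d using J J'(1) by (auto simp: gleft_ideal_def)
    have "A0 \<subseteq> I J'"
    proof
      fix a assume a: "a \<in> A0"
      have "comp a d \<in> J' d" for d
      proof (cases "comp a d = \<zero>")
        case False
        then have "(d, comp a d) \<in> A" using a by (auto simp: A_def)
        then show ?thesis using J'(2) by auto
      qed (use zJ in simp)
      then show "a \<in> I J'" using a A0(2) by (auto simp: I_def)
    qed
    moreover have "left_ideal R (I J')" unfolding I_def by (rule left_ideal_of_gleft_ideal[OF J'(1)])
    ultimately have "I J \<subseteq> I J'" using A0(3) by blast
    moreover have xn: "x \<in> grading R n" using x J by (auto simp: gleft_ideal_def)
    have "x \<in> I J" using x xn zJ grading_carrier by (auto simp: I_def comp_homogeneous[OF xn])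
    ultimately have "comp x n \<in> J' n" by (auto simp: I_def)
    then show "x \<in> J' n" by (simp add: comp_homogeneous[OF xn])
  qed
  ultimately show ?thesis by (rule that)
qed

end

section \<open>Spans and finite generation of graded submodules\<close>

lemma gspan_iff:
  "x \<in> gspan R M A n \<longleftrightarrow> (\<forall>N. gsubmodule R M N \<longrightarrow> (\<forall>(d, a)\<in>A. a \<in> N d) \<longrightarrow> x \<in> N n)"
  unfolding gspan_def by blast

lemma gspan_least:
  "\<lbrakk>gsubmodule R M N; \<forall>(d, a)\<in>A. a \<in> N d\<rbrakk> \<Longrightarrow> gspan R M A n \<subseteq> N n"
  unfolding gspan_def by blast

lemma gspan_base: "(d, a) \<in> A \<Longrightarrow> a \<in> gspan R M A d"
  unfolding gspan_def by blast

lemma gsubmoduleD: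
  assumes "gsubmodule R M N"
  shows "N d \<subseteq> gcar M d" "\<zero>\<^bsub>gpart M d\<^esub> \<in> N d"
    "\<lbrakk>x \<in> N d; y \<in> N d\<rbrakk> \<Longrightarrow> x \<oplus>\<^bsub>gpart M d\<^esub> y \<in> N d"
    "\<lbrakk>r \<in> grading R d; x \<in> N e\<rbrakk> \<Longrightarrow> gact M d e r x \<in> N (d + e)"
  using assms unfolding gsubmodule_def by auto

lemma gfin_genE:
  assumes "gfin_gen R M"
  obtains A where "finite A" "\<forall>(d, a)\<in>A. a \<in> gcar M d"
    "\<forall>n. \<forall>x\<in>gcar M n. \<exists>c. (\<forall>(d, a)\<in>A. c (d, a) \<in> grading R (n - d)) \<and>
        x = finsum (gpart M n) (\<lambda>(d, a). gact M (n - d) d (c (d, a)) a) A"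
  using assms unfolding gfin_gen_def by - (erule exE, (erule conjE)+, rule that; assumption)

context graded_module
begin

lemma gpart_zero: "\<zero>\<^bsub>gpart M e\<^esub> \<in> gcar M e"
  using gpart_group abelian_monoid.zero_closed abelian_group_def by blast

lemma gact_zero_left:
  assumes "x \<in> gcar M e"
  shows "gact M d e \<zero> x = \<zero>\<^bsub>gpart M (d + e)\<^esub>"
proof -
  interpret P: abelian_group "gpart M (d + e)" by (rule gpart_group)
  have z: "gact M d e \<zero> x \<in> gcar M (d + e)" using assms gact_closed grading_zero by blast
  have "gact M d e \<zero> x \<oplus>\<^bsub>gpart M (d + e)\<^esub> gact M d e \<zero> x = gact M d e \<zero> x"
    using gact_add_left[OF grading_zero grading_zero assms, of d] by simp
  then show ?thesis using z
    by (metis P.add.l_cancel_one)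
qed

lemma gact_zero_right:
  assumes "r \<in> grading R d"
  shows "gact M d e r \<zero>\<^bsub>gpart M e\<^esub> = \<zero>\<^bsub>gpart M (d + e)\<^esub>"
proof -
  interpret P: abelian_group "gpart M (d + e)" by (rule gpart_group)
  interpret Q: abelian_group "gpart M e" by (rule gpart_group)
  have z: "gact M d e r \<zero>\<^bsub>gpart M e\<^esub> \<in> gcar M (d + e)" using assms gact_closed by blast
  have "gact M d e r \<zero>\<^bsub>gpart M e\<^esub> \<oplus>\<^bsub>gpart M (d + e)\<^esub> gact M d e r \<zero>\<^bsub>gpart M e\<^esub>
     = gact M d e r \<zero>\<^bsub>gpart M e\<^esub>"
    using gact_add_right[OF assms Q.zero_closed Q.zero_closed] by simp
  then show ?thesis using z
    by (metis P.add.l_cancel_one)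
qed

lemma gact_minus_one:
  assumes "x \<in> gcar M e"
  shows "gact M 0 e (\<ominus> \<one>) x = \<ominus>\<^bsub>gpart M e\<^esub> x"
proof -
  interpret P: abelian_group "gpart M e" by (rule gpart_group)
  have m: "\<ominus> \<one> \<in> grading R 0" using grading_one grading_minus by blast
  have "gact M 0 e (\<ominus> \<one>) x \<oplus>\<^bsub>gpart M e\<^esub> x = \<zero>\<^bsub>gpart M e\<^esub>"
    using gact_add_left[OF m grading_one assms] gact_zero_left[OF assms, of 0] gact_one[OF assms]
    by (simp add: l_neg)
  then show ?thesis using P.minus_equality[of "gact M 0 e (\<ominus> \<one>) x" x] gact_closed[OF m assms] assms
    by simp
qed

text \<open>Negatives are not among the closure conditions of \<open>gsubmodule\<close>; they come
  from the action of the negative of \<open>\<one>\<close>, which lies in degree 0.\<close>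

lemma gsubmodule_minus:
  assumes "gsubmodule R M N" "x \<in> N e"
  shows "\<ominus>\<^bsub>gpart M e\<^esub> x \<in> N e"
proof -
  have "\<ominus> \<one> \<in> grading R 0" using grading_one grading_minus by blast
  then have "gact M 0 e (\<ominus> \<one>) x \<in> N (0 + e)" using gsubmoduleD(4)[OF assms(1)] assms(2) by blast
  moreover have "x \<in> gcar M e" using gsubmoduleD(1)[OF assms(1)] assms(2) by blast
  ultimately show ?thesis using gact_minus_one by simp
qed

lemma gsubmodule_all: "gsubmodule R M (gcar M)"
  unfolding gsubmodule_def
  using gpart_zero gact_closed abelian_monoid.a_closed[OF abelian_group.axioms(1)[OF gpart_group]]
  by auto

lemma gsubmodule_Int:
  assumes "gsubmodule R M N" "gsubmodule R M N'"
  shows "gsubmodule R M (\<lambda>n. N n \<inter> N' n)"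
  using assms unfolding gsubmodule_def by auto

lemma gspan_submodule:
  assumes "\<forall>(d, a)\<in>A. a \<in> gcar M d"
  shows "gsubmodule R M (gspan R M A)"
  unfolding gsubmodule_def
proof (intro conjI allI ballI)
  fix d show "gspan R M A d \<subseteq> gcar M d" by (rule gspan_least[OF gsubmodule_all assms])
  show "\<zero>\<^bsub>gpart M d\<^esub> \<in> gspan R M A d" using gsubmoduleD(2) unfolding gspan_iff by blast
  show "x \<oplus>\<^bsub>gpart M d\<^esub> y \<in> gspan R M A d" if "x \<in> gspan R M A d" "y \<in> gspan R M A d" for x y
    using that by (auto simp: gspan_iff intro!: gsubmoduleD(3))
  show "gact M d e r x \<in> gspan R M A (d + e)" if "r \<in> grading R d" "x \<in> gspan R M A e" for e r x
    using that by (auto simp: gspan_iff intro!: gsubmoduleD(4))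
qed

text \<open>As \<open>gspan\<close> is an intersection, the normal form is obtained by checking that
  the elements of this form are a graded submodule containing the generators.\<close>

lemma gspan_insertE:
  assumes "\<forall>(d, a)\<in>A. a \<in> gcar M d" "a \<in> gcar M d" "x \<in> gspan R M (insert (d, a) A) n"
  obtains r y where "r \<in> grading R (n - d)" "y \<in> gspan R M A n" "x = gact M (n - d) d r a \<oplus>\<^bsub>gpart M n\<^esub> y"
proof -
  define N where "N = (\<lambda>n. {gact M (n - d) d r a \<oplus>\<^bsub>gpart M n\<^esub> y |r y. r \<in> grading R (n - d) \<and> y \<in> gspan R M A n})"
  note sp = gsubmoduleD[OF gspan_submodule[OF assms(1)]]
  have act: "gact M (n - d) d r a \<in> gcar M n" if "r \<in> grading R (n - d)" for n r
    using gact_closed[OF that assms(2)] by simp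
  have "gsubmodule R M N"
    unfolding gsubmodule_def
  proof (intro conjI allI ballI)
    fix n
    interpret P: abelian_group "gpart M n" by (rule gpart_group)
    show "N n \<subseteq> gcar M n" unfolding N_def using act sp(1)[of n] by (auto intro!: P.a_closed)
    have "\<zero>\<^bsub>gpart M n\<^esub> = gact M (n - d) d \<zero> a \<oplus>\<^bsub>gpart M n\<^esub> \<zero>\<^bsub>gpart M n\<^esub>"
      using gact_zero_left[OF assms(2), of "n - d"] by simp
    then show "\<zero>\<^bsub>gpart M n\<^esub> \<in> N n" unfolding N_def using grading_zero sp(2) by blast
    fix x y assume "x \<in> N n" "y \<in> N n"
    then obtain r s u v where *: "r \<in> grading R (n - d)" "s \<in> grading R (n - d)"
      "u \<in> gspan R M A n" "v \<in> gspan R M A n"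
      "x = gact M (n - d) d r a \<oplus>\<^bsub>gpart M n\<^esub> u" "y = gact M (n - d) d s a \<oplus>\<^bsub>gpart M n\<^esub> v"
      unfolding N_def by auto
    have "u \<in> gcar M n" "v \<in> gcar M n" using * sp(1) by auto
    then have "x \<oplus>\<^bsub>gpart M n\<^esub> y = gact M (n - d) d (r \<oplus> s) a \<oplus>\<^bsub>gpart M n\<^esub> (u \<oplus>\<^bsub>gpart M n\<^esub> v)"
      using * gact_add_left[OF *(1,2) assms(2)] act by (simp add: P.a_ac)
    then show "x \<oplus>\<^bsub>gpart M n\<^esub> y \<in> N n" unfolding N_def using * grading_add sp(3) by blast
  next
    fix e n t x assume t: "t \<in> grading R e" and "x \<in> N n"
    then obtain r u where *: "r \<in> grading R (n - d)"
      "u \<in> gspan R M A n" "x = gact M (n - d) d r a \<oplus>\<^bsub>gpart M n\<^esub> u"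
      unfolding N_def by auto
    have u: "u \<in> gcar M n" using * sp(1) by auto
    have "gact M e n t x = gact M e n t (gact M (n - d) d r a) \<oplus>\<^bsub>gpart M (e + n)\<^esub> gact M e n t u"
      unfolding *(3) by (rule gact_add_right[OF t act[OF *(1)] u])
    also have "gact M e n t (gact M (n - d) d r a) = gact M (e + n - d) d (t \<otimes> r) a"
      using gact_assoc[OF t *(1) assms(2)] by (simp add: add_diff_eq)
    finally have "gact M e n t x = gact M (e + n - d) d (t \<otimes> r) a \<oplus>\<^bsub>gpart M (e + n)\<^esub> gact M e n t u" .
    moreover have "t \<otimes> r \<in> grading R (e + n - d)"
      using grading_mult[OF t *(1)] by (simp add: add_diff_eq)
    ultimately show "gact M e n t x \<in> N (e + n)" unfolding N_def using sp(4)[OF t *(2)] by blast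
  qed
  moreover have "\<forall>(d, a)\<in>insert (d, a) A. a \<in> N d"
  proof -
    interpret P: abelian_group "gpart M d" by (rule gpart_group)
    have "a = gact M (d - d) d \<one> a \<oplus>\<^bsub>gpart M d\<^esub> \<zero>\<^bsub>gpart M d\<^esub>" using gact_one assms(2) by simp
    then have 1: "a \<in> N d" unfolding N_def using grading_one sp(2)
      by (metis (mono_tags, lifting) cancel_comm_monoid_add_class.diff_cancel mem_Collect_eq)
    have 2: "b \<in> N e" if "(e, b) \<in> A" for e b
    proof -
      interpret Q: abelian_group "gpart M e" by (rule gpart_group)
      have "b \<in> gcar M e" using that assms(1) by auto
      then have "b = gact M (e - d) d \<zero> a \<oplus>\<^bsub>gpart M e\<^esub> b"
        using gact_zero_left[OF assms(2), of "e - d"] by simp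
      then show ?thesis unfolding N_def using grading_zero gspan_base[OF that] by blast
    qed
    show ?thesis using 1 2 by auto
  qed
  ultimately have "x \<in> N n" using assms(3) gspan_least by blast
  then show ?thesis unfolding N_def using that by auto
qed

text \<open>The colon ideal of \<open>a\<close> into \<open>N + K\<close>. With \<open>K\<close> the
  span of the remaining generators it consists of the coefficients at \<open>a\<close> of elements
  of \<open>N\<close>, as leading coefficients do in the basis theorem.\<close>

lemma gleft_ideal_colon:
  assumes N: "gsubmodule R M N" and K: "gsubmodule R M K" and a: "a \<in> gcar M d"
  shows "gleft_ideal R (\<lambda>m. {r \<in> grading R m. \<exists>y\<in>K (m + d). gact M m d r a \<oplus>\<^bsub>gpart M (m + d)\<^esub> y \<in> N (m + d)})"
    (is "gleft_ideal R ?J")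
  unfolding gleft_ideal_def
proof (intro conjI allI ballI)
  note Nd = gsubmoduleD[OF N] and Kd = gsubmoduleD[OF K]
  fix m
  interpret P: abelian_group "gpart M (m + d)" by (rule gpart_group)
  show "?J m \<subseteq> grading R m" by auto
  show "\<zero> \<in> ?J m" using gact_zero_left[OF a, of m] Kd(2)[of "m + d"] Nd(2)[of "m + d"] grading_zero
    by (auto intro!: bexI[of _ "\<zero>\<^bsub>gpart M (m + d)\<^esub>"])
  fix r s assume "r \<in> ?J m" "s \<in> ?J m"
  then obtain u v where *: "r \<in> grading R m" "s \<in> grading R m" "u \<in> K (m + d)" "v \<in> K (m + d)"
    "gact M m d r a \<oplus>\<^bsub>gpart M (m + d)\<^esub> u \<in> N (m + d)"
    "gact M m d s a \<oplus>\<^bsub>gpart M (m + d)\<^esub> v \<in> N (m + d)" by auto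
  have uv: "u \<in> gcar M (m + d)" "v \<in> gcar M (m + d)" using * Kd(1) by auto
  have "gact M m d (r \<oplus> s) a \<oplus>\<^bsub>gpart M (m + d)\<^esub> (u \<oplus>\<^bsub>gpart M (m + d)\<^esub> v) =
    (gact M m d r a \<oplus>\<^bsub>gpart M (m + d)\<^esub> u) \<oplus>\<^bsub>gpart M (m + d)\<^esub> (gact M m d s a \<oplus>\<^bsub>gpart M (m + d)\<^esub> v)"
    using gact_add_left[OF *(1,2) a] uv gact_closed[OF *(1) a] gact_closed[OF *(2) a]
    by (simp add: P.a_ac)
  then show "r \<oplus> s \<in> ?J m" using * grading_add Nd(3)[OF *(5,6)] Kd(3)[OF *(3,4)]
    by (auto intro!: bexI[of _ "u \<oplus>\<^bsub>gpart M (m + d)\<^esub> v"])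
next
  note Nd = gsubmoduleD[OF N] and Kd = gsubmoduleD[OF K]
  fix e m t r assume t: "t \<in> grading R e" and "r \<in> ?J m"
  then obtain u where *: "r \<in> grading R m" "u \<in> K (m + d)"
    "gact M m d r a \<oplus>\<^bsub>gpart M (m + d)\<^esub> u \<in> N (m + d)" by auto
  have u: "u \<in> gcar M (m + d)" using * Kd(1) by auto
  have "gact M e (m + d) t (gact M m d r a \<oplus>\<^bsub>gpart M (m + d)\<^esub> u) =
     gact M (e + m) d (t \<otimes> r) a \<oplus>\<^bsub>gpart M (e + m + d)\<^esub> gact M e (m + d) t u"
    using gact_add_right[OF t gact_closed[OF *(1) a] u] gact_assoc[OF t *(1) a]
    by (simp add: add.assoc)
  then show "t \<otimes> r \<in> ?J (e + m)" using grading_mult[OF t *(1)] Nd(4)[OF t *(3)] Kd(4)[OF t *(2)]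
    by (auto simp: add.assoc intro!: bexI[of _ "gact M e (m + d) t u"])
qed

text \<open>Induction on the generators of the ambient span: \<open>N\<close> is controlled by its
  intersection with the span of the old generators and by its coefficient ideal at the new
  one.\<close>

lemma gsubmodule_finitely_generated_aux:
  assumes noeth: "left_right_noetherian R" and "finite A"
  shows "\<lbrakk>\<forall>(d, a)\<in>A. a \<in> gcar M d; gsubmodule R M N; \<And>n. N n \<subseteq> gspan R M A n\<rbrakk> \<Longrightarrow>
    \<exists>B. finite B \<and> (\<forall>(d, b)\<in>B. b \<in> N d) \<and> (\<forall>n. N n \<subseteq> gspan R M B n)"
  using \<open>finite A\<close>
proof (induction A arbitrary: N)
  case empty
  then show ?case by (intro exI[of _ "{}"]) auto
next
  case (insert p A)
  obtain d a where p: "p = (d, a)" by fastforce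
  have a: "a \<in> gcar M d" and A: "\<forall>(d, a)\<in>A. a \<in> gcar M d" using insert.prems(1) p by auto
  let ?J = "\<lambda>N m. {r \<in> grading R m. \<exists>y\<in>gspan R M A (m + d).
    gact M m d r a \<oplus>\<^bsub>gpart M (m + d)\<^esub> y \<in> N (m + d)}"
  note sA = gspan_submodule[OF A] and N = insert.prems(2)
  obtain C where C: "finite C" "\<forall>(m, r)\<in>C. r \<in> ?J N m"
    "\<And>J' n. \<lbrakk>gleft_ideal R J'; \<forall>(d, a)\<in>C. a \<in> J' d\<rbrakk> \<Longrightarrow> ?J N n \<subseteq> J' n"
    by (rule gleft_ideal_finitely_generated[OF noeth gleft_ideal_colon[OF N sA a]]) (rule that)
  from C(2) have "\<forall>c\<in>C. \<exists>y. y \<in> gspan R M A (fst c + d) \<and>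
      gact M (fst c) d (snd c) a \<oplus>\<^bsub>gpart M (fst c + d)\<^esub> y \<in> N (fst c + d)"
    by fastforce
  then obtain y where y: "\<And>c. c \<in> C \<Longrightarrow> y c \<in> gspan R M A (fst c + d) \<and>
      gact M (fst c) d (snd c) a \<oplus>\<^bsub>gpart M (fst c + d)\<^esub> y c \<in> N (fst c + d)"
    by metis
  obtain B' where B': "finite B'" "\<forall>(d, b)\<in>B'. b \<in> N d \<inter> gspan R M A d"
    "\<forall>n. N n \<inter> gspan R M A n \<subseteq> gspan R M B' n"
    using insert.IH[OF A gsubmodule_Int[OF N sA]] by auto
  \<comment> \<open>Lifts to \<open>N\<close> of the generators of the coefficient ideal;
    \<open>y c\<close> is the correction from the span of \<open>A\<close> that brings the multiple
    of \<open>a\<close> into \<open>N\<close>.\<close>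
  define D where "D = (\<lambda>c. (fst c + d, gact M (fst c) d (snd c) a \<oplus>\<^bsub>gpart M (fst c + d)\<^esub> y c)) ` C"
  have BN: "\<forall>(d, b)\<in>B' \<union> D. b \<in> N d" using B'(2) y by (auto simp: D_def)
  have BM: "\<forall>(d, b)\<in>B' \<union> D. b \<in> gcar M d" using BN gsubmoduleD(1)[OF N] by blast
  note sB = gspan_submodule[OF BM]
  \<comment> \<open>The coefficient ideal of the new span contains the generators \<open>C\<close>,
    hence the whole coefficient ideal of \<open>N\<close>.\<close>
  have "\<forall>(m, r)\<in>C. r \<in> ?J (gspan R M (B' \<union> D)) m"
  proof safe
    fix m r assume c: "(m, r) \<in> C"
    then show "r \<in> grading R m" using C(2) by auto
    have "(m + d, gact M m d r a \<oplus>\<^bsub>gpart M (m + d)\<^esub> y (m, r)) \<in> B' \<union> D"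
      unfolding D_def using c by force
    then have "gact M m d r a \<oplus>\<^bsub>gpart M (m + d)\<^esub> y (m, r) \<in> gspan R M (B' \<union> D) (m + d)"
      by (rule gspan_base)
    then show "\<exists>z\<in>gspan R M A (m + d). gact M m d r a \<oplus>\<^bsub>gpart M (m + d)\<^esub> z \<in> gspan R M (B' \<union> D) (m + d)"
      using y[OF c] by auto
  qed
  then have JJ: "?J N m \<subseteq> ?J (gspan R M (B' \<union> D)) m" for m
    using C(3)[OF gleft_ideal_colon[OF sB sA a]] by blast
  have "x \<in> gspan R M (B' \<union> D) n" if x: "x \<in> N n" for n x
  proof -
    interpret P: abelian_group "gpart M n" by (rule gpart_group)
    have "x \<in> gspan R M (insert (d, a) A) n" using insert.prems(3) x p by auto
    then obtain r u where u: "r \<in> grading R (n - d)" "u \<in> gspan R M A n"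
      "x = gact M (n - d) d r a \<oplus>\<^bsub>gpart M n\<^esub> u"
      by (rule gspan_insertE[OF A a])
    then have "r \<in> ?J N (n - d)" using x by auto
    then have "r \<in> ?J (gspan R M (B' \<union> D)) (n - d)" using JJ by blast
    then obtain v where v: "v \<in> gspan R M A n"
      "gact M (n - d) d r a \<oplus>\<^bsub>gpart M n\<^esub> v \<in> gspan R M (B' \<union> D) n" by auto
    let ?w = "gact M (n - d) d r a \<oplus>\<^bsub>gpart M n\<^esub> v"
    have uv: "u \<in> gcar M n" "v \<in> gcar M n" using u v gsubmoduleD(1)[OF sA] by auto
    have ra: "gact M (n - d) d r a \<in> gcar M n" using gact_closed[OF u(1) a] by simp
    have "?w \<in> N n" using gspan_least[OF N BN] v(2) by blast
    then have 1: "\<ominus>\<^bsub>gpart M n\<^esub> ?w \<oplus>\<^bsub>gpart M n\<^esub> x \<in> N n"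
      using gsubmodule_minus[OF N] gsubmoduleD(3)[OF N] x by blast
    \<comment> \<open>\<open>x\<close> and \<open>?w\<close> have the same coefficient at
      \<open>a\<close>, so it cancels and their difference lies in \<open>N\<close> and in the span
      of \<open>A\<close>, where \<open>B'\<close> generates.\<close>
    have eq: "\<ominus>\<^bsub>gpart M n\<^esub> ?w \<oplus>\<^bsub>gpart M n\<^esub> x = u \<oplus>\<^bsub>gpart M n\<^esub> (\<ominus>\<^bsub>gpart M n\<^esub> v)"
    proof -
      have "\<ominus>\<^bsub>gpart M n\<^esub> ?w \<oplus>\<^bsub>gpart M n\<^esub> x = (\<ominus>\<^bsub>gpart M n\<^esub> v \<oplus>\<^bsub>gpart M n\<^esub> \<ominus>\<^bsub>gpart M n\<^esub> gact M (n - d) d r a) \<oplus>\<^bsub>gpart M n\<^esub> (gact M (n - d) d r a \<oplus>\<^bsub>gpart M n\<^esub> u)"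
        using u(3) uv ra by (simp add: P.minus_add P.a_comm)
      also have "\<dots> = \<ominus>\<^bsub>gpart M n\<^esub> v \<oplus>\<^bsub>gpart M n\<^esub> (\<ominus>\<^bsub>gpart M n\<^esub> gact M (n - d) d r a \<oplus>\<^bsub>gpart M n\<^esub> (gact M (n - d) d r a \<oplus>\<^bsub>gpart M n\<^esub> u))"
        using uv ra by (simp add: P.a_assoc)
      also have "\<dots> = \<ominus>\<^bsub>gpart M n\<^esub> v \<oplus>\<^bsub>gpart M n\<^esub> u" using uv ra by (simp add: P.r_neg1)
      finally show ?thesis using uv by (simp add: P.a_comm)
    qed
    have "u \<oplus>\<^bsub>gpart M n\<^esub> (\<ominus>\<^bsub>gpart M n\<^esub> v) \<in> gspan R M A n"
      using gsubmodule_minus[OF sA] gsubmoduleD(3)[OF sA] u v by blast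
    with 1 eq have "\<ominus>\<^bsub>gpart M n\<^esub> ?w \<oplus>\<^bsub>gpart M n\<^esub> x \<in> gspan R M B' n" using B'(3) by auto
    moreover have "gspan R M B' n \<subseteq> gspan R M (B' \<union> D) n" unfolding gspan_def by blast
    ultimately have "?w \<oplus>\<^bsub>gpart M n\<^esub> (\<ominus>\<^bsub>gpart M n\<^esub> ?w \<oplus>\<^bsub>gpart M n\<^esub> x) \<in> gspan R M (B' \<union> D) n"
      using v(2) gsubmoduleD(3)[OF sB] by blast
    moreover have "x \<in> gcar M n" using x gsubmoduleD(1)[OF N] by auto
    ultimately show ?thesis using ra uv by (simp add: P.r_neg2)
  qed
  moreover have "finite (B' \<union> D)" using B'(1) C(1) by (simp add: D_def)
  ultimately show ?case using BN by (intro exI[of _ "B' \<union> D"]) auto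
qed

lemma gfin_gen_gspan:
  assumes "gfin_gen R M"
  obtains A where "finite A" "\<forall>(d, a)\<in>A. a \<in> gcar M d" "\<And>n. gcar M n \<subseteq> gspan R M A n"
proof -
  obtain A where A: "finite A" "\<forall>(d, a)\<in>A. a \<in> gcar M d"
    "\<forall>n. \<forall>x\<in>gcar M n. \<exists>c. (\<forall>(d, a)\<in>A. c (d, a) \<in> grading R (n - d)) \<and>
        x = finsum (gpart M n) (\<lambda>(d, a). gact M (n - d) d (c (d, a)) a) A"
    by (rule gfin_genE[OF assms])
  note sA = gspan_submodule[OF A(2)]
  have "x \<in> gspan R M A n" if xn: "x \<in> gcar M n" for x n
  proof -
    interpret P: abelian_group "gpart M n" by (rule gpart_group)
    obtain c where c: "\<forall>(d, a)\<in>A. c (d, a) \<in> grading R (n - d)"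
        "x = finsum (gpart M n) (\<lambda>(d, a). gact M (n - d) d (c (d, a)) a) A"
      using A(3)[THEN spec, THEN bspec, OF xn] by - (erule exE, erule conjE, rule that; assumption)
    have "gact M (n - d) d (c (d, a)) a \<in> gspan R M A n" if "(d, a) \<in> A" for d a
    proof -
      have "gact M (n - d) d (c (d, a)) a \<in> gspan R M A (n - d + d)"
        by (rule gsubmoduleD(4)[OF sA]) (use c that in \<open>auto intro: gspan_base\<close>)
      then show ?thesis by simp
    qed
    then show ?thesis unfolding c(2)
      by (intro P.finsum_closed_subset) (use A(1) gsubmoduleD[OF sA] in auto)
  qed
  then show ?thesis by (intro that[OF A(1,2)]) blast
qed

lemma gsubmodule_finitely_generated:
  assumes "left_right_noetherian R" "gfin_gen R M" "gsubmodule R M N"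
  obtains B where "finite B" "\<forall>(d, b)\<in>B. b \<in> N d"
    "\<And>N' n. \<lbrakk>gsubmodule R M N'; \<forall>(d, b)\<in>B. b \<in> N' d\<rbrakk> \<Longrightarrow> N n \<subseteq> N' n"
proof -
  obtain A where A: "finite A" "\<forall>(d, a)\<in>A. a \<in> gcar M d" "\<And>n. gcar M n \<subseteq> gspan R M A n"
    by (rule gfin_gen_gspan[OF assms(2)]) (rule that)
  obtain B where B: "finite B" "\<forall>(d, b)\<in>B. b \<in> N d" "\<forall>n. N n \<subseteq> gspan R M B n"
    using gsubmodule_finitely_generated_aux[OF assms(1) A(1,2) assms(3)]
      A(3) gsubmoduleD(1)[OF assms(3)] by blast
  show ?thesis by (rule that[OF B(1,2)]) (use B(3) gspan_least in blast)
qed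

end

section \<open>Graded homomorphisms and transport along isomorphisms\<close>

lemma gmod_homD:
  assumes "gmod_hom R M N \<alpha>"
  shows "x \<in> gcar M d \<Longrightarrow> \<alpha> d x \<in> gcar N d"
    "\<lbrakk>x \<in> gcar M d; y \<in> gcar M d\<rbrakk> \<Longrightarrow> \<alpha> d (x \<oplus>\<^bsub>gpart M d\<^esub> y) = \<alpha> d x \<oplus>\<^bsub>gpart N d\<^esub> \<alpha> d y"
    "\<lbrakk>r \<in> grading R d; x \<in> gcar M e\<rbrakk> \<Longrightarrow> \<alpha> (d + e) (gact M d e r x) = gact N d e r (\<alpha> e x)"
  using assms unfolding gmod_hom_def by auto

lemma gmod_iso_inv:
  assumes "graded_module R M" "gmod_iso R M N \<alpha>"
  shows "gmod_iso R N M (\<lambda>d. inv_into (gcar M d) (\<alpha> d))"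
proof -
  interpret M: graded_module R M by fact
  have h: "gmod_hom R M N \<alpha>" and b: "\<And>d. bij_betw (\<alpha> d) (gcar M d) (gcar N d)"
    using assms(2) by (auto simp: gmod_iso_def)
  note hD = gmod_homD[OF h]
  define \<beta> where "\<beta> = (\<lambda>d. inv_into (gcar M d) (\<alpha> d))"
  have bb: "bij_betw (\<beta> d) (gcar N d) (gcar M d)" for d unfolding \<beta>_def using b bij_betw_inv_into by blast
  have ab: "\<alpha> d (\<beta> d y) = y" if "y \<in> gcar N d" for d y
    unfolding \<beta>_def using b that by (meson bij_betw_inv_into_right)
  have ba: "\<beta> d (\<alpha> d x) = x" if "x \<in> gcar M d" for d x
    unfolding \<beta>_def using b that by (meson bij_betw_inv_into_left)
  have bc: "\<beta> d y \<in> gcar M d" if "y \<in> gcar N d" for d y using bb that bij_betwE by blast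
  have "gmod_hom R N M \<beta>"
    unfolding gmod_hom_def
  proof (intro conjI allI ballI)
    fix d x y assume *: "x \<in> gcar N d" "y \<in> gcar N d"
    interpret P: abelian_group "gpart M d" by (rule M.gpart_group)
    show "\<beta> d (x \<oplus>\<^bsub>gpart N d\<^esub> y) = \<beta> d x \<oplus>\<^bsub>gpart M d\<^esub> \<beta> d y"
      using * hD(2)[of "\<beta> d x" d "\<beta> d y"] ab ba bc by (metis P.a_closed)
  next
    fix d e r x assume "r \<in> grading R d" "x \<in> gcar N e"
    then show "\<beta> (d + e) (gact N d e r x) = gact M d e r (\<beta> e x)"
      using hD(3)[of r d "\<beta> e x" e] ab ba bc M.gact_closed by metis
  qed (use bc in auto)
  then show ?thesis using bb unfolding \<beta>_def gmod_iso_def by simp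
qed

lemma gmod_iso_gfin_gen:
  assumes M: "graded_module R M" and N: "graded_module R N" and "gmod_iso R M N \<alpha>" "gfin_gen R M"
  shows "gfin_gen R N"
proof -
  interpret M: graded_module R M by fact
  interpret N: graded_module R N by fact
  have h: "gmod_hom R M N \<alpha>" and b: "\<And>d. bij_betw (\<alpha> d) (gcar M d) (gcar N d)"
    using assms(3) by (auto simp: gmod_iso_def)
  note hD = gmod_homD[OF h]
  obtain A where A: "finite A" "\<forall>(d, a)\<in>A. a \<in> gcar M d"
    "\<forall>n. \<forall>x\<in>gcar M n. \<exists>c. (\<forall>(d, a)\<in>A. c (d, a) \<in> grading R (n - d)) \<and>
        x = finsum (gpart M n) (\<lambda>(d, a). gact M (n - d) d (c (d, a)) a) A"
    by (rule gfin_genE[OF assms(4)])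
  define f where "f = (\<lambda>(d, a). (d, \<alpha> d a))"
  \<comment> \<open>\<open>finsum\<close> runs over a set, so two generators with the same image
    would lose a summand, and the coefficients \<open>c'\<close> below would be ambiguous.\<close>
  have inj: "inj_on f A"
  proof (rule inj_onI, clarify)
    fix d a e a' assume *: "(d, a) \<in> A" "(e, a') \<in> A" "f (d, a) = f (e, a')"
    then have "a \<in> gcar M d" "a' \<in> gcar M d" "\<alpha> d a = \<alpha> d a'" "d = e" using A(2) by (auto simp: f_def)
    then show "d = e \<and> a = a'" using b[of d] by (auto simp: bij_betw_def inj_on_def)
  qed
  have "\<exists>c. (\<forall>(d, a)\<in>f ` A. c (d, a) \<in> grading R (n - d)) \<and>
        y = finsum (gpart N n) (\<lambda>(d, a). gact N (n - d) d (c (d, a)) a) (f ` A)"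
    if yn: "y \<in> gcar N n" for y n
  proof -
    interpret P: abelian_group "gpart M n" by (rule M.gpart_group)
    interpret Q: abelian_group "gpart N n" by (rule N.gpart_group)
    interpret gh: group_hom "add_monoid (gpart M n)" "add_monoid (gpart N n)" "\<alpha> n"
      by (intro group_hom.intro group_hom_axioms.intro P.a_group Q.a_group)
        (use hD(1,2) in \<open>auto simp: hom_def\<close>)
    obtain x where x: "x \<in> gcar M n" "y = \<alpha> n x" using b[of n] yn by (auto simp: bij_betw_def)
    obtain c where c: "\<forall>(d, a)\<in>A. c (d, a) \<in> grading R (n - d)"
        "x = finsum (gpart M n) (\<lambda>(d, a). gact M (n - d) d (c (d, a)) a) A"
      using A(3)[THEN spec, THEN bspec, OF x(1)] by - (erule exE, erule conjE, rule that; assumption)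
    define g where "g = (\<lambda>(d, a). gact M (n - d) d (c (d, a)) a)"
    have gM: "g p \<in> gcar M n" if "p \<in> A" for p
    proof -
      obtain d a where p: "p = (d, a)" by fastforce
      have "gact M (n - d) d (c (d, a)) a \<in> gcar M (n - d + d)"
        by (rule M.gact_closed) (use c A that p in auto)
      then show ?thesis by (simp add: g_def p)
    qed
    have sum: "finite S \<Longrightarrow> S \<subseteq> A \<Longrightarrow> \<alpha> n (finsum (gpart M n) g S) = finsum (gpart N n) (\<lambda>p. \<alpha> n (g p)) S" for S
    proof (induction S rule: finite_induct)
      case empty
      then show ?case using gh.hom_one by simp
    next
      case (insert p S)
      have "g \<in> S \<rightarrow> gcar M n" "g p \<in> gcar M n" using insert.prems gM by auto
      moreover from this have "(\<lambda>p. \<alpha> n (g p)) \<in> S \<rightarrow> gcar N n" "\<alpha> n (g p) \<in> gcar N n" using hD(1) by auto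
      ultimately show ?case using insert hD(2) by simp
    qed
    define c' where "c' = (\<lambda>q. c (inv_into A f q))"
    have c': "c' (f p) = c p" if "p \<in> A" for p using inj that by (simp add: c'_def)
    have fp: "\<alpha> n (g p) = (case f p of (d, b) \<Rightarrow> gact N (n - d) d (c' (d, b)) b)" if p: "p \<in> A" for p
    proof -
      obtain d a where da: "p = (d, a)" by fastforce
      have "\<alpha> (n - d + d) (gact M (n - d) d (c (d, a)) a) = gact N (n - d) d (c (d, a)) (\<alpha> d a)"
        by (rule hD(3)) (use c A that da in auto)
      then show ?thesis using c'[OF p] by (simp add: g_def da f_def)
    qed
    have fN: "(case f p of (d, b) \<Rightarrow> gact N (n - d) d (c' (d, b)) b) \<in> gcar N n" if "p \<in> A" for p
      using fp[OF that] gM[OF that] hD(1) by metis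
    have "finsum (gpart N n) (\<lambda>p. \<alpha> n (g p)) A =
       finsum (gpart N n) (\<lambda>p. case f p of (d, b) \<Rightarrow> gact N (n - d) d (c' (d, b)) b) A"
      by (intro Q.finsum_cong' refl fp Pi_I fN)
    also have "\<dots> = finsum (gpart N n) (\<lambda>(d, b). gact N (n - d) d (c' (d, b)) b) (f ` A)"
    proof (rule Q.finsum_reindex[symmetric, OF _ inj])
      show "(\<lambda>(d, b). gact N (n - d) d (c' (d, b)) b) \<in> f ` A \<rightarrow> gcar N n"
        using fN by blast
    qed
    finally have "y = finsum (gpart N n) (\<lambda>(d, b). gact N (n - d) d (c' (d, b)) b) (f ` A)"
      using sum[of A] A(1) x(2) c(2) unfolding g_def by simp
    moreover have "\<forall>(d, b)\<in>f ` A. c' (d, b) \<in> grading R (n - d)"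
      using c(1) c' by (fastforce simp: f_def)
    ultimately show ?thesis by blast
  qed
  moreover have "\<forall>(d, b)\<in>f ` A. b \<in> gcar N d" using A(2) hD(1) by (auto simp: f_def)
  ultimately show ?thesis unfolding gfin_gen_def using A(1) by (intro exI[of _ "f ` A"]) blast
qed

section \<open>Suspensions and exact triangles\<close>

text \<open>\<open>sus_ob\<close> and \<open>sus_arr\<close> are both of this shape, so the laws of
  integer powers are proved once for objects and morphisms.\<close>

definition bij_power :: "'a set \<Rightarrow> ('a \<Rightarrow> 'a) \<Rightarrow> int \<Rightarrow> 'a \<Rightarrow> 'a" where
  "bij_power S f n x = (if 0 \<le> n then (f ^^ nat n) x else (inv_into S f ^^ nat (- n)) x)"

lemma funpow_closed: "(\<And>x. x \<in> S \<Longrightarrow> f x \<in> S) \<Longrightarrow> x \<in> S \<Longrightarrow> (f ^^ n) x \<in> S"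
  by (induction n) auto

lemma bij_power_closed:
  assumes "bij_betw f S S" "x \<in> S"
  shows "bij_power S f n x \<in> S"
  unfolding bij_power_def
  using assms bij_betwE[OF assms(1)] bij_betwE[OF bij_betw_inv_into[OF assms(1)]]
  by (auto intro!: funpow_closed)

lemma bij_power_Suc:
  assumes "bij_betw f S S" "x \<in> S"
  shows "bij_power S f (n + 1) x = f (bij_power S f n x)"
proof (cases "0 \<le> n")
  case True
  then have "nat (n + 1) = Suc (nat n)" by simp
  then show ?thesis using True by (simp add: bij_power_def)
next
  case False
  define k where "k = nat (- n - 1)"
  have n: "n = - int k - 1" using False by (simp add: k_def)
  have "(inv_into S f ^^ k) x \<in> S"
    by (rule funpow_closed) (use assms bij_betwE[OF bij_betw_inv_into[OF assms(1)]] in auto)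
  then have "f (inv_into S f ((inv_into S f ^^ k) x)) = (inv_into S f ^^ k) x"
    using assms(1) by (meson bij_betw_inv_into_right)
  moreover have "bij_power S f n x = inv_into S f ((inv_into S f ^^ k) x)"
  proof -
    have "nat (- n) = Suc k" by (simp add: n)
    then show ?thesis using False by (simp add: bij_power_def)
  qed
  \<comment> \<open>For \<open>k = 0\<close> the exponent \<open>n + 1\<close> is 0 and falls into
    the nonnegative branch; here the two branches of the definition meet.\<close>
  moreover have "bij_power S f (n + 1) x = (inv_into S f ^^ k) x"
    by (cases "k = 0") (simp_all add: bij_power_def n)
  ultimately show ?thesis by simp
qed

lemma bij_power_add:
  assumes "bij_betw f S S" "x \<in> S"
  shows "bij_power S f (m + n) x = bij_power S f m (bij_power S f n x)"
proof (induction m rule: int_induct[where k = 0])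
  case base
  then show ?case by (simp add: bij_power_def)
next
  case (step1 m)
  have "m + 1 + n = (m + n) + 1" by simp
  then show ?case using step1 assms by (metis bij_power_Suc bij_power_closed)
next
  case (step2 m)
  have "f (bij_power S f (m - 1 + n) x) = bij_power S f (m + n) x"
    using bij_power_Suc[OF assms, of "m - 1 + n"] by (simp add: algebra_simps)
  moreover have "f (bij_power S f (m - 1) (bij_power S f n x)) = bij_power S f m (bij_power S f n x)"
    using bij_power_Suc[OF assms(1) bij_power_closed[OF assms], of "m - 1" n] by simp
  ultimately show ?case
    using step2 assms by (metis bij_power_closed bij_betw_inv_into_left)
qed

section \<open>Arithmetic of morphisms in preadditive categories\<close>

lemma hom_group_simps [simp]:
  "carrier (hom_group T X Y) = hom_set T X Y"
  "add (hom_group T X Y) = Add_arr T"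
  "zero (hom_group T X Y) = Zero_arr T X Y"
  by (simp_all add: hom_group_def)

context category
begin

lemma hom_set_Obj: "f \<in> hom_set T X Y \<Longrightarrow> X \<in> Obj T" "f \<in> hom_set T X Y \<Longrightarrow> Y \<in> Obj T"
  using Dom_Obj Cod_Obj by (auto simp: hom_set_def)

end

context preadditive_category
begin

abbreviation neg :: "'o \<Rightarrow> 'o \<Rightarrow> 'm \<Rightarrow> 'm" where
  "neg X Y f \<equiv> \<ominus>\<^bsub>hom_group T X Y\<^esub> f"

lemma Zero_arr_hom: "\<lbrakk>X \<in> Obj T; Y \<in> Obj T\<rbrakk> \<Longrightarrow> Zero_arr T X Y \<in> hom_set T X Y"
  using abelian_monoid.zero_closed[OF abelian_group.axioms(1)[OF hom_abelian_group[of X Y]]] by simp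

lemma Add_arr_hom: "\<lbrakk>f \<in> hom_set T X Y; g \<in> hom_set T X Y\<rbrakk> \<Longrightarrow> Add_arr T f g \<in> hom_set T X Y"
  using abelian_monoid.a_closed[OF abelian_group.axioms(1)[OF hom_abelian_group[of X Y]], of f g]
    hom_set_Obj[of f X Y] by simp

lemma neg_hom: "f \<in> hom_set T X Y \<Longrightarrow> neg X Y f \<in> hom_set T X Y"
  using abelian_group.a_inv_closed[OF hom_abelian_group[of X Y], of f] hom_set_Obj[of f X Y] by simp

lemma Add_arr_zero: "f \<in> hom_set T X Y \<Longrightarrow> Add_arr T f (Zero_arr T X Y) = f"
  using abelian_monoid.r_zero[OF abelian_group.axioms(1)[OF hom_abelian_group[of X Y]], of f]
    hom_set_Obj[of f X Y] by simp

lemma Add_arr_neg: "f \<in> hom_set T X Y \<Longrightarrow> Add_arr T f (neg X Y f) = Zero_arr T X Y"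
  using abelian_group.r_neg[OF hom_abelian_group[of X Y], of f] hom_set_Obj[of f X Y] by simp

text \<open>An additive map sends zero to an element that equals its own double, so this is how zero
  morphisms are seen to be preserved.\<close>

lemma Add_arr_idem_zero:
  assumes "f \<in> hom_set T X Y" "Add_arr T f f = f"
  shows "f = Zero_arr T X Y"
proof -
  interpret G: abelian_group "hom_group T X Y"
    by (rule hom_abelian_group) (use hom_set_Obj[OF assms(1)] in auto)
  show ?thesis using assms G.add.l_cancel_one[of f f] by simp
qed

lemma neg_unique:
  assumes "f \<in> hom_set T X Y" "g \<in> hom_set T X Y" "Add_arr T f g = Zero_arr T X Y"
  shows "g = neg X Y f"
proof -
  interpret G: abelian_group "hom_group T X Y"
    by (rule hom_abelian_group) (use hom_set_Obj[OF assms(1)] in auto)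
  show ?thesis using assms G.minus_equality[of g f] G.a_comm[of f g] by simp
qed

lemma neg_neg: "f \<in> hom_set T X Y \<Longrightarrow> neg X Y (neg X Y f) = f"
  using abelian_group.minus_minus[OF hom_abelian_group[of X Y], of f] hom_set_Obj[of f X Y] by simp

lemma Add_arr_neg_eq_zero:
  assumes "f \<in> hom_set T X Y" "g \<in> hom_set T X Y" "Add_arr T f (neg X Y g) = Zero_arr T X Y"
  shows "f = g"
  using neg_unique[OF assms(1) neg_hom[OF assms(2)] assms(3)] neg_neg assms by metis

lemma Comp_zero_left:
  assumes "f \<in> hom_set T X Y" "Z \<in> Obj T"
  shows "Zero_arr T Y Z \<cdot> f = Zero_arr T X Z"
proof (rule Add_arr_idem_zero)
  have z: "Zero_arr T Y Z \<in> hom_set T Y Z" using assms hom_set_Obj Zero_arr_hom by blast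
  show "Zero_arr T Y Z \<cdot> f \<in> hom_set T X Z" by (rule Comp_hom[OF assms(1) z])
  show "Add_arr T (Zero_arr T Y Z \<cdot> f) (Zero_arr T Y Z \<cdot> f) = Zero_arr T Y Z \<cdot> f"
    using Comp_add_left[OF assms(1) z z] Add_arr_zero[OF z] by simp
qed

lemma Comp_zero_right:
  assumes "f \<in> hom_set T Y Z" "X \<in> Obj T"
  shows "f \<cdot> Zero_arr T X Y = Zero_arr T X Z"
proof (rule Add_arr_idem_zero)
  have z: "Zero_arr T X Y \<in> hom_set T X Y" using assms hom_set_Obj Zero_arr_hom by blast
  show "f \<cdot> Zero_arr T X Y \<in> hom_set T X Z" by (rule Comp_hom[OF z assms(1)])
  show "Add_arr T (f \<cdot> Zero_arr T X Y) (f \<cdot> Zero_arr T X Y) = f \<cdot> Zero_arr T X Y"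
    using Comp_add_right[OF z z assms(1)] Add_arr_zero[OF z] by simp
qed

lemma Comp_neg_left:
  assumes "f \<in> hom_set T X Y" "g \<in> hom_set T Y Z"
  shows "neg Y Z g \<cdot> f = neg X Z (g \<cdot> f)"
  by (rule neg_unique)
    (use assms Comp_hom neg_hom Comp_add_left[OF assms(1,2) neg_hom[OF assms(2)]] Add_arr_neg
      Comp_zero_left[OF assms(1)] hom_set_Obj in \<open>metis+\<close>)

lemma Comp_neg_right:
  assumes "f \<in> hom_set T X Y" "g \<in> hom_set T Y Z"
  shows "g \<cdot> neg X Y f = neg X Z (g \<cdot> f)"
  by (rule neg_unique)
    (use assms Comp_hom neg_hom Comp_add_right[OF assms(1) neg_hom[OF assms(1)] assms(2)] Add_arr_neg
      Comp_zero_right[OF assms(2)] hom_set_Obj in \<open>metis+\<close>)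

text \<open>An equation between morphisms, unlike the universal property, is visibly preserved by
  suspensions.\<close>

lemma zero_object_iff:
  "zero_object T N \<longleftrightarrow> N \<in> Obj T \<and> Idn T N = Zero_arr T N N"
proof
  assume z: "zero_object T N"
  then have "N \<in> Obj T" by (simp add: zero_object_def)
  then show "N \<in> Obj T \<and> Idn T N = Zero_arr T N N"
    using z Idn_hom[of N] Zero_arr_hom[of N N] unfolding zero_object_def by blast
next
  assume a: "N \<in> Obj T \<and> Idn T N = Zero_arr T N N"
  have "f = Zero_arr T N X" if "f \<in> hom_set T N X" for f X
    using Comp_Idn[OF that] Comp_zero_right[OF that] a by metis
  moreover have "f = Zero_arr T X N" if "f \<in> hom_set T X N" for f X
    using Idn_Comp[OF that] Comp_zero_left[OF that] a by metis
  ultimately show "zero_object T N" unfolding zero_object_def using a Zero_arr_hom by metis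
qed

lemma hom_from_zero: "\<lbrakk>zero_object T N; f \<in> hom_set T N X\<rbrakk> \<Longrightarrow> f = Zero_arr T N X"
  unfolding zero_object_def using Zero_arr_hom hom_set_Obj by metis

end

section \<open>Integer powers of the suspension and exactness of Hom\<close>

context triangulated_category
begin

lemma sus_ob_eq: "sus_ob T n X = bij_power (Obj T) (Sus_ob T) n X"
  by (simp add: sus_ob_def bij_power_def)

lemma sus_arr_eq: "sus_arr T n f = bij_power (Arr T) (Sus_arr T) n f"
  by (simp add: sus_arr_def bij_power_def)

lemma sus_ob_closed: "X \<in> Obj T \<Longrightarrow> sus_ob T n X \<in> Obj T"
  by (simp add: sus_ob_eq bij_power_closed Sus_ob_bij)

lemma sus_ob_add: "X \<in> Obj T \<Longrightarrow> sus_ob T m (sus_ob T n X) = sus_ob T (m + n) X"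
  by (simp add: sus_ob_eq bij_power_add Sus_ob_bij)

lemma sus_ob_0 [simp]: "sus_ob T 0 X = X"
  by (simp add: sus_ob_def)

lemma sus_ob_1: "sus_ob T 1 X = Sus_ob T X"
  by (simp add: sus_ob_def)

lemma sus_ob_cancel [simp]: "X \<in> Obj T \<Longrightarrow> sus_ob T (- n) (sus_ob T n X) = X"
  "X \<in> Obj T \<Longrightarrow> sus_ob T n (sus_ob T (- n) X) = X"
  by (simp_all add: sus_ob_add)

lemma Sus_ob_closed: "X \<in> Obj T \<Longrightarrow> Sus_ob T X \<in> Obj T"
  using sus_ob_closed[of X 1] by (simp add: sus_ob_1)

lemma hom_Arr: "f \<in> hom_set T X Y \<Longrightarrow> f \<in> Arr T"
  by (simp add: hom_set_def)

lemma Arr_hom: "f \<in> Arr T \<Longrightarrow> f \<in> hom_set T (Dom T f) (Cod T f)"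
  by (simp add: hom_set_def)

lemma sus_arr_add: "f \<in> hom_set T X Y \<Longrightarrow> sus_arr T m (sus_arr T n f) = sus_arr T (m + n) f"
  by (simp add: sus_arr_eq bij_power_add Sus_arr_bij hom_Arr)

lemma sus_arr_0 [simp]: "sus_arr T 0 f = f"
  by (simp add: sus_arr_def)

lemma sus_arr_1: "sus_arr T 1 f = Sus_arr T f"
  by (simp add: sus_arr_def)

lemma sus_arr_cancel [simp]: "f \<in> hom_set T X Y \<Longrightarrow> sus_arr T (- n) (sus_arr T n f) = f"
  "f \<in> hom_set T X Y \<Longrightarrow> sus_arr T n (sus_arr T (- n) f) = f"
  by (simp_all add: sus_arr_add)

lemma sus_arr_Suc: "f \<in> hom_set T X Y \<Longrightarrow> sus_arr T (n + 1) f = Sus_arr T (sus_arr T n f)"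
  by (simp add: sus_arr_eq bij_power_Suc Sus_arr_bij hom_Arr)

lemma sus_ob_Suc: "X \<in> Obj T \<Longrightarrow> sus_ob T (n + 1) X = Sus_ob T (sus_ob T n X)"
  by (simp add: sus_ob_eq bij_power_Suc Sus_ob_bij)

lemma Sus_arr_inj: "\<lbrakk>f \<in> Arr T; g \<in> Arr T; Sus_arr T f = Sus_arr T g\<rbrakk> \<Longrightarrow> f = g"
  using Sus_arr_bij by (auto simp: bij_betw_def inj_on_def)

lemma Sus_ob_inj: "\<lbrakk>X \<in> Obj T; Y \<in> Obj T; Sus_ob T X = Sus_ob T Y\<rbrakk> \<Longrightarrow> X = Y"
  using Sus_ob_bij by (auto simp: bij_betw_def inj_on_def)

text \<open>Domain and codomain are recovered from injectivity on objects; this is the downward step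
  of the induction in \<open>sus_hom\<close>.\<close>

lemma Sus_hom_iff:
  assumes "f \<in> Arr T" "X \<in> Obj T" "Y \<in> Obj T" "Sus_arr T f \<in> hom_set T (Sus_ob T X) (Sus_ob T Y)"
  shows "f \<in> hom_set T X Y"
proof -
  have "Sus_arr T f \<in> hom_set T (Sus_ob T (Dom T f)) (Sus_ob T (Cod T f))"
    by (rule Sus_hom[OF Arr_hom[OF assms(1)]])
  then have "Sus_ob T (Dom T f) = Sus_ob T X" "Sus_ob T (Cod T f) = Sus_ob T Y"
    using assms(4) by (auto simp: hom_set_def)
  then have "Dom T f = X" "Cod T f = Y" using Sus_ob_inj assms Dom_Obj Cod_Obj by blast+
  then show ?thesis using Arr_hom[OF assms(1)] by simp
qed

lemma sus_hom:
  assumes "f \<in> hom_set T X Y"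
  shows "sus_arr T n f \<in> hom_set T (sus_ob T n X) (sus_ob T n Y)"
proof (induction n rule: int_induct[where k = 0])
  case base
  then show ?case using assms by simp
next
  case (step1 n)
  then show ?case using Sus_hom assms by (simp add: sus_arr_Suc sus_ob_Suc hom_set_Obj[OF assms])
next
  case (step2 n)
  have XY: "X \<in> Obj T" "Y \<in> Obj T" using hom_set_Obj assms by auto
  show ?case
  proof (rule Sus_hom_iff)
    show "sus_arr T (n - 1) f \<in> Arr T"
      using assms by (simp add: sus_arr_eq bij_power_closed Sus_arr_bij hom_Arr)
    show "Sus_arr T (sus_arr T (n - 1) f)
      \<in> hom_set T (Sus_ob T (sus_ob T (n - 1) X)) (Sus_ob T (sus_ob T (n - 1) Y))"
      using step2 sus_arr_Suc[OF assms, of "n - 1"] sus_ob_Suc[of _ "n - 1"] XY by simp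
  qed (use sus_ob_closed XY in auto)
qed

lemma sus_Comp:
  assumes "f \<in> hom_set T X Y" "g \<in> hom_set T Y Z"
  shows "sus_arr T n (g \<cdot> f) = sus_arr T n g \<cdot> sus_arr T n f"
proof (induction n rule: int_induct[where k = 0])
  case (step1 n)
  then show ?case
    using sus_arr_Suc[OF Comp_hom[OF assms]] sus_arr_Suc[OF assms(1)] sus_arr_Suc[OF assms(2)]
      Sus_Comp[OF sus_hom[OF assms(1)] sus_hom[OF assms(2)]] by simp
next
  case (step2 n)
  \<comment> \<open>In the downward step both sides are compared after one application of
    \<open>Sus_arr\<close>, which is injective.\<close>
  have *: "Sus_arr T (sus_arr T (n - 1) h) = sus_arr T n h" if "h \<in> hom_set T A B" for h A B
    using sus_arr_Suc[OF that, of "n - 1"] by simp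
  have "Sus_arr T (sus_arr T (n - 1) (g \<cdot> f)) = Sus_arr T (sus_arr T (n - 1) g \<cdot> sus_arr T (n - 1) f)"
    using step2 *[OF assms(1)] *[OF assms(2)] *[OF Comp_hom[OF assms]]
      Sus_Comp[OF sus_hom[OF assms(1)] sus_hom[OF assms(2)], of "n - 1"] by simp
  then show ?case
    using Sus_arr_inj hom_Arr[OF Comp_hom[OF sus_hom[OF assms(1)] sus_hom[OF assms(2)]]]
      hom_Arr[OF sus_hom[OF Comp_hom[OF assms]]] by blast
qed simp

lemma sus_add:
  assumes "f \<in> hom_set T X Y" "g \<in> hom_set T X Y"
  shows "sus_arr T n (Add_arr T f g) = Add_arr T (sus_arr T n f) (sus_arr T n g)"
proof (induction n rule: int_induct[where k = 0])
  case (step1 n)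
  then show ?case
    using sus_arr_Suc[OF Add_arr_hom[OF assms]] sus_arr_Suc[OF assms(1)] sus_arr_Suc[OF assms(2)]
      Sus_add[OF sus_hom[OF assms(1)] sus_hom[OF assms(2)]] by simp
next
  case (step2 n)
  have *: "Sus_arr T (sus_arr T (n - 1) h) = sus_arr T n h" if "h \<in> hom_set T A B" for h A B
    using sus_arr_Suc[OF that, of "n - 1"] by simp
  have "Sus_arr T (sus_arr T (n - 1) (Add_arr T f g)) =
      Sus_arr T (Add_arr T (sus_arr T (n - 1) f) (sus_arr T (n - 1) g))"
    using step2 *[OF assms(1)] *[OF assms(2)] *[OF Add_arr_hom[OF assms]]
      Sus_add[OF sus_hom[OF assms(1)] sus_hom[OF assms(2)], of "n - 1"] by simp
  then show ?case
    using Sus_arr_inj hom_Arr[OF Add_arr_hom[OF sus_hom[OF assms(1)] sus_hom[OF assms(2)]]]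
      hom_Arr[OF sus_hom[OF Add_arr_hom[OF assms]]] by blast
qed simp

lemma sus_zero:
  assumes "X \<in> Obj T" "Y \<in> Obj T"
  shows "sus_arr T n (Zero_arr T X Y) = Zero_arr T (sus_ob T n X) (sus_ob T n Y)"
proof (rule Add_arr_idem_zero)
  note z = Zero_arr_hom[OF assms]
  show "sus_arr T n (Zero_arr T X Y) \<in> hom_set T (sus_ob T n X) (sus_ob T n Y)"
    by (rule sus_hom[OF z])
  show "Add_arr T (sus_arr T n (Zero_arr T X Y)) (sus_arr T n (Zero_arr T X Y)) = sus_arr T n (Zero_arr T X Y)"
    using sus_add[OF z z, of n] Add_arr_zero[OF z] by simp
qed

text \<open>Every endomorphism of the suspended object is itself a suspension. Desuspending its
  identity to \<open>?g\<close> and suspending \<open>Idn T X \<cdot> ?g\<close> shows that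
  \<open>?e\<close> is neutral.\<close>

lemma sus_Idn: "X \<in> Obj T \<Longrightarrow> sus_arr T n (Idn T X) = Idn T (sus_ob T n X)"
proof -
  assume X: "X \<in> Obj T"
  let ?e = "sus_arr T n (Idn T X)" and ?Y = "sus_ob T n X"
  have e: "?e \<in> hom_set T ?Y ?Y" by (rule sus_hom[OF Idn_hom[OF X]])
  have Y: "?Y \<in> Obj T" using X sus_ob_closed by blast
  let ?g = "sus_arr T (- n) (Idn T ?Y)"
  have g: "?g \<in> hom_set T X X" using sus_hom[OF Idn_hom[OF Y], of "- n"] X by simp
  have "sus_arr T n (Idn T X \<cdot> ?g) = ?e \<cdot> sus_arr T n ?g" by (rule sus_Comp[OF g Idn_hom[OF X]])
  then have "Idn T ?Y = ?e \<cdot> Idn T ?Y" using Idn_Comp[OF g] Idn_hom[OF Y] by simp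
  then show ?thesis using Comp_Idn[OF e] by simp
qed

lemma zero_object_sus: "zero_object T N \<Longrightarrow> zero_object T (sus_ob T n N)"
  using zero_object_iff sus_ob_closed sus_Idn sus_zero by metis

text \<open>The identity of \<open>X\<close> and \<open>u\<close> map the trivial triangle on
  \<open>X\<close> to the given one; the third component factors \<open>v \<cdot> u\<close> through
  a zero object.\<close>

lemma triangle_comp_zero:
  assumes tri: "(u, v, w) \<in> Triangles T"
    and u: "u \<in> hom_set T X Y" and v: "v \<in> hom_set T Y Z" and w: "w \<in> hom_set T Z (Sus_ob T X)"
  shows "v \<cdot> u = Zero_arr T X Z"
proof -
  obtain N where N: "zero_object T N" using zero_object_exists by blast
  have X: "X \<in> Obj T" and Z: "Z \<in> Obj T" and NO: "N \<in> Obj T"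
    using u v N hom_set_Obj by (auto simp: zero_object_def)
  have zX: "Zero_arr T X N \<in> hom_set T X N" and zN: "Zero_arr T N (Sus_ob T X) \<in> hom_set T N (Sus_ob T X)"
    using Zero_arr_hom X NO Sus_ob_closed by auto
  have "Idn T X \<in> hom_set T (Dom T (Idn T X)) (Dom T u)"
    using Idn_hom[OF X] u by (simp add: hom_set_def)
  moreover have "u \<in> hom_set T (Dom T (Zero_arr T X N)) (Dom T v)"
    using u v zX by (simp add: hom_set_def)
  ultimately have "\<exists>c\<in>hom_set T (Dom T (Zero_arr T N (Sus_ob T X))) (Dom T w).
      c \<cdot> Zero_arr T X N = v \<cdot> u"
    using triangle_morphism[OF triangle_Idn[OF X N] tri, of "Idn T X" u] by blast
  then obtain c where c: "c \<in> hom_set T N Z" "c \<cdot> Zero_arr T X N = v \<cdot> u"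
    using zN w by (auto simp: hom_set_def)
  then show ?thesis using Comp_zero_right[OF c(1) X] by simp
qed

text \<open>One rotation gives the first equation and two give the second, where the sign of the
  suspended \<open>u\<close> has to be cleared.\<close>

lemma triangle_comp_zero_rotated:
  assumes tri: "(u, v, w) \<in> Triangles T"
    and u: "u \<in> hom_set T X Y" and v: "v \<in> hom_set T Y Z" and w: "w \<in> hom_set T Z (Sus_ob T X)"
  shows "w \<cdot> v = Zero_arr T Y (Sus_ob T X)" "Sus_arr T u \<cdot> w = Zero_arr T Z (Sus_ob T Y)"
proof -
  let ?u = "neg (Sus_ob T X) (Sus_ob T Y) (Sus_arr T u)"
  have Su: "Sus_arr T u \<in> hom_set T (Sus_ob T X) (Sus_ob T Y)" by (rule Sus_hom[OF u])
  have u': "?u \<in> hom_set T (Sus_ob T X) (Sus_ob T Y)" by (rule neg_hom[OF Su])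
  have tri': "(v, w, ?u) \<in> Triangles T" using triangle_rotate[OF u v w] tri by simp
  show "w \<cdot> v = Zero_arr T Y (Sus_ob T X)" by (rule triangle_comp_zero[OF tri' v w u'])
  have "(w, ?u, neg (Sus_ob T Y) (Sus_ob T Z) (Sus_arr T v)) \<in> Triangles T"
    using triangle_rotate[OF v w u'] tri' by simp
  then have "?u \<cdot> w = Zero_arr T Z (Sus_ob T Y)"
    by (rule triangle_comp_zero[OF _ w u' neg_hom[OF Sus_hom[OF v]]])
  moreover have "Sus_arr T u = neg (Sus_ob T X) (Sus_ob T Y) ?u" using neg_neg[OF Su] by simp
  ultimately have "Sus_arr T u \<cdot> w = neg Z (Sus_ob T Y) (Zero_arr T Z (Sus_ob T Y))"
    using Comp_neg_left[OF w u'] by simp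
  moreover have "neg Z (Sus_ob T Y) (Zero_arr T Z (Sus_ob T Y)) = Zero_arr T Z (Sus_ob T Y)"
    using hom_set_Obj w Su Zero_arr_hom Add_arr_zero neg_unique by metis
  ultimately show "Sus_arr T u \<cdot> w = Zero_arr T Z (Sus_ob T Y)" by simp
qed

text \<open>A map \<open>h\<close> that vanishes on \<open>X\<close> is part of a morphism from the
  triangle to \<open>0 \<rightarrow> A \<rightarrow> A \<rightarrow> 0\<close>; completing the
  morphism factors \<open>h\<close> through \<open>v\<close>.\<close>

lemma hom_exact:
  assumes "(u, v, w) \<in> Triangles T"
    and u: "u \<in> hom_set T X Y" and v: "v \<in> hom_set T Y Z" and w: "w \<in> hom_set T Z (Sus_ob T X)"
    and h: "h \<in> hom_set T Y A" and "h \<cdot> u = Zero_arr T X A"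
  obtains g where "g \<in> hom_set T Z A" "g \<cdot> v = h"
proof -
  obtain N where N: "zero_object T N" using zero_object_exists by blast
  let ?S = "Sus_ob T N"
  have S: "zero_object T ?S" using zero_object_sus[OF N, of 1] by (simp add: sus_ob_1)
  have A: "A \<in> Obj T" and X: "X \<in> Obj T" using h u hom_set_Obj by auto
  have NO: "N \<in> Obj T" and SO: "?S \<in> Obj T" using N S by (auto simp: zero_object_def)
  have za: "Zero_arr T N A \<in> hom_set T N A" and zs: "Zero_arr T A ?S \<in> hom_set T A ?S"
    using Zero_arr_hom A NO SO by auto
  have "neg ?S (Sus_ob T A) (Sus_arr T (Zero_arr T N A)) \<in> hom_set T ?S (Sus_ob T A)"
    by (rule neg_hom[OF Sus_hom[OF za]])
  then have "neg ?S (Sus_ob T A) (Sus_arr T (Zero_arr T N A)) = Zero_arr T ?S (Sus_ob T A)"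
    using hom_from_zero[OF S] by blast
  \<comment> \<open>The trivial triangle on \<open>A\<close>, rotated backwards. Its third map
    starts at a zero object, so the sign of the rotation is invisible.\<close>
  then have "(Zero_arr T N A, Idn T A, Zero_arr T A ?S) \<in> Triangles T"
    using triangle_rotate[OF za Idn_hom[OF A] zs] triangle_Idn[OF A S] by simp
  moreover have "Zero_arr T X N \<in> hom_set T (Dom T u) (Dom T (Zero_arr T N A))"
    using Zero_arr_hom[OF X NO] u za by (simp add: hom_set_def)
  moreover have "h \<in> hom_set T (Dom T v) (Dom T (Idn T A))"
    using h v Idn_hom[OF A] by (simp add: hom_set_def)
  moreover have "h \<cdot> u = Zero_arr T N A \<cdot> Zero_arr T X N"
    using assms(6) Comp_zero_right[OF za X] by simp
  ultimately have "\<exists>c\<in>hom_set T (Dom T w) (Dom T (Zero_arr T A ?S)). c \<cdot> v = Idn T A \<cdot> h"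
    using triangle_morphism[OF assms(1)] by meson
  then have "\<exists>c\<in>hom_set T Z A. c \<cdot> v = h"
    using w zs Idn_Comp[OF h] by (simp add: hom_set_def)
  then show ?thesis using that by blast
qed

text \<open>Suspending the triangle would change signs, so \<open>h\<close> is desuspended instead,
  factored there, and the factor is suspended again.\<close>

lemma hom_exact_sus:
  assumes "(u, v, w) \<in> Triangles T"
    and u: "u \<in> hom_set T X Y" and v: "v \<in> hom_set T Y Z" and w: "w \<in> hom_set T Z (Sus_ob T X)"
    and h: "h \<in> hom_set T (sus_ob T n Y) A" and hu: "h \<cdot> sus_arr T n u = Zero_arr T (sus_ob T n X) A"
  obtains g where "g \<in> hom_set T (sus_ob T n Z) A" "g \<cdot> sus_arr T n v = h"
proof -
  have O: "X \<in> Obj T" "Y \<in> Obj T" "A \<in> Obj T" using u h hom_set_Obj by auto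
  have h': "sus_arr T (- n) h \<in> hom_set T Y (sus_ob T (- n) A)" using sus_hom[OF h, of "- n"] O by simp
  have "sus_arr T (- n) h \<cdot> u = sus_arr T (- n) (h \<cdot> sus_arr T n u)"
    using sus_Comp[OF sus_hom[OF u] h, of "- n"] u by simp
  also have "\<dots> = Zero_arr T X (sus_ob T (- n) A)"
    using hu sus_zero[of "sus_ob T n X" A "- n"] O sus_ob_closed by simp
  finally obtain g where g: "g \<in> hom_set T Z (sus_ob T (- n) A)" "g \<cdot> v = sus_arr T (- n) h"
    using hom_exact[OF assms(1) u v w h'] by blast
  have "sus_arr T n g \<in> hom_set T (sus_ob T n Z) A" using sus_hom[OF g(1), of n] O by simp
  moreover have "sus_arr T n g \<cdot> sus_arr T n v = h"
    using sus_Comp[OF v g(1), of n] g(2) h by simp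
  ultimately show ?thesis using that by blast
qed

text \<open>The triangle rotated twice has the negative of the suspended \<open>u\<close> as its
  second map; the sign is absorbed into the factor.\<close>

lemma hom_exact_rotated_sus:
  assumes "(u, v, w) \<in> Triangles T"
    and u: "u \<in> hom_set T X Y" and v: "v \<in> hom_set T Y Z" and w: "w \<in> hom_set T Z (Sus_ob T X)"
    and h: "h \<in> hom_set T (sus_ob T (n + 1) X) A" and hw: "h \<cdot> sus_arr T n w = Zero_arr T (sus_ob T n Z) A"
  obtains g where "g \<in> hom_set T (sus_ob T (n + 1) Y) A" "g \<cdot> sus_arr T (n + 1) u = h"
proof -
  have O: "X \<in> Obj T" "Y \<in> Obj T" "A \<in> Obj T" using u h hom_set_Obj by auto
  let ?u = "neg (Sus_ob T X) (Sus_ob T Y) (Sus_arr T u)"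
  let ?v = "neg (Sus_ob T Y) (Sus_ob T Z) (Sus_arr T v)"
  have Su: "Sus_arr T u \<in> hom_set T (Sus_ob T X) (Sus_ob T Y)" by (rule Sus_hom[OF u])
  have u': "?u \<in> hom_set T (Sus_ob T X) (Sus_ob T Y)" by (rule neg_hom[OF Su])
  have v': "?v \<in> hom_set T (Sus_ob T Y) (Sus_ob T Z)" by (rule neg_hom[OF Sus_hom[OF v]])
  have "(v, w, ?u) \<in> Triangles T" using triangle_rotate[OF u v w] assms(1) by simp
  then have tri: "(w, ?u, ?v) \<in> Triangles T" using triangle_rotate[OF v w u'] by simp
  have SX: "sus_ob T n (Sus_ob T X) = sus_ob T (n + 1) X" "sus_ob T n (Sus_ob T Y) = sus_ob T (n + 1) Y"
    using O sus_ob_add[of _ n 1] by (simp_all add: sus_ob_1)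
  obtain g where g: "g \<in> hom_set T (sus_ob T (n + 1) Y) A" "g \<cdot> sus_arr T n ?u = h"
    using hom_exact_sus[OF tri w u' v', of h n A] h hw SX by auto
  have su: "sus_arr T n (Sus_arr T u) = sus_arr T (n + 1) u"
    using sus_arr_add[OF u, of n 1] by (simp add: sus_arr_1)
  have s': "sus_arr T (n + 1) u \<in> hom_set T (sus_ob T (n + 1) X) (sus_ob T (n + 1) Y)" by (rule sus_hom[OF u])
  have "Add_arr T (sus_arr T (n + 1) u) (sus_arr T n ?u) = Zero_arr T (sus_ob T (n + 1) X) (sus_ob T (n + 1) Y)"
    using sus_add[OF Su u', of n] Add_arr_neg[OF Su] sus_zero[of "Sus_ob T X" "Sus_ob T Y" n] O Sus_ob_closed su SX
    by simp
  then have "sus_arr T n ?u = neg (sus_ob T (n + 1) X) (sus_ob T (n + 1) Y) (sus_arr T (n + 1) u)"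
    using neg_unique[OF s'] sus_hom[OF u', of n] SX by simp
  then have "neg (sus_ob T (n + 1) Y) A g \<cdot> sus_arr T (n + 1) u = h"
    using g Comp_neg_left[OF s' g(1)] Comp_neg_right[OF s' g(1)] by simp
  then show ?thesis using that neg_hom[OF g(1)] by blast
qed

end

section \<open>Cohomological functors to abelian groups\<close>

text \<open>The degree 0 shadow of a graded functor, with the other degrees reached through
  suspensions. Both exactness conditions say that the kernel lies in the image; the converse comes
  from the vanishing composites in a triangle.\<close>

locale cohomological_group_functor = triangulated_category T
  for T :: "('o, 'm, 'z) triang_category_scheme" (structure) +
  fixes H :: "'o \<Rightarrow> 'x ring" and Hm :: "'m \<Rightarrow> 'x \<Rightarrow> 'x"
  assumes H_group: "X \<in> Obj T \<Longrightarrow> abelian_group (H X)"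
    and Hm_closed: "\<lbrakk>h \<in> hom_set T X Y; y \<in> carrier (H Y)\<rbrakk> \<Longrightarrow> Hm h y \<in> carrier (H X)"
    and Hm_add: "\<lbrakk>h \<in> hom_set T X Y; y \<in> carrier (H Y); z \<in> carrier (H Y)\<rbrakk> \<Longrightarrow>
      Hm h (y \<oplus>\<^bsub>H Y\<^esub> z) = Hm h y \<oplus>\<^bsub>H X\<^esub> Hm h z"
    and Hm_Idn: "\<lbrakk>X \<in> Obj T; y \<in> carrier (H X)\<rbrakk> \<Longrightarrow> Hm (Idn T X) y = y"
    and Hm_Comp: "\<lbrakk>h \<in> hom_set T X Y; k \<in> hom_set T Y Z; z \<in> carrier (H Z)\<rbrakk> \<Longrightarrow>
      Hm (k \<cdot> h) z = Hm h (Hm k z)"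
    and Hm_Add_arr: "\<lbrakk>h \<in> hom_set T X Y; k \<in> hom_set T X Y; y \<in> carrier (H Y)\<rbrakk> \<Longrightarrow>
      Hm (Add_arr T h k) y = Hm h y \<oplus>\<^bsub>H X\<^esub> Hm k y"
    and H_exact: "\<lbrakk>(u, v, w) \<in> Triangles T; u \<in> hom_set T X Y; v \<in> hom_set T Y Z;
        w \<in> hom_set T Z (Sus_ob T X);
        y \<in> carrier (H (sus_ob T n Y)); Hm (sus_arr T n u) y = \<zero>\<^bsub>H (sus_ob T n X)\<^esub>\<rbrakk> \<Longrightarrow>
      \<exists>z\<in>carrier (H (sus_ob T n Z)). Hm (sus_arr T n v) z = y"
    and H_exact_rotated: "\<lbrakk>(u, v, w) \<in> Triangles T; u \<in> hom_set T X Y; v \<in> hom_set T Y Z;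
        w \<in> hom_set T Z (Sus_ob T X);
        z \<in> carrier (H (sus_ob T n Z)); Hm (sus_arr T n v) z = \<zero>\<^bsub>H (sus_ob T n Y)\<^esub>\<rbrakk> \<Longrightarrow>
      \<exists>t\<in>carrier (H (sus_ob T (n + 1) X)). Hm (sus_arr T n w) t = z"
begin

lemma H_add: "\<lbrakk>X \<in> Obj T; a \<in> carrier (H X); b \<in> carrier (H X)\<rbrakk> \<Longrightarrow> a \<oplus>\<^bsub>H X\<^esub> b \<in> carrier (H X)"
  using abelian_monoid.a_closed[OF abelian_group.axioms(1)[OF H_group]] .

lemma H_idem_zero:
  assumes "X \<in> Obj T" "a \<in> carrier (H X)" "a \<oplus>\<^bsub>H X\<^esub> a = a"
  shows "a = \<zero>\<^bsub>H X\<^esub>"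
proof -
  interpret P: abelian_group "H X" by (rule H_group[OF assms(1)])
  show ?thesis using assms P.add.l_cancel_one[of a a] by simp
qed

lemma Hm_zero:
  assumes "h \<in> hom_set T X Y"
  shows "Hm h \<zero>\<^bsub>H Y\<^esub> = \<zero>\<^bsub>H X\<^esub>"
proof -
  have O: "X \<in> Obj T" "Y \<in> Obj T" using hom_set_Obj assms by auto
  interpret Q: abelian_group "H Y" by (rule H_group[OF O(2)])
  show ?thesis using H_idem_zero[OF O(1), of "Hm h \<zero>\<^bsub>H Y\<^esub>"] Hm_closed[OF assms]
      Hm_add[OF assms Q.zero_closed Q.zero_closed] by simp
qed

lemma Hm_zero_arr:
  assumes "X \<in> Obj T" "Y \<in> Obj T" "y \<in> carrier (H Y)"
  shows "Hm (Zero_arr T X Y) y = \<zero>\<^bsub>H X\<^esub>"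
proof -
  have z: "Zero_arr T X Y \<in> hom_set T X Y" using assms Zero_arr_hom by blast
  show ?thesis using H_idem_zero[OF assms(1), of "Hm (Zero_arr T X Y) y"] Hm_closed[OF z assms(3)]
      Hm_Add_arr[OF z z assms(3)] Add_arr_zero[OF z] by simp
qed

lemma Hm_neg:
  assumes "h \<in> hom_set T X Y" "y \<in> carrier (H Y)"
  shows "Hm (neg X Y h) y = \<ominus>\<^bsub>H X\<^esub> Hm h y"
proof -
  have O: "X \<in> Obj T" "Y \<in> Obj T" using hom_set_Obj assms by auto
  interpret P: abelian_group "H X" by (rule H_group[OF O(1)])
  have c: "Hm (neg X Y h) y \<in> carrier (H X)" "Hm h y \<in> carrier (H X)"
    using Hm_closed[OF _ assms(2)] assms(1) neg_hom[OF assms(1)] by auto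
  have "Hm h y \<oplus>\<^bsub>H X\<^esub> Hm (neg X Y h) y = \<zero>\<^bsub>H X\<^esub>"
    using Hm_Add_arr[OF assms(1) neg_hom[OF assms(1)] assms(2)] Add_arr_neg[OF assms(1)]
      Hm_zero_arr[OF O assms(2)] by simp
  then show ?thesis using P.minus_equality[of "Hm (neg X Y h) y" "Hm h y"] c by (simp add: P.a_comm)
qed

text \<open>Pull \<open>x\<close> back along \<open>p\<close> and \<open>y\<close> along
  \<open>q\<close>, and add. This merges two Yoneda maps, from \<open>X\<close> and from
  \<open>Y\<close>, into one from \<open>S\<close>.\<close>

lemma direct_sum_element:
  assumes i: "i \<in> hom_set T X S" and j: "j \<in> hom_set T Y S"
    and p: "p \<in> hom_set T S X" and q: "q \<in> hom_set T S Y"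
    and eqs: "p \<cdot> i = Idn T X" "q \<cdot> j = Idn T Y" "q \<cdot> i = Zero_arr T X Y" "p \<cdot> j = Zero_arr T Y X"
    and x: "x \<in> carrier (H X)" and y: "y \<in> carrier (H Y)"
  obtains z where "z \<in> carrier (H S)" "Hm i z = x" "Hm j z = y"
proof
  have O: "X \<in> Obj T" "Y \<in> Obj T" "S \<in> Obj T" using i j hom_set_Obj by auto
  interpret P: abelian_group "H X" by (rule H_group[OF O(1)])
  interpret Q: abelian_group "H Y" by (rule H_group[OF O(2)])
  let ?z = "Hm p x \<oplus>\<^bsub>H S\<^esub> Hm q y"
  have px: "Hm p x \<in> carrier (H S)" and qy: "Hm q y \<in> carrier (H S)"
    using Hm_closed[OF p x] Hm_closed[OF q y] by auto
  show "?z \<in> carrier (H S)" by (rule H_add[OF O(3) px qy])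
  have "Hm i (Hm p x) = x" "Hm i (Hm q y) = \<zero>\<^bsub>H X\<^esub>" "Hm j (Hm p x) = \<zero>\<^bsub>H Y\<^esub>" "Hm j (Hm q y) = y"
    using Hm_Comp[OF i p x] Hm_Comp[OF i q y] Hm_Comp[OF j p x] Hm_Comp[OF j q y] eqs
      Hm_Idn[OF O(1) x] Hm_Idn[OF O(2) y] Hm_zero_arr[OF O(1,2) y] Hm_zero_arr[OF O(2,1) x] by simp_all
  then show "Hm i ?z = x" "Hm j ?z = y" using Hm_add[OF i px qy] Hm_add[OF j px qy] x y by simp_all
qed

text \<open>By the Yoneda lemma \<open>x\<close> is a transformation from \<open>Hom(-, A)\<close>
  to \<open>H\<close>, and this is its surjectivity at \<open>Y\<close>.\<close>

definition lifts :: "'o \<Rightarrow> 'x \<Rightarrow> 'o \<Rightarrow> bool" where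
  "lifts A x Y \<longleftrightarrow> (\<forall>y\<in>carrier (H Y). \<exists>h\<in>hom_set T Y A. Hm h x = y)"

text \<open>The form that injectivity takes along a sequence: an element of the kernel of the Yoneda
  map of \<open>x\<close> need not vanish, but it dies along \<open>f\<close>.\<close>

definition kills :: "'o \<Rightarrow> 'x \<Rightarrow> 'm \<Rightarrow> 'o \<Rightarrow> 'o \<Rightarrow> bool" where
  "kills A x f B Y \<longleftrightarrow> (\<forall>h\<in>hom_set T Y A. Hm h x = \<zero>\<^bsub>H Y\<^esub> \<longrightarrow> f \<cdot> h = Zero_arr T Y B)"

lemma lifts_retract:
  assumes "r \<in> hom_set T Y X" "p \<in> hom_set T X Y" "p \<cdot> r = Idn T Y"
    and x: "x \<in> carrier (H A)" and "lifts A x X"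
  shows "lifts A x Y"
  unfolding lifts_def
proof
  fix y assume y: "y \<in> carrier (H Y)"
  obtain h where h: "h \<in> hom_set T X A" "Hm h x = Hm p y"
    using assms(5) Hm_closed[OF assms(2) y] unfolding lifts_def by blast
  have "Hm (h \<cdot> r) x = Hm r (Hm p y)" using Hm_Comp[OF assms(1) h(1) x] h(2) by simp
  also have "\<dots> = y" using Hm_Comp[OF assms(1,2) y] assms(3) Hm_Idn y hom_set_Obj[OF assms(1)] by simp
  finally show "\<exists>h\<in>hom_set T Y A. Hm h x = y" using Comp_hom[OF assms(1) h(1)] by blast
qed

lemma kills_retract:
  assumes "r \<in> hom_set T Y X" "p \<in> hom_set T X Y" "p \<cdot> r = Idn T Y"
    and x: "x \<in> carrier (H A)" and f: "f \<in> hom_set T A B" and "kills A x f B X"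
  shows "kills A x f B Y"
  unfolding kills_def
proof (intro ballI impI)
  fix h assume h: "h \<in> hom_set T Y A" "Hm h x = \<zero>\<^bsub>H Y\<^esub>"
  have hp: "h \<cdot> p \<in> hom_set T X A" by (rule Comp_hom[OF assms(2) h(1)])
  have "Hm (h \<cdot> p) x = \<zero>\<^bsub>H X\<^esub>" using Hm_Comp[OF assms(2) h(1) x] h(2) Hm_zero[OF assms(2)] by simp
  then have "f \<cdot> (h \<cdot> p) = Zero_arr T X B" using assms(6) hp unfolding kills_def by blast
  then have "(f \<cdot> (h \<cdot> p)) \<cdot> r = Zero_arr T Y B"
    using Comp_zero_left[OF assms(1)] hom_set_Obj f by metis
  moreover have "(f \<cdot> (h \<cdot> p)) \<cdot> r = f \<cdot> (h \<cdot> (p \<cdot> r))"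
    using Comp_assoc[OF assms(1) hp f] Comp_assoc[OF assms(1,2) h(1)] by simp
  ultimately show "f \<cdot> h = Zero_arr T Y B" using assms(3) Comp_Idn[OF h(1)] by simp
qed

lemma lifts_sum:
  assumes i: "i \<in> hom_set T X S" and j: "j \<in> hom_set T Y S"
    and p: "p \<in> hom_set T S X" and q: "q \<in> hom_set T S Y"
    and id: "Add_arr T (i \<cdot> p) (j \<cdot> q) = Idn T S"
    and x: "x \<in> carrier (H A)" and "lifts A x X" "lifts A x Y"
  shows "lifts A x S"
  unfolding lifts_def
proof
  fix y assume y: "y \<in> carrier (H S)"
  obtain h where h: "h \<in> hom_set T X A" "Hm h x = Hm i y"
    using assms(7) Hm_closed[OF i y] unfolding lifts_def by blast
  obtain k where k: "k \<in> hom_set T Y A" "Hm k x = Hm j y"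
    using assms(8) Hm_closed[OF j y] unfolding lifts_def by blast
  have hp: "h \<cdot> p \<in> hom_set T S A" and kq: "k \<cdot> q \<in> hom_set T S A"
    using Comp_hom[OF p h(1)] Comp_hom[OF q k(1)] by auto
  have "Hm (Add_arr T (h \<cdot> p) (k \<cdot> q)) x = Hm p (Hm i y) \<oplus>\<^bsub>H S\<^esub> Hm q (Hm j y)"
    using Hm_Add_arr[OF hp kq x] Hm_Comp[OF p h(1) x] Hm_Comp[OF q k(1) x] h k by simp
  also have "\<dots> = Hm (Add_arr T (i \<cdot> p) (j \<cdot> q)) y"
    using Hm_Add_arr[OF Comp_hom[OF p i] Comp_hom[OF q j] y] Hm_Comp[OF p i y] Hm_Comp[OF q j y] by simp
  also have "\<dots> = y" using id Hm_Idn y hom_set_Obj[OF i] by simp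
  finally show "\<exists>h\<in>hom_set T S A. Hm h x = y" using Add_arr_hom[OF hp kq] by blast
qed

lemma kills_sum:
  assumes i: "i \<in> hom_set T X S" and j: "j \<in> hom_set T Y S"
    and p: "p \<in> hom_set T S X" and q: "q \<in> hom_set T S Y"
    and id: "Add_arr T (i \<cdot> p) (j \<cdot> q) = Idn T S"
    and x: "x \<in> carrier (H A)" and f: "f \<in> hom_set T A B" and "kills A x f B X" "kills A x f B Y"
  shows "kills A x f B S"
  unfolding kills_def
proof (intro ballI impI)
  fix h assume h: "h \<in> hom_set T S A" "Hm h x = \<zero>\<^bsub>H S\<^esub>"
  have fh: "f \<cdot> h \<in> hom_set T S B" by (rule Comp_hom[OF h(1) f])
  have O: "S \<in> Obj T" "B \<in> Obj T" using hom_set_Obj h f by auto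
  have *: "(f \<cdot> h) \<cdot> (a \<cdot> b) = Zero_arr T S B"
    if "a \<in> hom_set T C S" "b \<in> hom_set T S C" "kills A x f B C" for a b C
  proof -
    have "Hm (h \<cdot> a) x = \<zero>\<^bsub>H C\<^esub>" using Hm_Comp[OF that(1) h(1) x] h(2) Hm_zero[OF that(1)] by simp
    then have "f \<cdot> (h \<cdot> a) = Zero_arr T C B"
      using that(3) Comp_hom[OF that(1) h(1)] unfolding kills_def by blast
    then have "((f \<cdot> h) \<cdot> a) \<cdot> b = Zero_arr T S B"
      using Comp_assoc[OF that(1) h(1) f] Comp_zero_left[OF that(2) O(2)] by simp
    then show ?thesis using Comp_assoc[OF that(2,1) fh] by simp
  qed
  have "f \<cdot> h = (f \<cdot> h) \<cdot> Add_arr T (i \<cdot> p) (j \<cdot> q)" using id Comp_Idn[OF fh] by simp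
  also have "\<dots> = Add_arr T (Zero_arr T S B) (Zero_arr T S B)"
    using Comp_add_right[OF Comp_hom[OF p i] Comp_hom[OF q j] fh] *[OF i p assms(8)] *[OF j q assms(9)] by simp
  also have "\<dots> = Zero_arr T S B" using Add_arr_zero[OF Zero_arr_hom[OF O]] .
  finally show "f \<cdot> h = Zero_arr T S B" .
qed

end

text \<open>On the suspensions of \<open>G\<close>, the functor \<open>H\<close> is the colimit of the functors represented by
  the \<open>A i\<close>.\<close>

locale approximating_sequence = cohomological_group_functor T H Hm
  for T :: "('o, 'm, 'z) triang_category_scheme" (structure)
    and H :: "'o \<Rightarrow> 'x ring" and Hm :: "'m \<Rightarrow> 'x \<Rightarrow> 'x" +
  fixes G :: 'o and A :: "nat \<Rightarrow> 'o" and x :: "nat \<Rightarrow> 'x" and f :: "nat \<Rightarrow> 'm"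
  assumes G_Obj: "G \<in> Obj T"
    and A_Obj: "A i \<in> Obj T"
    and x_closed: "x i \<in> carrier (H (A i))"
    and f_hom: "f i \<in> hom_set T (A i) (A (Suc i))"
    and Hm_f: "Hm (f i) (x (Suc i)) = x i"
    and lifts_G: "lifts (A i) (x i) (sus_ob T n G)"
    and kills_G: "kills (A i) (x i) (f i) (A (Suc i)) (sus_ob T n G)"
begin

text \<open>The second argument counts steps and is not the target stage. New arrows are composed on
  the left, so that \<open>approx_extension\<close> can split off the last one.\<close>

fun tr :: "nat \<Rightarrow> nat \<Rightarrow> 'm" where
  "tr i 0 = Idn T (A i)"
| "tr i (Suc k) = f (i + k) \<cdot> tr i k"

lemma tr_hom: "tr i k \<in> hom_set T (A i) (A (i + k))"
proof (induction k)
  case 0 then show ?case using Idn_hom[OF A_Obj] by simp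
next
  case (Suc k) then show ?case using Comp_hom[OF Suc f_hom] by simp
qed

lemma Hm_tr: "Hm (tr i k) (x (i + k)) = x i"
proof (induction k)
  case 0 then show ?case using Hm_Idn[OF A_Obj x_closed] by simp
next
  case (Suc k)
  then show ?case using Hm_Comp[OF tr_hom f_hom x_closed] Hm_f by simp
qed

lemma tr_1: "tr i (Suc 0) = f i"
  using Comp_Idn[OF f_hom] by simp

text \<open>\<open>k\<close> counts extensions, so \<open>approx k\<close> belongs to
  \<open>thick T G (Suc k)\<close>. All suspensions are included because the chase for an extension
  passes to the next suspension of \<open>Y\<close>.\<close>

definition approx :: "nat \<Rightarrow> 'o \<Rightarrow> bool" where
  "approx k Y \<longleftrightarrow> (\<forall>n. (\<forall>i\<ge>k. lifts (A i) (x i) (sus_ob T n Y)) \<and>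
     (\<forall>i. kills (A i) (x i) (tr i (Suc k)) (A (i + Suc k)) (sus_ob T n Y)))"

lemma approx_G: "approx 0 G"
  using lifts_G kills_G tr_1 by (simp add: approx_def)

lemma approx_zero:
  assumes "zero_object T N"
  shows "approx k N"
proof -
  have "lifts (A i) (x i) (sus_ob T n N)" "kills (A i) (x i) (tr i m) (A (i + m)) (sus_ob T n N)" for i n m
  proof -
    let ?N = "sus_ob T n N"
    have N: "zero_object T ?N" using zero_object_sus assms by blast
    then have O: "?N \<in> Obj T" by (simp add: zero_object_def)
    have H0: "y = \<zero>\<^bsub>H ?N\<^esub>" if "y \<in> carrier (H ?N)" for y
      using Hm_Idn[OF O that] Hm_zero_arr[OF O O that] N by (simp add: zero_object_iff)
    have z: "Zero_arr T ?N (A i) \<in> hom_set T ?N (A i)" by (rule Zero_arr_hom[OF O A_Obj])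
    show "lifts (A i) (x i) ?N" unfolding lifts_def
    proof
      fix y assume "y \<in> carrier (H ?N)"
      then show "\<exists>h\<in>hom_set T ?N (A i). Hm h (x i) = y"
        using H0[of y] H0[OF Hm_closed[OF z x_closed]] z by auto
    qed
    show "kills (A i) (x i) (tr i m) (A (i + m)) ?N"
      unfolding kills_def using hom_from_zero[OF N] Comp_hom tr_hom by blast
  qed
  then show ?thesis unfolding approx_def by blast
qed

lemma approx_sus:
  assumes "Y \<in> Obj T" "approx k Y"
  shows "approx k (sus_ob T n Y)"
  using assms(2) unfolding approx_def by (simp only: sus_ob_add[OF assms(1)]) blast

lemma approx_retract:
  assumes "retract T Y X" "approx k X"
  shows "approx k Y"
proof -
  obtain r p where rp: "r \<in> hom_set T Y X" "p \<in> hom_set T X Y" "p \<cdot> r = Idn T Y" and Y: "Y \<in> Obj T"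
    using assms(1) unfolding retract_def by blast
  have s: "sus_arr T n r \<in> hom_set T (sus_ob T n Y) (sus_ob T n X)"
    "sus_arr T n p \<in> hom_set T (sus_ob T n X) (sus_ob T n Y)"
    "sus_arr T n p \<cdot> sus_arr T n r = Idn T (sus_ob T n Y)" for n
    using sus_hom[OF rp(1)] sus_hom[OF rp(2)] sus_Comp[OF rp(1,2)] rp(3) sus_Idn[OF Y] by auto
  show ?thesis using assms(2) unfolding approx_def
    using lifts_retract[OF s x_closed] kills_retract[OF s x_closed tr_hom] by blast
qed

lemma approx_sum:
  assumes "direct_sum T X Y S" "approx k X" "approx k Y"
  shows "approx k S"
proof -
  obtain i j p q where d: "i \<in> hom_set T X S" "j \<in> hom_set T Y S" "p \<in> hom_set T S X" "q \<in> hom_set T S Y"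
    "Add_arr T (i \<cdot> p) (j \<cdot> q) = Idn T S" and S: "S \<in> Obj T"
    using assms(1) unfolding direct_sum_def by blast
  have s: "Add_arr T (sus_arr T n i \<cdot> sus_arr T n p) (sus_arr T n j \<cdot> sus_arr T n q) = Idn T (sus_ob T n S)" for n
    using sus_add[OF Comp_hom[OF d(3,1)] Comp_hom[OF d(4,2)], of n] sus_Comp[OF d(3,1)] sus_Comp[OF d(4,2)]
      sus_Idn[OF S] d(5) by simp
  note d' = d(1-4)[THEN sus_hom]
  show ?thesis using assms(2,3) unfolding approx_def
    using lifts_sum[OF d' s x_closed] kills_sum[OF d' s x_closed tr_hom] by blast
qed

text \<open>Surjectivity at \<open>S\<close> is chased from surjectivity at \<open>Y\<close> and
  \<open>Z\<close> and killing at \<open>Z\<close>; killing at \<open>S\<close> from killing at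
  \<open>Y\<close> and \<open>Z\<close> and surjectivity at \<open>Y\<close>. As \<open>Z\<close>
  has index 0, a single arrow \<open>f\<close> makes each correction, hence the cost of one.\<close>

lemma approx_extension:
  assumes tri: "(u, v, w) \<in> Triangles T"
    and u: "u \<in> hom_set T Y S" and v: "v \<in> hom_set T S Z" and w: "w \<in> hom_set T Z (Sus_ob T Y)"
    and Y: "approx k Y" and Z: "approx 0 Z"
  shows "approx (Suc k) S"
proof -
  have O: "Y \<in> Obj T" "S \<in> Obj T" "Z \<in> Obj T" using u v hom_set_Obj by auto
  have un: "sus_arr T n u \<in> hom_set T (sus_ob T n Y) (sus_ob T n S)"
    and vn: "sus_arr T n v \<in> hom_set T (sus_ob T n S) (sus_ob T n Z)"
    and wn: "sus_arr T n w \<in> hom_set T (sus_ob T n Z) (sus_ob T (n + 1) Y)" for n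
    using sus_hom[OF u] sus_hom[OF v] sus_hom[OF w, of n] sus_ob_add[OF O(1), of n 1] by (auto simp: sus_ob_1)
  have lY: "lifts (A i) (x i) (sus_ob T n Y)" if "k \<le> i" for i n
    using Y that by (simp add: approx_def)
  have lZ: "lifts (A i) (x i) (sus_ob T n Z)" for i n using Z by (simp add: approx_def)
  have kY: "kills (A i) (x i) (tr i (Suc k)) (A (i + Suc k)) (sus_ob T n Y)" for i n
    using Y unfolding approx_def by blast
  have kZ: "kills (A i) (x i) (f i) (A (Suc i)) (sus_ob T n Z)" for i n
    using Z by (simp add: approx_def tr_1 del: tr.simps)
  have lifts_S: "lifts (A (Suc i)) (x (Suc i)) (sus_ob T (n + 1) S)" if i: "k \<le> i" for i n
    unfolding lifts_def
  proof
    let ?u = "sus_arr T (n + 1) u" and ?v = "sus_arr T (n + 1) v" and ?w = "sus_arr T n w"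
    let ?Y = "sus_ob T (n + 1) Y" and ?S = "sus_ob T (n + 1) S" and ?Z = "sus_ob T (n + 1) Z"
    fix y assume y: "y \<in> carrier (H ?S)"
    have SO: "?S \<in> Obj T" "sus_ob T n Z \<in> Obj T" using O sus_ob_closed by auto
    interpret P: abelian_group "H ?S" by (rule H_group[OF SO(1)])
    obtain h where h: "h \<in> hom_set T ?Y (A i)" "Hm h (x i) = Hm ?u y"
      using lY[OF i] Hm_closed[OF un y] unfolding lifts_def by blast
    have uw: "?u \<cdot> ?w = Zero_arr T (sus_ob T n Z) ?S"
      using sus_Comp[OF w Sus_hom[OF u], of n] triangle_comp_zero_rotated(2)[OF tri u v w]
        sus_zero[OF O(3) Sus_ob_closed[OF O(2)], of n] sus_arr_add[OF u, of n 1] sus_ob_add[OF O(2), of n 1]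
      by (simp add: sus_arr_1 sus_ob_1)
    have "Hm (h \<cdot> ?w) (x i) = Hm ?w (Hm ?u y)" using Hm_Comp[OF wn h(1) x_closed] h(2) by simp
    also have "\<dots> = \<zero>\<^bsub>H (sus_ob T n Z)\<^esub>"
      using Hm_Comp[OF wn un y] uw Hm_zero_arr[OF SO(2,1) y] by simp
    \<comment> \<open>Only the image of \<open>h \<cdot> ?w\<close> in \<open>H\<close> vanishes;
      \<open>f i\<close> makes the composite itself vanish. This is why the lift exists at stage
      \<open>Suc i\<close>.\<close>
    finally have "f i \<cdot> (h \<cdot> ?w) = Zero_arr T (sus_ob T n Z) (A (Suc i))"
      using kZ Comp_hom[OF wn h(1)] unfolding kills_def by blast
    then have "(f i \<cdot> h) \<cdot> ?w = Zero_arr T (sus_ob T n Z) (A (Suc i))"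
      using Comp_assoc[OF wn h(1) f_hom] by simp
    then obtain g where g: "g \<in> hom_set T ?S (A (Suc i))" "g \<cdot> ?u = f i \<cdot> h"
      using hom_exact_rotated_sus[OF tri u v w Comp_hom[OF h(1) f_hom]] by blast
    \<comment> \<open>\<open>?gx\<close> and \<open>y\<close> agree on \<open>Y\<close>, so
      exactness of \<open>H\<close> brings their difference from \<open>Z\<close>, where it
      lifts.\<close>
    let ?gx = "Hm g (x (Suc i))"
    have gx: "?gx \<in> carrier (H ?S)" by (rule Hm_closed[OF g(1) x_closed])
    have YO: "?Y \<in> Obj T" using O sus_ob_closed by blast
    interpret Q: abelian_group "H ?Y" by (rule H_group[OF YO])
    have "Hm ?u ?gx = Hm ?u y"
      using Hm_Comp[OF un g(1) x_closed] g(2) Hm_Comp[OF h(1) f_hom x_closed] Hm_f h(2) by simp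
    moreover have "Hm ?u y = Hm ?u (y \<ominus>\<^bsub>H ?S\<^esub> ?gx \<oplus>\<^bsub>H ?S\<^esub> ?gx)"
      using y gx by (simp add: P.minus_eq P.a_assoc P.l_neg)
    moreover have "\<dots> = Hm ?u (y \<ominus>\<^bsub>H ?S\<^esub> ?gx) \<oplus>\<^bsub>H ?Y\<^esub> Hm ?u ?gx"
      by (rule Hm_add[OF un]) (use y gx in auto)
    ultimately have "Hm ?u (y \<ominus>\<^bsub>H ?S\<^esub> ?gx) = \<zero>\<^bsub>H ?Y\<^esub>"
      using Hm_closed[OF un, of "y \<ominus>\<^bsub>H ?S\<^esub> ?gx"] Hm_closed[OF un gx] y gx
        Q.add.r_cancel_one[of "Hm ?u ?gx" "Hm ?u (y \<ominus>\<^bsub>H ?S\<^esub> ?gx)"] by simp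
    then obtain z where z: "z \<in> carrier (H ?Z)" "Hm ?v z = y \<ominus>\<^bsub>H ?S\<^esub> ?gx"
      using H_exact[OF tri u v w, of _ "n + 1"] y gx P.minus_closed by blast
    obtain t where t: "t \<in> hom_set T ?Z (A (Suc i))" "Hm t (x (Suc i)) = z"
      using lZ z(1) unfolding lifts_def by blast
    have "Hm (Add_arr T (t \<cdot> ?v) g) (x (Suc i)) = (y \<ominus>\<^bsub>H ?S\<^esub> ?gx) \<oplus>\<^bsub>H ?S\<^esub> ?gx"
      using Hm_Add_arr[OF Comp_hom[OF vn t(1)] g(1) x_closed] Hm_Comp[OF vn t(1) x_closed] t(2) z(2) by simp
    also have "\<dots> = y" using y gx by (simp add: P.minus_eq P.a_assoc P.l_neg)
    finally show "\<exists>h\<in>hom_set T ?S (A (Suc i)). Hm h (x (Suc i)) = y"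
      using Add_arr_hom[OF Comp_hom[OF vn t(1)] g(1)] by blast
  qed
  \<comment> \<open>\<open>lifts_S\<close> speaks of stage \<open>Suc i\<close> and suspension
    \<open>n + 1\<close>; the integer \<open>n\<close> and the positive stage can both be shifted
    back by one.\<close>
  have lifts_S': "lifts (A i) (x i) (sus_ob T n S)" if "Suc k \<le> i" for i n
    using lifts_S[of "i - 1" "n - 1"] that by (cases i) auto
  have kills_S: "kills (A i) (x i) (tr i (Suc (Suc k))) (A (i + Suc (Suc k))) (sus_ob T n S)" for i n
    unfolding kills_def
  proof (intro ballI impI)
    let ?u = "sus_arr T n u" and ?v = "sus_arr T n v" and ?w = "sus_arr T n w"
    let ?Y = "sus_ob T n Y" and ?S = "sus_ob T n S" and ?Z = "sus_ob T n Z"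
    \<comment> \<open>The stage at which the restriction of \<open>h\<close> to \<open>Y\<close> has
      died. As \<open>k \<le> ?j\<close>, elements at suspensions of \<open>Y\<close> lift
      there.\<close>
    let ?j = "i + Suc k"
    have SO: "?S \<in> Obj T" "?Y \<in> Obj T" "?Z \<in> Obj T" using O sus_ob_closed by auto
    fix h assume h: "h \<in> hom_set T ?S (A i)" "Hm h (x i) = \<zero>\<^bsub>H ?S\<^esub>"
    have th: "tr i (Suc k) \<cdot> h \<in> hom_set T ?S (A ?j)" by (rule Comp_hom[OF h(1) tr_hom])
    have "Hm (h \<cdot> ?u) (x i) = \<zero>\<^bsub>H ?Y\<^esub>" using Hm_Comp[OF un h(1) x_closed] h(2) Hm_zero[OF un] by simp
    then have "tr i (Suc k) \<cdot> (h \<cdot> ?u) = Zero_arr T ?Y (A ?j)"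
      using kY Comp_hom[OF un h(1)] unfolding kills_def by blast
    then have "(tr i (Suc k) \<cdot> h) \<cdot> ?u = Zero_arr T ?Y (A ?j)"
      using Comp_assoc[OF un h(1) tr_hom] by metis
    then obtain g where g: "g \<in> hom_set T ?Z (A ?j)" "g \<cdot> ?v = tr i (Suc k) \<cdot> h"
      by (rule hom_exact_sus[OF tri u v w th])
    have "Hm ?v (Hm g (x ?j)) = Hm h (Hm (tr i (Suc k)) (x ?j))"
      using Hm_Comp[OF vn g(1) x_closed] g(2) Hm_Comp[OF h(1) tr_hom x_closed] by metis
    also have "\<dots> = \<zero>\<^bsub>H ?S\<^esub>" using h(2) Hm_tr by metis
    finally obtain z where z: "z \<in> carrier (H (sus_ob T (n + 1) Y))" "Hm ?w z = Hm g (x ?j)"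
      using H_exact_rotated[OF tri u v w Hm_closed[OF g(1) x_closed]] by blast
    obtain t where t: "t \<in> hom_set T (sus_ob T (n + 1) Y) (A ?j)" "Hm t (x ?j) = z"
      using lY[of ?j] z(1) unfolding lifts_def by (metis le_add2 le_SucI add_Suc_right)
    \<comment> \<open>\<open>g\<close> and \<open>t \<cdot> ?w\<close> have the same image in
      \<open>H\<close>, so \<open>f ?j\<close> identifies them, and \<open>t \<cdot> ?w\<close>
      vanishes when composed with \<open>?v\<close>.\<close>
    have tw: "t \<cdot> ?w \<in> hom_set T ?Z (A ?j)" by (rule Comp_hom[OF wn t(1)])
    interpret P: abelian_group "H ?Z" by (rule H_group[OF SO(3)])
    have "Hm (Add_arr T g (neg ?Z (A ?j) (t \<cdot> ?w))) (x ?j) = \<zero>\<^bsub>H ?Z\<^esub>"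
      using Hm_Add_arr[OF g(1) neg_hom[OF tw] x_closed] Hm_neg[OF tw x_closed] Hm_Comp[OF wn t(1) x_closed]
        t(2) z(2) P.r_neg[OF Hm_closed[OF g(1) x_closed]] by simp
    then have "f ?j \<cdot> Add_arr T g (neg ?Z (A ?j) (t \<cdot> ?w)) = Zero_arr T ?Z (A (Suc ?j))"
      using kZ Add_arr_hom[OF g(1) neg_hom[OF tw]] unfolding kills_def by blast
    then have "Add_arr T (f ?j \<cdot> g) (neg ?Z (A (Suc ?j)) (f ?j \<cdot> (t \<cdot> ?w))) = Zero_arr T ?Z (A (Suc ?j))"
      using Comp_add_right[OF g(1) neg_hom[OF tw] f_hom] Comp_neg_right[OF tw f_hom] by simp
    then have fg: "f ?j \<cdot> g = f ?j \<cdot> (t \<cdot> ?w)"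
      by (rule Add_arr_neg_eq_zero[OF Comp_hom[OF g(1) f_hom] Comp_hom[OF tw f_hom]])
    have wv: "?w \<cdot> ?v = Zero_arr T ?S (sus_ob T (n + 1) Y)"
      using sus_Comp[OF v w, of n] triangle_comp_zero_rotated(1)[OF tri u v w]
        sus_zero[OF O(2) Sus_ob_closed[OF O(1)], of n] sus_ob_add[OF O(1), of n 1]
      by (simp add: sus_ob_1)
    have "tr i (Suc (Suc k)) \<cdot> h = f ?j \<cdot> (tr i (Suc k) \<cdot> h)"
      using Comp_assoc[OF h(1) tr_hom f_hom, of "Suc k"] by simp
    also have "\<dots> = (f ?j \<cdot> g) \<cdot> ?v" using g(2) Comp_assoc[OF vn g(1) f_hom] by simp
    also have "\<dots> = f ?j \<cdot> (t \<cdot> (?w \<cdot> ?v))"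
      using fg Comp_assoc[OF vn tw f_hom] Comp_assoc[OF vn wn t(1)] by simp
    also have "\<dots> = Zero_arr T ?S (A (Suc ?j))"
      using wv Comp_zero_right[OF t(1) SO(1)] Comp_zero_right[OF f_hom SO(1)] by simp
    finally show "tr i (Suc (Suc k)) \<cdot> h = Zero_arr T ?S (A (i + Suc (Suc k)))" by simp
  qed
  show ?thesis unfolding approx_def using lifts_S' kills_S by blast
qed

text \<open>The closure operations of the first layer cost nothing, so the index stays 0. Membership
  in \<open>Obj T\<close> is carried along since combining suspensions asks for it.\<close>

lemma thick1_approx: "X \<in> thick1 T G \<Longrightarrow> X \<in> Obj T \<and> approx 0 X"
proof (induction rule: thick1.induct)
  case thick1_base then show ?case using G_Obj approx_G by simp
next
  case (thick1_zero N) then show ?case using approx_zero by (simp add: zero_object_def)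
next
  case (thick1_sum X Y S) then show ?case using approx_sum[of X Y S 0] direct_sum_def[of T X Y S] by blast
next
  case (thick1_retract X Y) then show ?case using approx_retract[of Y X 0] retract_def[of T Y X] by blast
next
  case (thick1_sus X n) then show ?case using approx_sus sus_ob_closed by blast
qed

lemma thick_approx: "X \<in> thick T G (Suc k) \<Longrightarrow> approx k X"
proof (induction k arbitrary: X)
  case 0
  then show ?case using thick1_approx by simp
next
  case (Suc k)
  then obtain X' S Y Z u v w where *: "direct_sum T X X' S" "Y \<in> thick T G (Suc k)" "Z \<in> thick1 T G"
    "(u, v, w) \<in> Triangles T" "u \<in> hom_set T Y S" "v \<in> hom_set T S Z" "w \<in> hom_set T Z (Sus_ob T Y)"
    by auto
  have "approx (Suc k) S"
    using approx_extension[OF *(4-7)] Suc.IH[OF *(2)] thick1_approx[OF *(3)] by blast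
  moreover have "retract T X S" using *(1) unfolding retract_def direct_sum_def by blast
  ultimately show ?case using approx_retract by blast
qed

text \<open>The idempotent endomorphism \<open>tr i (Suc k) \<cdot> e\<close> of \<open>A (i + Suc k)\<close> fixes the universal element,
  and its image represents \<open>H\<close>.\<close>

lemma representing_object:
  assumes ic: "idempotent_complete T" and ap: "\<And>Y. Y \<in> Obj T \<Longrightarrow> approx k Y"
  obtains X c where "X \<in> Obj T" "c \<in> carrier (H X)"
    "\<And>Y. Y \<in> Obj T \<Longrightarrow> bij_betw (\<lambda>h. Hm h c) (hom_set T Y X) (carrier (H Y))"
proof -
  have lift: "lifts (A i) (x i) Y" if "k \<le> i" "Y \<in> Obj T" for i Y
    using ap[OF that(2)] that unfolding approx_def by (metis sus_ob_0)
  have kill: "kills (A i) (x i) (tr i (Suc k)) (A (i + Suc k)) Y" if "Y \<in> Obj T" for i Y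
    using ap[OF that] unfolding approx_def by (metis sus_ob_0)
  \<comment> \<open>From stage \<open>k\<close> on every object lifts; \<open>Suc k\<close> further
    steps kill the kernel at every object.\<close>
  let ?j = "k + Suc k"
  let ?B = "A ?j" and ?b = "x ?j" and ?t = "tr k (Suc k)"
  have B: "?B \<in> Obj T" by (rule A_Obj)
  have t: "?t \<in> hom_set T (A k) ?B" by (rule tr_hom)
  have Ht: "Hm ?t ?b = x k" by (rule Hm_tr)
  obtain e where e: "e \<in> hom_set T ?B (A k)" "Hm e (x k) = ?b"
    using lift[OF order_refl B] x_closed unfolding lifts_def by blast
  have te: "?t \<cdot> e \<in> hom_set T ?B ?B" by (rule Comp_hom[OF e(1) t])
  have Hte: "Hm (?t \<cdot> e) ?b = ?b" using Hm_Comp[OF e(1) t x_closed] Ht e(2) by simp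
  have kt: "?t \<cdot> (e \<cdot> h) = Zero_arr T Y ?B" if "h \<in> hom_set T Y ?B" "Hm h ?b = \<zero>\<^bsub>H Y\<^esub>" for h Y
  proof -
    have "Hm (e \<cdot> h) (x k) = \<zero>\<^bsub>H Y\<^esub>" using Hm_Comp[OF that(1) e(1) x_closed] e(2) that(2) by simp
    then show ?thesis
      using kill[of Y k] Comp_hom[OF that(1) e(1)] hom_set_Obj[OF that(1)] unfolding kills_def by blast
  qed
  have "(?t \<cdot> e) \<cdot> (?t \<cdot> e) = ?t \<cdot> e"
  proof -
    have n: "neg ?B ?B (Idn T ?B) \<in> hom_set T ?B ?B" by (rule neg_hom[OF Idn_hom[OF B]])
    interpret P: abelian_group "H ?B" by (rule H_group[OF B])
    \<comment> \<open>The difference of \<open>?t \<cdot> e\<close> and the identity annihilates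
      \<open>?b\<close>, because \<open>?t \<cdot> e\<close> fixes \<open>?b\<close>. So
      \<open>kt\<close> applies to it and yields idempotence.\<close>
    let ?d = "Add_arr T (?t \<cdot> e) (neg ?B ?B (Idn T ?B))"
    have d: "?d \<in> hom_set T ?B ?B" by (rule Add_arr_hom[OF te n])
    have "Hm ?d ?b = \<zero>\<^bsub>H ?B\<^esub>"
      using Hm_Add_arr[OF te n x_closed] Hm_neg[OF Idn_hom[OF B] x_closed] Hm_Idn[OF B x_closed] Hte
        P.r_neg[OF x_closed] by simp
    then have "?t \<cdot> (e \<cdot> ?d) = Zero_arr T ?B ?B" by (rule kt[OF d])
    then have "(?t \<cdot> e) \<cdot> ?d = Zero_arr T ?B ?B" using Comp_assoc[OF d e(1) t] by simp
    then have "Add_arr T ((?t \<cdot> e) \<cdot> (?t \<cdot> e)) (neg ?B ?B (?t \<cdot> e)) = Zero_arr T ?B ?B"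
      using Comp_add_right[OF te n te] Comp_neg_right[OF Idn_hom[OF B] te] Comp_Idn[OF te] by simp
    then show ?thesis by (rule Add_arr_neg_eq_zero[OF Comp_hom[OF te te] te])
  qed
  then obtain X p s where X: "X \<in> Obj T" and p: "p \<in> hom_set T ?B X" and s: "s \<in> hom_set T X ?B"
    and sp: "s \<cdot> p = ?t \<cdot> e" and ps: "p \<cdot> s = Idn T X"
    using ic[unfolded idempotent_complete_def] B te by blast
  let ?x = "Hm s ?b"
  have x: "?x \<in> carrier (H X)" by (rule Hm_closed[OF s x_closed])
  have px: "Hm p ?x = ?b" using Hm_Comp[OF p s x_closed] sp Hte by simp
  \<comment> \<open>\<open>s \<cdot> h\<close> annihilates \<open>?b\<close>, so the idempotent
    kills it; but the idempotent \<open>s \<cdot> p\<close> also fixes it, and \<open>p\<close>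
    splits \<open>s\<close>.\<close>
  have inj0: "h = Zero_arr T Y X" if h: "h \<in> hom_set T Y X" "Hm h ?x = \<zero>\<^bsub>H Y\<^esub>" for h Y
  proof -
    have sh: "s \<cdot> h \<in> hom_set T Y ?B" by (rule Comp_hom[OF h(1) s])
    have "Hm (s \<cdot> h) ?b = \<zero>\<^bsub>H Y\<^esub>" using Hm_Comp[OF h(1) s x_closed] h(2) by simp
    then have "(?t \<cdot> e) \<cdot> (s \<cdot> h) = Zero_arr T Y ?B" using kt[OF sh] Comp_assoc[OF sh e(1) t] by simp
    then have "(s \<cdot> p) \<cdot> (s \<cdot> h) = Zero_arr T Y ?B" using sp by simp
    moreover have "(s \<cdot> p) \<cdot> (s \<cdot> h) = s \<cdot> h"
      using Comp_assoc[OF sh p s] Comp_assoc[OF h(1) s p] ps Idn_Comp[OF h(1)] by simp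
    ultimately have "p \<cdot> (s \<cdot> h) = Zero_arr T Y X"
      using Comp_zero_right[OF p] hom_set_Obj[OF h(1)] by simp
    then show ?thesis using Comp_assoc[OF h(1) s p] ps Idn_Comp[OF h(1)] by simp
  qed
  have "bij_betw (\<lambda>h. Hm h ?x) (hom_set T Y X) (carrier (H Y))" if Y: "Y \<in> Obj T" for Y
  proof (rule bij_betw_imageI)
    interpret P: abelian_group "H Y" by (rule H_group[OF Y])
    show "inj_on (\<lambda>h. Hm h ?x) (hom_set T Y X)"
    proof (rule inj_onI)
      fix g h assume g: "g \<in> hom_set T Y X" and h: "h \<in> hom_set T Y X" and eq: "Hm g ?x = Hm h ?x"
      have "Hm (Add_arr T g (neg Y X h)) ?x = \<zero>\<^bsub>H Y\<^esub>"
        using Hm_Add_arr[OF g neg_hom[OF h] x] Hm_neg[OF h x] eq P.r_neg[OF Hm_closed[OF h x]] by simp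
      then have "Add_arr T g (neg Y X h) = Zero_arr T Y X"
        by (rule inj0[OF Add_arr_hom[OF g neg_hom[OF h]]])
      then show "g = h" by (rule Add_arr_neg_eq_zero[OF g h])
    qed
    show "(\<lambda>h. Hm h ?x) ` hom_set T Y X = carrier (H Y)"
    proof (intro equalityI subsetI)
      fix y assume "y \<in> carrier (H Y)"
      then obtain h where h: "h \<in> hom_set T Y ?B" "Hm h ?b = y"
        using lift[of ?j Y] Y unfolding lifts_def by auto
      have "Hm (p \<cdot> h) ?x = y" using Hm_Comp[OF h(1) p x] px h(2) by simp
      then show "y \<in> (\<lambda>h. Hm h ?x) ` hom_set T Y X" using Comp_hom[OF h(1) p] by blast
    qed (use Hm_closed x in auto)
  qed
  then show ?thesis using that X x by blast
qed

end

section \<open>Construction of an approximating sequence by iterated cones\<close>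

context cohomological_group_functor
begin

text \<open>The cone of \<open>b\<close> does both tasks: kernel elements factor through
  \<open>b\<close>, so they die in it, and surjectivity is inherited because the extended element
  restricts to \<open>x\<close>.\<close>

lemma approximating_sequence_exists:
  assumes G: "G \<in> Obj T"
    and base: "\<exists>A\<in>Obj T. \<exists>x\<in>carrier (H A). \<forall>n. lifts A x (sus_ob T n G)"
    and step: "\<And>A x. \<lbrakk>A \<in> Obj T; x \<in> carrier (H A)\<rbrakk> \<Longrightarrow>
      \<exists>B\<in>Obj T. \<exists>b\<in>hom_set T B A. Hm b x = \<zero>\<^bsub>H B\<^esub> \<and>
        (\<forall>n. \<forall>h\<in>hom_set T (sus_ob T n G) A. Hm h x = \<zero>\<^bsub>H (sus_ob T n G)\<^esub> \<longrightarrow>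
           (\<exists>g\<in>hom_set T (sus_ob T n G) B. b \<cdot> g = h))"
  shows "\<exists>A x f. approximating_sequence T H Hm G A x f"
proof -
  let ?P = "\<lambda>a. fst a \<in> Obj T \<and> snd a \<in> carrier (H (fst a)) \<and> (\<forall>n. lifts (fst a) (snd a) (sus_ob T n G))"
  let ?Q = "\<lambda>a b f. f \<in> hom_set T (fst a) (fst b) \<and> Hm f (snd b) = snd a \<and>
    (\<forall>n. kills (fst a) (snd a) f (fst b) (sus_ob T n G))"
  have next_ex: "\<exists>b. ?P b \<and> (\<exists>f. ?Q a b f)" if a: "?P a" for a
  proof -
    obtain A x where ax: "a = (A, x)" by fastforce
    have A: "A \<in> Obj T" and x: "x \<in> carrier (H A)" and l: "\<And>n. lifts A x (sus_ob T n G)" using a ax by auto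
    obtain B b where b: "b \<in> hom_set T B A" "Hm b x = \<zero>\<^bsub>H B\<^esub>"
      and fac: "\<And>n h. \<lbrakk>h \<in> hom_set T (sus_ob T n G) A; Hm h x = \<zero>\<^bsub>H (sus_ob T n G)\<^esub>\<rbrakk> \<Longrightarrow>
           \<exists>g\<in>hom_set T (sus_ob T n G) B. b \<cdot> g = h"
      using step[OF A x] by blast
    obtain v w where tri: "(b, v, w) \<in> Triangles T" using triangle_cone hom_Arr[OF b(1)] by blast
    then obtain C where v: "v \<in> hom_set T A C" and w: "w \<in> hom_set T C (Sus_ob T B)"
      using triangle_homs[OF tri] b(1) by (auto simp: hom_set_def)
    obtain z where z: "z \<in> carrier (H C)" "Hm v z = x"
      using H_exact[OF tri b(1) v w, of x 0] x b(2) by auto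
    have CO: "C \<in> Obj T" using v hom_set_Obj by blast
    have vb: "v \<cdot> b = Zero_arr T B C" by (rule triangle_comp_zero[OF tri b(1) v w])
    have "kills A x v C (sus_ob T n G)" for n
      unfolding kills_def
    proof (intro ballI impI)
      fix h assume "h \<in> hom_set T (sus_ob T n G) A" "Hm h x = \<zero>\<^bsub>H (sus_ob T n G)\<^esub>"
      then obtain g where g: "g \<in> hom_set T (sus_ob T n G) B" "b \<cdot> g = h" using fac by blast
      then show "v \<cdot> h = Zero_arr T (sus_ob T n G) C"
        using Comp_assoc[OF g(1) b(1) v] vb Comp_zero_left[OF g(1) CO] by simp
    qed
    moreover have "lifts C z (sus_ob T n G)" for n
      unfolding lifts_def
    proof
      fix y assume "y \<in> carrier (H (sus_ob T n G))"
      then obtain h where h: "h \<in> hom_set T (sus_ob T n G) A" "Hm h x = y" using l unfolding lifts_def by blast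
      then have "Hm (v \<cdot> h) z = y" using Hm_Comp[OF h(1) v z(1)] z(2) by simp
      then show "\<exists>h\<in>hom_set T (sus_ob T n G) C. Hm h z = y" using Comp_hom[OF h(1) v] by blast
    qed
    ultimately show ?thesis using v z CO ax by (intro exI[of _ "(C, z)"]) auto
  qed
  \<comment> \<open>The states of the choice are pairs of an object and an element; the arrows are
    picked once the pairs are fixed.\<close>
  have "\<exists>a. \<forall>i. ?P (a i) \<and> (\<exists>f. ?Q (a i) (a (Suc i)) f)"
    by (rule dependent_nat_choice[of "\<lambda>_. ?P" "\<lambda>_ a b. \<exists>f. ?Q a b f"]) (use base next_ex in auto)
  then obtain a where a: "\<And>i. ?P (a i)" "\<And>i. \<exists>f. ?Q (a i) (a (Suc i)) f" by blast
  then obtain f where f: "\<And>i. ?Q (a i) (a (Suc i)) (f i)" by metis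
  have "approximating_sequence T H Hm G (\<lambda>i. fst (a i)) (\<lambda>i. snd (a i)) f"
    by unfold_locales (use G a(1) f in auto)
  then show ?thesis by blast
qed

end

section \<open>Graded linear functors\<close>

context graded_linear_category
begin

lemma phi_hom:
  assumes "r \<in> grading R d" "X \<in> Obj T"
  shows "\<phi> d r X \<in> hom_set T X (sus_ob T d X)"
  using phi_center[OF assms(1)] assms(2) by (auto simp: graded_center_def)

lemma phi_natural:
  assumes "r \<in> grading R d" "f \<in> hom_set T X Y"
  shows "\<phi> d r Y \<cdot>\<^bsub>T\<^esub> f = sus_arr T d f \<cdot>\<^bsub>T\<^esub> \<phi> d r X"
  using phi_center[OF assms(1)] assms(2) hom_set_Obj[OF assms(2)] by (simp add: graded_center_def)

lemma phi_hom_sus: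
  assumes "r \<in> grading R d" "X \<in> Obj T"
  shows "\<phi> d r (sus_ob T e X) \<in> hom_set T (sus_ob T e X) (sus_ob T (d + e) X)"
  using phi_hom[OF assms(1) sus_ob_closed[OF assms(2)]] sus_ob_add[OF assms(2)] by simp

lemma Ext_simps [simp]:
  "gpart (Ext T \<phi> X Y) d = hom_group T X (sus_ob T d Y)"
  "gact (Ext T \<phi> X Y) d e r h = \<phi> d r (sus_ob T e Y) \<cdot>\<^bsub>T\<^esub> h"
  by (simp_all add: Ext_def)

lemma Ext_module:
  assumes X: "X \<in> Obj T" and Y: "Y \<in> Obj T"
  shows "graded_module R (Ext T \<phi> X Y)"
proof (intro graded_module.intro R.graded_ring_axioms graded_module_axioms.intro)
  note s = sus_ob_closed[OF Y]
  show "abelian_group (gpart (Ext T \<phi> X Y) d)" for d using hom_abelian_group[OF X s] by simp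
  show "gact (Ext T \<phi> X Y) d e r x \<in> gcar (Ext T \<phi> X Y) (d + e)"
    if "r \<in> grading R d" "x \<in> gcar (Ext T \<phi> X Y) e" for r d x e
    using that Comp_hom[OF _ phi_hom_sus[OF that(1) Y]] by simp
  show "gact (Ext T \<phi> X Y) d e (r \<oplus>\<^bsub>R\<^esub> t) x =
      gact (Ext T \<phi> X Y) d e r x \<oplus>\<^bsub>gpart (Ext T \<phi> X Y) (d + e)\<^esub> gact (Ext T \<phi> X Y) d e t x"
    if "r \<in> grading R d" "t \<in> grading R d" "x \<in> gcar (Ext T \<phi> X Y) e" for r d t x e
    using that phi_add[OF that(1,2)] s[of e]
      Comp_add_left[OF _ phi_hom_sus[OF that(1) Y] phi_hom_sus[OF that(2) Y]]
    by (simp add: center_add_def)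
  show "gact (Ext T \<phi> X Y) d e r (x \<oplus>\<^bsub>gpart (Ext T \<phi> X Y) e\<^esub> y) =
      gact (Ext T \<phi> X Y) d e r x \<oplus>\<^bsub>gpart (Ext T \<phi> X Y) (d + e)\<^esub> gact (Ext T \<phi> X Y) d e r y"
    if "r \<in> grading R d" "x \<in> gcar (Ext T \<phi> X Y) e" "y \<in> gcar (Ext T \<phi> X Y) e" for r d x e y
    using that Comp_add_right[OF _ _ phi_hom_sus[OF that(1) Y]] by simp
  show "gact (Ext T \<phi> X Y) (d + e) n (r \<otimes>\<^bsub>R\<^esub> t) x =
      gact (Ext T \<phi> X Y) d (e + n) r (gact (Ext T \<phi> X Y) e n t x)"
    if "r \<in> grading R d" "t \<in> grading R e" "x \<in> gcar (Ext T \<phi> X Y) n" for r d t e x n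
    using that phi_mult[OF that(1,2)] s[of n] sus_ob_add[OF Y, of e n]
      Comp_assoc[OF _ phi_hom_sus[OF that(2) Y] phi_hom_sus[OF that(1) Y]]
    by (simp add: center_mult_def)
  show "gact (Ext T \<phi> X Y) 0 e \<one>\<^bsub>R\<^esub> x = x" if "x \<in> gcar (Ext T \<phi> X Y) e" for x e
    using that phi_one s[of e] Idn_Comp by (simp add: center_one_def)
qed

text \<open>Stability under \<open>R\<close> is naturality of the center: \<open>\<phi> d r\<close>
  moves past the suspended \<open>b\<close>. Generators of a kernel are tested against this
  submodule.\<close>

lemma factoring_submodule:
  assumes X: "X \<in> Obj T" and b: "b \<in> hom_set T B Y"
  shows "gsubmodule R (Ext T \<phi> X Y) (\<lambda>d. (\<lambda>g. sus_arr T d b \<cdot>\<^bsub>T\<^esub> g) ` hom_set T X (sus_ob T d B))"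
  unfolding gsubmodule_def
proof (intro conjI allI ballI)
  have O: "B \<in> Obj T" "Y \<in> Obj T" using hom_set_Obj b by auto
  let ?N = "\<lambda>d. (\<lambda>g. sus_arr T d b \<cdot>\<^bsub>T\<^esub> g) ` hom_set T X (sus_ob T d B)"
  note s = sus_hom[OF b]
  show "?N d \<subseteq> gcar (Ext T \<phi> X Y) d" for d using Comp_hom[OF _ s] by auto
  show "\<zero>\<^bsub>gpart (Ext T \<phi> X Y) d\<^esub> \<in> ?N d" for d
    using Comp_zero_right[OF s X] Zero_arr_hom[OF X sus_ob_closed[OF O(1)]] by (force intro: image_eqI[rotated])
  show "h \<oplus>\<^bsub>gpart (Ext T \<phi> X Y) d\<^esub> k \<in> ?N d" if hk: "h \<in> ?N d" "k \<in> ?N d" for d h k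
  proof -
    obtain g g' where g: "g \<in> hom_set T X (sus_ob T d B)" "g' \<in> hom_set T X (sus_ob T d B)"
      "h = sus_arr T d b \<cdot>\<^bsub>T\<^esub> g" "k = sus_arr T d b \<cdot>\<^bsub>T\<^esub> g'" using hk by auto
    then show ?thesis using Comp_add_right[OF g(1,2) s] Add_arr_hom[OF g(1,2)] by (auto intro: image_eqI[rotated])
  qed
  show "gact (Ext T \<phi> X Y) d e r h \<in> ?N (d + e)" if r: "r \<in> grading R d" and "h \<in> ?N e" for d e r h
  proof -
    obtain g where g: "g \<in> hom_set T X (sus_ob T e B)" "h = sus_arr T e b \<cdot>\<^bsub>T\<^esub> g" using \<open>h \<in> ?N e\<close> by auto
    note pY = phi_hom_sus[OF r O(2), of e] and pB = phi_hom_sus[OF r O(1), of e]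
    have "\<phi> d r (sus_ob T e Y) \<cdot>\<^bsub>T\<^esub> h = (\<phi> d r (sus_ob T e Y) \<cdot>\<^bsub>T\<^esub> sus_arr T e b) \<cdot>\<^bsub>T\<^esub> g"
      using Comp_assoc[OF g(1) s pY] g(2) by simp
    also have "\<dots> = (sus_arr T (d + e) b \<cdot>\<^bsub>T\<^esub> \<phi> d r (sus_ob T e B)) \<cdot>\<^bsub>T\<^esub> g"
      using phi_natural[OF r s] sus_arr_add[OF b] by simp
    also have "\<dots> = sus_arr T (d + e) b \<cdot>\<^bsub>T\<^esub> (\<phi> d r (sus_ob T e B) \<cdot>\<^bsub>T\<^esub> g)"
      by (rule Comp_assoc[OF g(1) pB s])
    finally show ?thesis using Comp_hom[OF g(1) pB] by auto
  qed
qed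

end

section \<open>Kernels and images of graded homomorphisms\<close>

lemma gmod_hom_kernel:
  assumes "graded_module R M" "graded_module R N" "gmod_hom R M N \<alpha>"
  shows "gsubmodule R M (\<lambda>d. {x \<in> gcar M d. \<alpha> d x = \<zero>\<^bsub>gpart N d\<^esub>})"
proof -
  interpret M: graded_module R M by fact
  interpret N: graded_module R N by fact
  note h = gmod_homD[OF assms(3)]
  show ?thesis
    unfolding gsubmodule_def
  proof (intro conjI allI ballI)
    fix d
    interpret P: abelian_group "gpart M d" by (rule M.gpart_group)
    interpret Q: abelian_group "gpart N d" by (rule N.gpart_group)
    have "\<alpha> d \<zero>\<^bsub>gpart M d\<^esub> \<oplus>\<^bsub>gpart N d\<^esub> \<alpha> d \<zero>\<^bsub>gpart M d\<^esub> = \<alpha> d \<zero>\<^bsub>gpart M d\<^esub>"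
      using h(2)[OF P.zero_closed P.zero_closed] by simp
    then show "\<zero>\<^bsub>gpart M d\<^esub> \<in> {x \<in> gcar M d. \<alpha> d x = \<zero>\<^bsub>gpart N d\<^esub>}"
      using h(1)[OF P.zero_closed] Q.add.l_cancel_one[of "\<alpha> d \<zero>\<^bsub>gpart M d\<^esub>" "\<alpha> d \<zero>\<^bsub>gpart M d\<^esub>"] by simp
    show "x \<oplus>\<^bsub>gpart M d\<^esub> y \<in> {x \<in> gcar M d. \<alpha> d x = \<zero>\<^bsub>gpart N d\<^esub>}"
      if "x \<in> {x \<in> gcar M d. \<alpha> d x = \<zero>\<^bsub>gpart N d\<^esub>}" "y \<in> {x \<in> gcar M d. \<alpha> d x = \<zero>\<^bsub>gpart N d\<^esub>}" for x y
      using that h(2)[of x d y] by simp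
  qed (use h(3) M.gact_closed N.gact_zero_right in auto)
qed

lemma gmod_hom_image:
  assumes "graded_module R M" "graded_module R N" "gmod_hom R M N \<alpha>"
  shows "gsubmodule R N (\<lambda>d. \<alpha> d ` gcar M d)"
proof -
  interpret M: graded_module R M by fact
  interpret N: graded_module R N by fact
  note h = gmod_homD[OF assms(3)]
  have "\<zero>\<^bsub>gpart M d\<^esub> \<in> {x \<in> gcar M d. \<alpha> d x = \<zero>\<^bsub>gpart N d\<^esub>}" for d
    using gsubmoduleD(2)[OF gmod_hom_kernel[OF assms]] .
  then have z: "\<zero>\<^bsub>gpart N d\<^esub> \<in> \<alpha> d ` gcar M d" for d by force
  show ?thesis
    unfolding gsubmodule_def
  proof (intro conjI allI ballI)
    fix d
    interpret P: abelian_group "gpart M d" by (rule M.gpart_group)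
    show "\<alpha> d ` gcar M d \<subseteq> gcar N d" using h(1) by auto
    show "x \<oplus>\<^bsub>gpart N d\<^esub> y \<in> \<alpha> d ` gcar M d" if xy: "x \<in> \<alpha> d ` gcar M d" "y \<in> \<alpha> d ` gcar M d" for x y
    proof -
      obtain a b where "a \<in> gcar M d" "b \<in> gcar M d" "x = \<alpha> d a" "y = \<alpha> d b" using xy by auto
      then show ?thesis using h(2)[of a d b] P.a_closed[of a b] by (metis imageI)
    qed
  next
    fix d e r x assume r: "r \<in> grading R d" and "x \<in> \<alpha> e ` gcar M e"
    then obtain a where "a \<in> gcar M e" "x = \<alpha> e a" by auto
    then show "gact N d e r x \<in> \<alpha> (d + e) ` gcar M (d + e)"
      using h(3)[OF r, of a e] M.gact_closed[OF r, of a e] by (metis imageI)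
  qed (rule z)
qed

section \<open>Shift identifications and Yoneda maps\<close>

context graded_linear_functor
begin

abbreviation FC :: "'o \<Rightarrow> int \<Rightarrow> 'x set" where
  "FC X d \<equiv> gcar (Fob F X) d"

lemma Fsh_bij: "X \<in> Obj T \<Longrightarrow> bij_betw (Fsh F n X e) (FC (sus_ob T n X) e) (FC X (- n + e))"
  using Fsh_iso[of X n] by (simp add: gmod_iso_def gshift_def)

lemma Fsh_closed: "\<lbrakk>X \<in> Obj T; x \<in> FC (sus_ob T n X) e\<rbrakk> \<Longrightarrow> Fsh F n X e x \<in> FC X (- n + e)"
  using Fsh_bij bij_betwE by blast

lemma Fsh_inj: "\<lbrakk>X \<in> Obj T; x \<in> FC (sus_ob T n X) e; y \<in> FC (sus_ob T n X) e;
    Fsh F n X e x = Fsh F n X e y\<rbrakk> \<Longrightarrow> x = y"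
  using Fsh_bij[of X n e] by (auto simp: bij_betw_def inj_on_def)

lemma Fsh_add:
  assumes "X \<in> Obj T" "x \<in> FC (sus_ob T n X) e" "y \<in> FC (sus_ob T n X) e"
  shows "Fsh F n X e (x \<oplus>\<^bsub>gpart (Fob F (sus_ob T n X)) e\<^esub> y) =
    Fsh F n X e x \<oplus>\<^bsub>gpart (Fob F X) (- n + e)\<^esub> Fsh F n X e y"
proof -
  have "gmod_hom R (Fob F (sus_ob T n X)) (gshift (Fob F X) (- n)) (Fsh F n X)"
    using Fsh_iso[OF assms(1)] by (simp add: gmod_iso_def)
  from gmod_homD(2)[OF this assms(2,3)] show ?thesis by (simp add: gshift_def)
qed

lemma F_group: "X \<in> Obj T \<Longrightarrow> abelian_group (gpart (Fob F X) e)"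
  using graded_module.gpart_group[OF Fob_module] .

lemma F_idem_zero:
  assumes "X \<in> Obj T" "a \<in> FC X e" "a \<oplus>\<^bsub>gpart (Fob F X) e\<^esub> a = a"
  shows "a = \<zero>\<^bsub>gpart (Fob F X) e\<^esub>"
proof -
  interpret P: abelian_group "gpart (Fob F X) e" by (rule F_group[OF assms(1)])
  show ?thesis using assms P.add.l_cancel_one[of a a] by simp
qed

lemma F_zero: "X \<in> Obj T \<Longrightarrow> \<zero>\<^bsub>gpart (Fob F X) e\<^esub> \<in> FC X e"
  using graded_module.gpart_zero[OF Fob_module] .

lemma Fsh_zero:
  assumes "X \<in> Obj T"
  shows "Fsh F n X e \<zero>\<^bsub>gpart (Fob F (sus_ob T n X)) e\<^esub> = \<zero>\<^bsub>gpart (Fob F X) (- n + e)\<^esub>"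
proof -
  have O: "sus_ob T n X \<in> Obj T" using assms sus_ob_closed by blast
  interpret P: abelian_group "gpart (Fob F (sus_ob T n X)) e" by (rule F_group[OF O])
  show ?thesis
    using Fsh_add[OF assms P.zero_closed P.zero_closed] Fsh_closed[OF assms P.zero_closed]
      F_idem_zero[OF assms] by simp
qed

text \<open>Coherence makes the identification for 0 idempotent, and it is injective.\<close>

lemma Fsh_0:
  assumes "X \<in> Obj T" "x \<in> FC X e"
  shows "Fsh F 0 X e x = x"
proof -
  have "Fsh F 0 X e x = Fsh F 0 X e (Fsh F 0 X e x)"
    using Fsh_coherent[of X x 0 0 e] assms by simp
  then show ?thesis using Fsh_inj[of X "Fsh F 0 X e x" 0 e x] Fsh_closed[of X x 0 e] assms by simp
qed

lemma Farr_closed: "\<lbrakk>h \<in> hom_set T X Y; y \<in> FC Y e\<rbrakk> \<Longrightarrow> Farr F h e y \<in> FC X e"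
  using gmod_homD(1)[OF Farr_hom] .

text \<open>The component in degree \<open>d\<close> of the morphism \<open>Ext\<^sup>*(-, X) \<rightarrow> F\<close> that corresponds to
  the element \<open>c\<close> of \<open>F(X)\<^sub>0\<close> under the Yoneda lemma.\<close>

definition yoneda :: "'o \<Rightarrow> 'x \<Rightarrow> int \<Rightarrow> 'm \<Rightarrow> 'x" where
  "yoneda X c d h = Farr F h d (inv_into (FC (sus_ob T d X) d) (Fsh F d X d) c)"

lemma Fsh_inv:
  assumes "X \<in> Obj T" "c \<in> FC X 0"
  shows "inv_into (FC (sus_ob T d X) d) (Fsh F d X d) c \<in> FC (sus_ob T d X) d"
    "Fsh F d X d (inv_into (FC (sus_ob T d X) d) (Fsh F d X d) c) = c"
proof -
  have "c \<in> Fsh F d X d ` FC (sus_ob T d X) d"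
    using Fsh_bij[OF assms(1), of d d] assms(2) by (simp add: bij_betw_def)
  then show "inv_into (FC (sus_ob T d X) d) (Fsh F d X d) c \<in> FC (sus_ob T d X) d"
    "Fsh F d X d (inv_into (FC (sus_ob T d X) d) (Fsh F d X d) c) = c"
    by (rule inv_into_into, rule f_inv_into_f)
qed

lemma Fsh_inv_eq:
  assumes "X \<in> Obj T" "u \<in> FC (sus_ob T d X) d" "Fsh F d X d u = c"
  shows "inv_into (FC (sus_ob T d X) d) (Fsh F d X d) c = u"
  using inv_into_f_f[of "Fsh F d X d" "FC (sus_ob T d X) d" u] Fsh_bij[OF assms(1), of d d] assms(2,3)
  by (auto simp: bij_betw_def)

lemma yoneda_closed:
  assumes "X \<in> Obj T" "c \<in> FC X 0" "h \<in> hom_set T Y (sus_ob T d X)"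
  shows "yoneda X c d h \<in> FC Y d"
  unfolding yoneda_def using Farr_closed[OF assms(3)] Fsh_inv[OF assms(1,2)] by blast

text \<open>The Yoneda map is \<open>degree_map\<close> evaluated at \<open>c\<close>. Evaluation in
  degree 0 turns the operations of \<open>ghom\<close> into those of \<open>F(Y)\<close>, because
  \<open>ghom\<close> acts through the unsigned action on the target.\<close>

lemma yoneda_hom:
  assumes X: "X \<in> Obj T" and Y: "Y \<in> Obj T" and c: "c \<in> FC X 0"
  shows "gmod_hom R (Ext T \<phi> Y X) (Fob F Y) (yoneda X c)"
proof -
  have yo: "degree_map T F X d h 0 c = yoneda X c d h" for d h
    using c by (simp add: degree_map_def yoneda_def)
  note dm = gmod_homD[OF degree_map_hom[OF Y X]]
  show ?thesis
    unfolding gmod_hom_def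
  proof (intro conjI allI ballI)
    show "yoneda X c d h \<in> FC Y d" if "h \<in> gcar (Ext T \<phi> Y X) d" for d h
      using yoneda_closed[OF X c] that by simp
    show "yoneda X c d (h \<oplus>\<^bsub>gpart (Ext T \<phi> Y X) d\<^esub> k) =
        yoneda X c d h \<oplus>\<^bsub>gpart (Fob F Y) d\<^esub> yoneda X c d k"
      if "h \<in> gcar (Ext T \<phi> Y X) d" "k \<in> gcar (Ext T \<phi> Y X) d" for d h k
      using fun_cong[OF fun_cong[OF dm(2)[OF that]], of 0 c] c by (simp add: ghom_def yo)
    show "yoneda X c (d + e) (gact (Ext T \<phi> Y X) d e r h) = gact (Fob F Y) d e r (yoneda X c e h)"
      if "r \<in> grading R d" "h \<in> gcar (Ext T \<phi> Y X) e" for d e r h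
      using fun_cong[OF fun_cong[OF dm(3)[OF that]], of 0 c] c by (simp add: ghom_def yo)
  qed
qed

lemma yoneda_0:
  assumes "X \<in> Obj T" "c \<in> FC X 0"
  shows "yoneda X c 0 h = Farr F h 0 c"
  using Fsh_inv_eq[of X c 0 c] Fsh_0[OF assms] assms by (simp add: yoneda_def)

text \<open>Functoriality does not include additivity on morphisms; it is the degree 0 case of
  linearity on Ext.\<close>

lemma Farr_Add_arr:
  assumes "h \<in> hom_set T Y X" "k \<in> hom_set T Y X" "c \<in> FC X 0"
  shows "Farr F (Add_arr T h k) 0 c = Farr F h 0 c \<oplus>\<^bsub>gpart (Fob F Y) 0\<^esub> Farr F k 0 c"
proof -
  have O: "X \<in> Obj T" "Y \<in> Obj T" using hom_set_Obj assms(1) by auto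
  show ?thesis using gmod_homD(2)[OF yoneda_hom[OF O assms(3)], of h 0 k] assms yoneda_0[OF O(1) assms(3)]
    by simp
qed

lemma yoneda_precomp:
  assumes "X \<in> Obj T" "c \<in> FC X 0" "k \<in> hom_set T Y (sus_ob T d X)" "h \<in> hom_set T Z Y"
  shows "yoneda X c d (k \<cdot>\<^bsub>T\<^esub> h) = Farr F h d (yoneda X c d k)"
  unfolding yoneda_def by (rule Farr_Comp[OF assms(4,3) Fsh_inv(1)[OF assms(1,2)]])

text \<open>Pushing forward along \<open>g\<close> on Ext matches pulling \<open>c\<close> back
  along \<open>g\<close>; this carries solutions from a summand to a direct sum.\<close>

lemma yoneda_postcomp:
  assumes g: "g \<in> hom_set T A X" and c: "c \<in> FC X 0" and h: "h \<in> hom_set T Y (sus_ob T d A)"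
  shows "yoneda X c d (sus_arr T d g \<cdot>\<^bsub>T\<^esub> h) = yoneda A (Farr F g 0 c) d h"
proof -
  have O: "X \<in> Obj T" "A \<in> Obj T" using hom_set_Obj g by auto
  let ?u = "inv_into (FC (sus_ob T d X) d) (Fsh F d X d) c"
  note u = Fsh_inv[OF O(1) c, of d]
  have gu: "Farr F (sus_arr T d g) d ?u \<in> FC (sus_ob T d A) d" by (rule Farr_closed[OF sus_hom[OF g] u(1)])
  have "Fsh F d A d (Farr F (sus_arr T d g) d ?u) = Farr F g 0 c"
    using Fsh_natural[OF g u(1)] u(2) by simp
  from Fsh_inv_eq[OF O(2) gu this] show ?thesis
    unfolding yoneda_def using Farr_Comp[OF h sus_hom[OF g] u(1)] by simp
qed

text \<open>Coherence for \<open>n\<close> and \<open>- n + e\<close> matches the two preimages of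
  \<open>c\<close>. Degree \<open>e\<close> at a suspension is thereby exchanged for degree
  \<open>- n + e\<close> at the object itself.\<close>

lemma yoneda_shift:
  assumes X: "X \<in> Obj T" and Y: "Y \<in> Obj T" and c: "c \<in> FC X 0"
    and h: "h \<in> hom_set T (sus_ob T n Y) (sus_ob T e X)"
  shows "Fsh F n Y e (yoneda X c e h) = yoneda X c (- n + e) (sus_arr T (- n) h)"
proof -
  let ?u = "inv_into (FC (sus_ob T e X) e) (Fsh F e X e) c"
  let ?X = "sus_ob T (- n + e) X"
  note u = Fsh_inv[OF X c, of e]
  have nX: "sus_ob T n ?X = sus_ob T e X" by (simp add: sus_ob_add[OF X])
  have h': "sus_arr T (- n) h \<in> hom_set T Y ?X"
    using sus_hom[OF h, of "- n"] Y by (simp add: sus_ob_add[OF X])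
  have XO: "?X \<in> Obj T" using X sus_ob_closed by blast
  have u': "?u \<in> FC (sus_ob T n ?X) e" using u(1) nX by simp
  have w: "Fsh F n ?X e ?u \<in> FC ?X (- n + e)" by (rule Fsh_closed[OF XO u'])
  have "Fsh F (- n + e) X (- n + e) (Fsh F n ?X e ?u) = c"
    using Fsh_coherent[OF X, of ?u n "- n + e" e] u by simp
  then have "inv_into (FC ?X (- n + e)) (Fsh F (- n + e) X (- n + e)) c = Fsh F n ?X e ?u"
    by (rule Fsh_inv_eq[OF X w])
  then show ?thesis
    unfolding yoneda_def using Fsh_natural[OF h' u'] h by simp
qed

end

section \<open>Finite generation at the generator and representability\<close>

locale cohomological_graded_functor = graded_linear_functor R T \<phi> F
  for R :: "('r, 'y) graded_ring_scheme" and T :: "('o, 'm, 'z) triang_category_scheme"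
    and \<phi> :: "int \<Rightarrow> 'r \<Rightarrow> 'o \<Rightarrow> 'm" and F :: "('o, 'm, 'r, 'x) graded_functor" +
  assumes cohomological: "cohomological T F"
begin

sublocale deg0: cohomological_group_functor T "\<lambda>X. gpart (Fob F X) 0" "\<lambda>h. Farr F h 0"
proof (intro cohomological_group_functor.intro triangulated_category_axioms
    cohomological_group_functor_axioms.intro)
  show "abelian_group (gpart (Fob F X) 0)" if "X \<in> Obj T" for X by (rule F_group[OF that])
  show "Farr F h 0 (y \<oplus>\<^bsub>gpart (Fob F Y) 0\<^esub> z) = Farr F h 0 y \<oplus>\<^bsub>gpart (Fob F X) 0\<^esub> Farr F h 0 z"
    if "h \<in> hom_set T X Y" "y \<in> FC Y 0" "z \<in> FC Y 0" for h X Y y z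
    using gmod_homD(2)[OF Farr_hom[OF that(1)] that(2,3)] .
  fix u v w X Y Z n
  assume tri: "(u, v, w) \<in> Triangles T" and h: "u \<in> hom_set T X Y" "v \<in> hom_set T Y Z"
    "w \<in> hom_set T Z (Sus_ob T X)"
  have ex: "exact_image T F (sus_arr T n u) (sus_arr T n v)" "exact_image T F (sus_arr T n v) (sus_arr T n w)"
    using cohomological tri unfolding cohomological_def by blast+
  have SX: "sus_ob T n (Sus_ob T X) = sus_ob T (n + 1) X"
    using sus_ob_add[of X n 1] hom_set_Obj[OF h(1)] by (simp add: sus_ob_1)
  have d: "Dom T (sus_arr T n u) = sus_ob T n X" "Dom T (sus_arr T n v) = sus_ob T n Y"
    "Cod T (sus_arr T n v) = sus_ob T n Z" "Dom T (sus_arr T n w) = sus_ob T n Z"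
    "Cod T (sus_arr T n w) = sus_ob T (n + 1) X"
    using sus_hom[OF h(1), of n] sus_hom[OF h(2), of n] sus_hom[OF h(3), of n] SX by (auto simp: hom_set_def)
  show "\<exists>z\<in>FC (sus_ob T n Z) 0. Farr F (sus_arr T n v) 0 z = y"
    if y: "y \<in> FC (sus_ob T n Y) 0" "Farr F (sus_arr T n u) 0 y = \<zero>\<^bsub>gpart (Fob F (sus_ob T n X)) 0\<^esub>" for y
  proof -
    have "y \<in> Farr F (sus_arr T n v) 0 ` FC (sus_ob T n Z) 0"
      using ex(1)[unfolded exact_image_def, THEN spec, of 0] y d by simp
    then show ?thesis by auto
  qed
  show "\<exists>t\<in>FC (sus_ob T (n + 1) X) 0. Farr F (sus_arr T n w) 0 t = y"
    if y: "y \<in> FC (sus_ob T n Z) 0" "Farr F (sus_arr T n v) 0 y = \<zero>\<^bsub>gpart (Fob F (sus_ob T n Y)) 0\<^esub>" for y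
  proof -
    have "y \<in> Farr F (sus_arr T n w) 0 ` FC (sus_ob T (n + 1) X) 0"
      using ex(2)[unfolded exact_image_def, THEN spec, of 0] y d by simp
    then show ?thesis by auto
  qed
qed (use Farr_closed Farr_Idn Farr_Comp Farr_Add_arr in auto)

lemma finite_family_lifts:
  assumes G: "G \<in> Obj T" and "finite B"
  shows "\<forall>(d, b)\<in>B. b \<in> FC G d \<Longrightarrow>
    \<exists>A\<in>Obj T. \<exists>x\<in>FC A 0. \<forall>(d, b)\<in>B. \<exists>h\<in>hom_set T G (sus_ob T d A). yoneda A x d h = b"
  using \<open>finite B\<close>
proof (induction B)
  case empty
  then show ?case using zero_object_exists F_zero unfolding zero_object_def by blast
next
  case (insert p B)
  obtain d b where p: "p = (d, b)" by fastforce
  have b: "b \<in> FC G d" using insert.prems p by simp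
  obtain A x where A: "A \<in> Obj T" "x \<in> FC A 0"
    and AB: "\<forall>(d, b)\<in>B. \<exists>h\<in>hom_set T G (sus_ob T d A). yoneda A x d h = b"
    using insert.IH insert.prems by auto
  then have B: "\<And>d b. (d, b) \<in> B \<Longrightarrow> \<exists>h\<in>hom_set T G (sus_ob T d A). yoneda A x d h = b" by auto
  \<comment> \<open>\<open>F(G)\<close> in degree \<open>d\<close> is \<open>F(?A)\<close> in degree
    0, so the generator \<open>b\<close> becomes an element of \<open>H\<close> at
    \<open>?A\<close>, and its Yoneda map sends the identity of \<open>G\<close> to
    \<open>b\<close>.\<close>
  let ?A = "sus_ob T (- d) G"
  let ?x = "Fsh F d ?A d b"
  have A': "?A \<in> Obj T" "sus_ob T d ?A = G" using G sus_ob_closed by auto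
  have x': "?x \<in> FC ?A 0" using Fsh_closed[OF A'(1), of b d d] b A'(2) by simp
  have yb: "yoneda ?A ?x d (Idn T G) = b"
    unfolding yoneda_def using Fsh_inv_eq[OF A'(1), of b d ?x] b A'(2) Farr_Idn[OF G b] by simp
  obtain S where "direct_sum T A ?A S" using direct_sum_exists A(1) A'(1) by blast
  then obtain i j p q where S: "S \<in> Obj T" and d: "i \<in> hom_set T A S" "j \<in> hom_set T ?A S"
    "p \<in> hom_set T S A" "q \<in> hom_set T S ?A" "p \<cdot>\<^bsub>T\<^esub> i = Idn T A" "q \<cdot>\<^bsub>T\<^esub> j = Idn T ?A"
    "q \<cdot>\<^bsub>T\<^esub> i = Zero_arr T A ?A" "p \<cdot>\<^bsub>T\<^esub> j = Zero_arr T ?A A"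
    unfolding direct_sum_def by blast
  obtain y where y: "y \<in> FC S 0" and iy: "Farr F i 0 y = x" and jy: "Farr F j 0 y = ?x"
    by (rule deg0.direct_sum_element[OF d A(2) x'])
  have old: "\<exists>h\<in>hom_set T G (sus_ob T d' S). yoneda S y d' h = b'" if B': "(d', b') \<in> B" for d' b'
  proof -
    obtain h where h: "h \<in> hom_set T G (sus_ob T d' A)" "yoneda A x d' h = b'" using B[OF B'] by blast
    then show ?thesis
      using yoneda_postcomp[OF d(1) y h(1)] iy Comp_hom[OF h(1) sus_hom[OF d(1)]] by auto
  qed
  have idn: "Idn T G \<in> hom_set T G (sus_ob T d ?A)" using Idn_hom[OF G] A'(2) by simp
  have new: "\<exists>h\<in>hom_set T G (sus_ob T d S). yoneda S y d h = b"
    using yoneda_postcomp[OF d(2) y idn] jy yb Comp_hom[OF idn sus_hom[OF d(2)]] by auto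
  show ?case unfolding p by (intro bexI[OF _ S] bexI[OF _ y]) (use old new in auto)
qed

text \<open>The image of a Yoneda map is a graded submodule, so it is everything once it contains
  the generators. Surjectivity in degree \<open>- n\<close> at \<open>G\<close> is surjectivity in
  degree 0 at the suspension \<open>n\<close>.\<close>

lemma approximation_start:
  assumes G: "G \<in> Obj T" and "gfin_gen R (Fob F G)"
  shows "\<exists>A\<in>Obj T. \<exists>x\<in>FC A 0. \<forall>n. deg0.lifts A x (sus_ob T n G)"
proof -
  interpret M: graded_module R "Fob F G" by (rule Fob_module[OF G])
  obtain B where B: "finite B" "\<forall>(d, b)\<in>B. b \<in> FC G d" "\<And>n. FC G n \<subseteq> gspan R (Fob F G) B n"
    by (rule M.gfin_gen_gspan[OF assms(2)]) (rule that)
  obtain A x where A: "A \<in> Obj T" and x: "x \<in> FC A 0"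
    and l: "\<forall>(d, b)\<in>B. \<exists>h\<in>hom_set T G (sus_ob T d A). yoneda A x d h = b"
    using finite_family_lifts[OF G B(1,2)] by blast
  have im: "gsubmodule R (Fob F G) (\<lambda>d. yoneda A x d ` gcar (Ext T \<phi> G A) d)"
    by (rule gmod_hom_image[OF Ext_module[OF G A] Fob_module[OF G] yoneda_hom[OF A G x]])
  have "\<forall>(d, b)\<in>B. b \<in> yoneda A x d ` gcar (Ext T \<phi> G A) d"
    using l by (fastforce intro: image_eqI[rotated])
  then have surj: "FC G n \<subseteq> yoneda A x n ` hom_set T G (sus_ob T n A)" for n
    using gspan_least[OF im, of B n] B(3)[of n] by simp
  have "deg0.lifts A x (sus_ob T n G)" for n
    unfolding deg0.lifts_def
  proof
    fix y assume y: "y \<in> FC (sus_ob T n G) 0"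
    have "Fsh F n G 0 y \<in> FC G (- n)" using Fsh_closed[OF G y] by simp
    then obtain h where h: "h \<in> hom_set T G (sus_ob T (- n) A)" "yoneda A x (- n) h = Fsh F n G 0 y"
      using surj[of "- n"] by (metis (no_types, lifting) imageE subsetD)
    have h': "sus_arr T n h \<in> hom_set T (sus_ob T n G) A" using sus_hom[OF h(1), of n] A by simp
    have "Fsh F n G 0 (yoneda A x 0 (sus_arr T n h)) = Fsh F n G 0 y"
      using yoneda_shift[OF A G x, of "sus_arr T n h" n 0] h h' by simp
    then have "yoneda A x 0 (sus_arr T n h) = y"
      using Fsh_inj[OF G _ y] yoneda_closed[OF A x, of "sus_arr T n h" _ 0] h' by simp
    then show "\<exists>h\<in>hom_set T (sus_ob T n G) A. Farr F h 0 x = y"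
      using h' yoneda_0[OF A x] by auto
  qed
  then show ?thesis using A x by blast
qed

text \<open>The kernels at all suspensions of \<open>G\<close> become the degrees of one graded
  submodule of \<open>Ext T \<phi> G A\<close>, so one finite generating set serves them
  all.\<close>

lemma yoneda_zero_shift:
  assumes A: "A \<in> Obj T" and G: "G \<in> Obj T" and x: "x \<in> FC A 0" and h: "h \<in> hom_set T (sus_ob T n G) A"
  shows "Farr F h 0 x = \<zero>\<^bsub>gpart (Fob F (sus_ob T n G)) 0\<^esub> \<longleftrightarrow>
    yoneda A x (- n) (sus_arr T (- n) h) = \<zero>\<^bsub>gpart (Fob F G) (- n)\<^esub>"
proof -
  have "Fsh F n G 0 (Farr F h 0 x) = yoneda A x (- n) (sus_arr T (- n) h)"
    using yoneda_shift[OF A G x, of h n 0] h yoneda_0[OF A x] by simp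
  moreover have "Fsh F n G 0 \<zero>\<^bsub>gpart (Fob F (sus_ob T n G)) 0\<^esub> = \<zero>\<^bsub>gpart (Fob F G) (- n)\<^esub>"
    using Fsh_zero[OF G, of n 0] by simp
  ultimately show ?thesis
    using Fsh_inj[OF G Farr_closed[OF h x] F_zero[OF sus_ob_closed[OF G]]] by metis
qed

text \<open>Each element of the family adds a suspension of \<open>G\<close> to \<open>B\<close>, on
  which \<open>b\<close> is the desuspended element.\<close>

lemma finite_family_factors:
  assumes G: "G \<in> Obj T" and A: "A \<in> Obj T" and x: "x \<in> FC A 0" and "finite K"
  shows "\<forall>(d, h)\<in>K. h \<in> hom_set T G (sus_ob T d A) \<and> yoneda A x d h = \<zero>\<^bsub>gpart (Fob F G) d\<^esub> \<Longrightarrow>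
    \<exists>B\<in>Obj T. \<exists>b\<in>hom_set T B A. Farr F b 0 x = \<zero>\<^bsub>gpart (Fob F B) 0\<^esub> \<and>
      (\<forall>(d, h)\<in>K. \<exists>g\<in>hom_set T G (sus_ob T d B). sus_arr T d b \<cdot>\<^bsub>T\<^esub> g = h)"
  using \<open>finite K\<close>
proof (induction K)
  case empty
  \<comment> \<open>With nothing to factor, the zero endomorphism of \<open>A\<close>
    serves.\<close>
  show ?case
    using Zero_arr_hom[OF A A] deg0.Hm_zero_arr[OF A A x] A by blast
next
  case (insert p K)
  obtain d h where p: "p = (d, h)" by fastforce
  have h: "h \<in> hom_set T G (sus_ob T d A)" "yoneda A x d h = \<zero>\<^bsub>gpart (Fob F G) d\<^esub>"
    using insert.prems p by auto
  obtain B b where B: "B \<in> Obj T" and b: "b \<in> hom_set T B A" "Farr F b 0 x = \<zero>\<^bsub>gpart (Fob F B) 0\<^esub>"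
    and BK: "\<forall>(d, h)\<in>K. \<exists>g\<in>hom_set T G (sus_ob T d B). sus_arr T d b \<cdot>\<^bsub>T\<^esub> g = h"
    using insert.IH insert.prems by auto
  then have K: "\<And>d h. (d, h) \<in> K \<Longrightarrow> \<exists>g\<in>hom_set T G (sus_ob T d B). sus_arr T d b \<cdot>\<^bsub>T\<^esub> g = h" by auto
  let ?B = "sus_ob T (- d) G" and ?b = "sus_arr T (- d) h"
  have B': "?B \<in> Obj T" "sus_ob T d ?B = G" using G sus_ob_closed by auto
  have b': "?b \<in> hom_set T ?B A" using sus_hom[OF h(1), of "- d"] A by simp
  have bx: "Farr F ?b 0 x = \<zero>\<^bsub>gpart (Fob F ?B) 0\<^esub>"
    using yoneda_zero_shift[OF A G x b'] h by simp
  obtain S where "direct_sum T B ?B S" using direct_sum_exists B B'(1) by blast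
  then obtain i j p q where S: "S \<in> Obj T" and d: "i \<in> hom_set T B S" "j \<in> hom_set T ?B S"
    "p \<in> hom_set T S B" "q \<in> hom_set T S ?B" "p \<cdot>\<^bsub>T\<^esub> i = Idn T B" "q \<cdot>\<^bsub>T\<^esub> j = Idn T ?B"
    "q \<cdot>\<^bsub>T\<^esub> i = Zero_arr T B ?B" "p \<cdot>\<^bsub>T\<^esub> j = Zero_arr T ?B B"
    unfolding direct_sum_def by blast
  have bp: "b \<cdot>\<^bsub>T\<^esub> p \<in> hom_set T S A" and bq: "?b \<cdot>\<^bsub>T\<^esub> q \<in> hom_set T S A"
    using Comp_hom[OF d(3) b(1)] Comp_hom[OF d(4) b'] by auto
  let ?c = "Add_arr T (b \<cdot>\<^bsub>T\<^esub> p) (?b \<cdot>\<^bsub>T\<^esub> q)"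
  have c: "?c \<in> hom_set T S A" by (rule Add_arr_hom[OF bp bq])
  interpret P: abelian_group "gpart (Fob F S) 0" by (rule F_group[OF S])
  have cx: "Farr F ?c 0 x = \<zero>\<^bsub>gpart (Fob F S) 0\<^esub>"
    using deg0.Hm_Add_arr[OF bp bq x] deg0.Hm_Comp[OF d(3) b(1) x] deg0.Hm_Comp[OF d(4) b' x] b(2) bx
      deg0.Hm_zero[OF d(3)] deg0.Hm_zero[OF d(4)] by simp
  have ci: "?c \<cdot>\<^bsub>T\<^esub> i = b"
    using Comp_add_left[OF d(1) bp bq] Comp_assoc[OF d(1,3) b(1)] Comp_assoc[OF d(1,4) b'] d(5,7)
      Comp_Idn[OF b(1)] Comp_zero_right[OF b' B] Add_arr_zero[OF b(1)] by simp
  have cj: "?c \<cdot>\<^bsub>T\<^esub> j = ?b"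
  proof -
    have "?c \<cdot>\<^bsub>T\<^esub> j = Add_arr T (Zero_arr T ?B A) ?b"
      using Comp_add_left[OF d(2) bp bq] Comp_assoc[OF d(2,3) b(1)] Comp_assoc[OF d(2,4) b'] d(6,8)
        Comp_Idn[OF b'] Comp_zero_right[OF b(1) B'(1)] by simp
    also have "\<dots> = Add_arr T ?b (Zero_arr T ?B A)"
      using abelian_monoid.a_comm[OF abelian_group.axioms(1)[OF hom_abelian_group[OF B'(1) A]]]
        b' Zero_arr_hom[OF B'(1) A] by simp
    finally show ?thesis using Add_arr_zero[OF b'] by simp
  qed
  have old: "\<exists>g\<in>hom_set T G (sus_ob T d' S). sus_arr T d' ?c \<cdot>\<^bsub>T\<^esub> g = h'" if K': "(d', h') \<in> K" for d' h'
  proof -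
    obtain g where g: "g \<in> hom_set T G (sus_ob T d' B)" "sus_arr T d' b \<cdot>\<^bsub>T\<^esub> g = h'" using K[OF K'] by blast
    have "sus_arr T d' ?c \<cdot>\<^bsub>T\<^esub> (sus_arr T d' i \<cdot>\<^bsub>T\<^esub> g) = h'"
      using Comp_assoc[OF g(1) sus_hom[OF d(1)] sus_hom[OF c]] sus_Comp[OF d(1) c, of d'] ci g(2) by simp
    then show ?thesis using Comp_hom[OF g(1) sus_hom[OF d(1)]] by blast
  qed
  have "sus_arr T d ?c \<cdot>\<^bsub>T\<^esub> sus_arr T d j = h"
    using sus_Comp[OF d(2) c, of d] cj h(1) by simp
  then have new: "\<exists>g\<in>hom_set T G (sus_ob T d S). sus_arr T d ?c \<cdot>\<^bsub>T\<^esub> g = h"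
    using sus_hom[OF d(2), of d] B'(2) by auto
  show ?case unfolding p by (intro bexI[OF _ S] bexI[OF _ c] conjI cx) (use old new in auto)
qed

text \<open>The generators of the kernel factor through suspensions of \<open>b\<close>, and such
  maps form a graded submodule; hence the whole kernel factors.\<close>

lemma approximation_step:
  assumes noeth: "left_right_noetherian R" and fin: "gfin_gen R (Ext T \<phi> G A)"
    and G: "G \<in> Obj T" and A: "A \<in> Obj T" and x: "x \<in> FC A 0"
  shows "\<exists>B\<in>Obj T. \<exists>b\<in>hom_set T B A. Farr F b 0 x = \<zero>\<^bsub>gpart (Fob F B) 0\<^esub> \<and>
    (\<forall>n. \<forall>h\<in>hom_set T (sus_ob T n G) A. Farr F h 0 x = \<zero>\<^bsub>gpart (Fob F (sus_ob T n G)) 0\<^esub> \<longrightarrow>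
       (\<exists>g\<in>hom_set T (sus_ob T n G) B. b \<cdot>\<^bsub>T\<^esub> g = h))"
proof -
  interpret E: graded_module R "Ext T \<phi> G A" by (rule Ext_module[OF G A])
  let ?N = "\<lambda>d. {h \<in> gcar (Ext T \<phi> G A) d. yoneda A x d h = \<zero>\<^bsub>gpart (Fob F G) d\<^esub>}"
  have N: "gsubmodule R (Ext T \<phi> G A) ?N"
    by (rule gmod_hom_kernel[OF Ext_module[OF G A] Fob_module[OF G] yoneda_hom[OF A G x]])
  obtain K where K: "finite K" "\<forall>(d, h)\<in>K. h \<in> ?N d"
    "\<And>N' n. \<lbrakk>gsubmodule R (Ext T \<phi> G A) N'; \<forall>(d, h)\<in>K. h \<in> N' d\<rbrakk> \<Longrightarrow> ?N n \<subseteq> N' n"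
    by (rule E.gsubmodule_finitely_generated[OF noeth fin N]) (rule that)
  have "\<forall>(d, h)\<in>K. h \<in> hom_set T G (sus_ob T d A) \<and> yoneda A x d h = \<zero>\<^bsub>gpart (Fob F G) d\<^esub>"
    using K(2) by auto
  then obtain B b where B: "B \<in> Obj T" and b: "b \<in> hom_set T B A" "Farr F b 0 x = \<zero>\<^bsub>gpart (Fob F B) 0\<^esub>"
    and f: "\<forall>(d, h)\<in>K. \<exists>g\<in>hom_set T G (sus_ob T d B). sus_arr T d b \<cdot>\<^bsub>T\<^esub> g = h"
    using finite_family_factors[OF G A x K(1)] by blast
  have "\<forall>(d, h)\<in>K. h \<in> (\<lambda>g. sus_arr T d b \<cdot>\<^bsub>T\<^esub> g) ` hom_set T G (sus_ob T d B)"
    using f by (fastforce intro: image_eqI[rotated])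
  note NN = K(3)[OF factoring_submodule[OF G b(1)] this]
  have "\<exists>g\<in>hom_set T (sus_ob T n G) B. b \<cdot>\<^bsub>T\<^esub> g = h"
    if h: "h \<in> hom_set T (sus_ob T n G) A" "Farr F h 0 x = \<zero>\<^bsub>gpart (Fob F (sus_ob T n G)) 0\<^esub>" for n h
  proof -
    have "sus_arr T (- n) h \<in> hom_set T G (sus_ob T (- n) A)" using sus_hom[OF h(1), of "- n"] G by simp
    then have "sus_arr T (- n) h \<in> ?N (- n)" using yoneda_zero_shift[OF A G x h(1)] h(2) by simp
    then obtain g where g: "g \<in> hom_set T G (sus_ob T (- n) B)" "sus_arr T (- n) h = sus_arr T (- n) b \<cdot>\<^bsub>T\<^esub> g"
      using NN by blast
    have "h = b \<cdot>\<^bsub>T\<^esub> sus_arr T n g"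
      using sus_Comp[OF g(1) sus_hom[OF b(1)], of n] g(2) h(1) b(1) by (metis sus_arr_cancel(2))
    moreover have "sus_arr T n g \<in> hom_set T (sus_ob T n G) B" using sus_hom[OF g(1), of n] B by simp
    ultimately show ?thesis by blast
  qed
  then show ?thesis using B b by blast
qed

text \<open>In degree \<open>d\<close> the Yoneda map is the degree 0 map at the suspension
  \<open>- d\<close>, placed between the bijections \<open>sus_arr\<close> and
  \<open>Fsh\<close>.\<close>

lemma representable_if_bijective:
  assumes X: "X \<in> Obj T" and c: "c \<in> FC X 0"
    and bij: "\<And>Y. Y \<in> Obj T \<Longrightarrow> bij_betw (\<lambda>h. Farr F h 0 c) (hom_set T Y X) (FC Y 0)"
  shows "graded_representable R T \<phi> F"
proof -
  have ybij: "bij_betw (yoneda X c d) (hom_set T Y (sus_ob T d X)) (FC Y d)" if Y: "Y \<in> Obj T" for Y d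
  proof -
    have 1: "bij_betw (sus_arr T (- d)) (hom_set T Y (sus_ob T d X)) (hom_set T (sus_ob T (- d) Y) X)"
    proof (rule bij_betw_byWitness[where f' = "sus_arr T d"])
      show "\<forall>h\<in>hom_set T Y (sus_ob T d X). sus_arr T d (sus_arr T (- d) h) = h" by auto
      show "\<forall>h\<in>hom_set T (sus_ob T (- d) Y) X. sus_arr T (- d) (sus_arr T d h) = h" by auto
      show "sus_arr T (- d) ` hom_set T Y (sus_ob T d X) \<subseteq> hom_set T (sus_ob T (- d) Y) X"
        using sus_hom[of _ Y "sus_ob T d X" "- d"] X by auto
      show "sus_arr T d ` hom_set T (sus_ob T (- d) Y) X \<subseteq> hom_set T Y (sus_ob T d X)"
        using sus_hom[of _ "sus_ob T (- d) Y" X d] Y by auto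
    qed
    have 2: "bij_betw (\<lambda>h. Farr F h 0 c) (hom_set T (sus_ob T (- d) Y) X) (FC (sus_ob T (- d) Y) 0)"
      by (rule bij[OF sus_ob_closed[OF Y]])
    have 3: "bij_betw (Fsh F (- d) Y 0) (FC (sus_ob T (- d) Y) 0) (FC Y d)"
      using Fsh_bij[OF Y, of "- d" 0] by simp
    have "yoneda X c d h = (Fsh F (- d) Y 0 \<circ> ((\<lambda>h. Farr F h 0 c) \<circ> sus_arr T (- d))) h"
      if h: "h \<in> hom_set T Y (sus_ob T d X)" for h
    proof -
      have "sus_arr T (- d) h \<in> hom_set T (sus_ob T (- d) Y) X" using sus_hom[OF h, of "- d"] X by simp
      then show ?thesis
        using yoneda_shift[OF X Y c, of "sus_arr T (- d) h" "- d" 0] h yoneda_0[OF X c] by simp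
    qed
    from bij_betw_cong[of _ "yoneda X c d", OF this] show ?thesis
      using bij_betw_trans[OF bij_betw_trans[OF 1 2] 3] by blast
  qed
  \<comment> \<open>The required transformation goes from \<open>F\<close> to Ext, so the Yoneda map
    is inverted; naturality and shift compatibility of \<open>\<tau>\<close> follow from its laws by
    injectivity.\<close>
  define \<tau> where "\<tau> = (\<lambda>Y d. inv_into (hom_set T Y (sus_ob T d X)) (yoneda X c d))"
  have iso: "gmod_iso R (Fob F Y) (Ext T \<phi> Y X) (\<tau> Y)" if Y: "Y \<in> Obj T" for Y
  proof -
    have "gmod_iso R (Ext T \<phi> Y X) (Fob F Y) (yoneda X c)"
      using yoneda_hom[OF X Y c] ybij[OF Y] by (simp add: gmod_iso_def)
    from gmod_iso_inv[OF Ext_module[OF Y X] this] show ?thesis by (simp add: \<tau>_def)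
  qed
  have \<tau>: "\<tau> Y d y \<in> hom_set T Y (sus_ob T d X)" "yoneda X c d (\<tau> Y d y) = y"
    if "Y \<in> Obj T" "y \<in> FC Y d" for Y d y
    using gmod_homD(1)[of R "Fob F Y" "Ext T \<phi> Y X" "\<tau> Y" y d] iso[OF that(1)] that(2)
      bij_betw_inv_into_right[OF ybij[OF that(1)] that(2)]
    by (simp_all add: gmod_iso_def \<tau>_def)
  have \<tau>_eq: "\<tau> Y d y = h" if "Y \<in> Obj T" "h \<in> hom_set T Y (sus_ob T d X)" "yoneda X c d h = y" for Y d h y
    using bij_betw_inv_into_left[OF ybij[OF that(1)] that(2)] that(3) by (simp add: \<tau>_def)
  have "graded_natural_iso R T F (Ext_functor T \<phi> X) \<tau>"
    unfolding graded_natural_iso_def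
  proof (intro conjI ballI allI)
    show "gmod_iso R (Fob F Y) (Fob (Ext_functor T \<phi> X) Y) (\<tau> Y)" if "Y \<in> Obj T" for Y
      using iso[OF that] by (simp add: Ext_functor_def)
  next
    fix Y Z h e z assume Y: "Y \<in> Obj T" and Z: "Z \<in> Obj T" and h: "h \<in> hom_set T Y Z" and z: "z \<in> FC Z e"
    have "\<tau> Y e (Farr F h e z) = \<tau> Z e z \<cdot>\<^bsub>T\<^esub> h"
      by (rule \<tau>_eq[OF Y Comp_hom[OF h \<tau>(1)[OF Z z]]])
        (use yoneda_precomp[OF X c \<tau>(1)[OF Z z] h] \<tau>(2)[OF Z z] in simp)
    then show "\<tau> Y e (Farr F h e z) = Farr (Ext_functor T \<phi> X) h e (\<tau> Z e z)"
      by (simp add: Ext_functor_def)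
  next
    fix Y n e y assume Y: "Y \<in> Obj T" and y: "y \<in> FC (sus_ob T n Y) e"
    note t = \<tau>[OF sus_ob_closed[OF Y] y]
    have "sus_arr T (- n) (\<tau> (sus_ob T n Y) e y) \<in> hom_set T Y (sus_ob T (- n + e) X)"
      using sus_hom[OF t(1), of "- n"] Y sus_ob_add[OF X, of "- n" e] by simp
    from \<tau>_eq[OF Y this] have "\<tau> Y (- n + e) (Fsh F n Y e y) = sus_arr T (- n) (\<tau> (sus_ob T n Y) e y)"
      using yoneda_shift[OF X Y c t(1)] t(2) by simp
    then show "\<tau> Y (- n + e) (Fsh F n Y e y) = Fsh (Ext_functor T \<phi> X) n Y e (\<tau> (sus_ob T n Y) e y)"
      by (simp add: Ext_functor_def)
  qed
  then show ?thesis unfolding graded_representable_def using X by blast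
qed

end

theorem theorem2p7:
  fixes R :: "('r, 'y) graded_ring_scheme"
    and T :: "('o, 'm, 'z) triang_category_scheme"
    and \<phi> :: "int \<Rightarrow> 'r \<Rightarrow> 'o \<Rightarrow> 'm"
    and F :: "('o, 'm, 'r, 'x) graded_functor"
  assumes "graded_commutative_ring R" and "left_right_noetherian R"
    and "triangulated_category T" and "graded_linear_category R T \<phi>"
    and "strongly_generated T" and "Ext_finite R T \<phi>" and "idempotent_complete T"
    and "graded_linear_functor R T \<phi> F" and "cohomological T F"
  shows "graded_representable R T \<phi> F \<longleftrightarrow> locally_finite R T F"
proof
  interpret cohomological_graded_functor R T \<phi> F
    by (intro cohomological_graded_functor.intro cohomological_graded_functor_axioms.intro assms)
  assume "graded_representable R T \<phi> F"
  then obtain X \<tau> where X: "X \<in> Obj T" and \<tau>: "graded_natural_iso R T F (Ext_functor T \<phi> X) \<tau>"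
    unfolding graded_representable_def by blast
  show "locally_finite R T F"
    unfolding locally_finite_def
  proof
    fix Y assume Y: "Y \<in> Obj T"
    have "gmod_iso R (Fob F Y) (Ext T \<phi> Y X) (\<tau> Y)"
      using \<tau> Y by (simp add: graded_natural_iso_def Ext_functor_def)
    moreover have "gfin_gen R (Ext T \<phi> Y X)" using assms(6) X Y by (simp add: Ext_finite_def)
    \<comment> \<open>Finite generation is known for Ext and is carried to \<open>F\<close> along
      the inverse of \<open>\<tau> Y\<close>.\<close>
    ultimately show "gfin_gen R (Fob F Y)"
      using gmod_iso_gfin_gen[OF Ext_module[OF Y X] Fob_module[OF Y]] gmod_iso_inv[OF Fob_module[OF Y]] by blast
  qed
next
  interpret cohomological_graded_functor R T \<phi> F
    by (intro cohomological_graded_functor.intro cohomological_graded_functor_axioms.intro assms)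
  assume lf: "locally_finite R T F"
  obtain G n where G: "G \<in> Obj T" and "n \<ge> 1" "Obj T = thick T G n"
    using assms(5) unfolding strongly_generated_def by blast
  \<comment> \<open>\<open>n \<ge> 1\<close> excludes the meaningless \<open>thick T G 0\<close>,
    and \<open>k = n - 1\<close> is the index of \<open>approx\<close>.\<close>
  then obtain k where k: "Obj T = thick T G (Suc k)" by (cases n) auto
  have "gfin_gen R (Fob F G)" using lf G by (simp add: locally_finite_def)
  moreover have "gfin_gen R (Ext T \<phi> G A)" if "A \<in> Obj T" for A
    using assms(6) G that by (simp add: Ext_finite_def)
  ultimately obtain A x f where seq: "approximating_sequence T (\<lambda>X. gpart (Fob F X) 0) (\<lambda>h. Farr F h 0) G A x f"
    using deg0.approximating_sequence_exists[OF G approximation_start[OF G]]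
      approximation_step[OF assms(2) _ G] by blast
  interpret S: approximating_sequence T "\<lambda>X. gpart (Fob F X) 0" "\<lambda>h. Farr F h 0" G A x f by (rule seq)
  \<comment> \<open>One index \<open>k\<close> for all objects: this uniformity lets a single stage
    serve the whole category.\<close>
  have "S.approx k Y" if "Y \<in> Obj T" for Y using S.thick_approx k that by blast
  from S.representing_object[OF assms(7) this] obtain X c where X: "X \<in> Obj T" "c \<in> FC X 0"
    "\<And>Y. Y \<in> Obj T \<Longrightarrow> bij_betw (\<lambda>h. Farr F h 0 c) (hom_set T Y X) (FC Y 0)"
    by blast
  then show "graded_representable R T \<phi> F" by (rule representable_if_bijective)
qed

end
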